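(* Let $d\ge 3$ be an integer, $\mathbb F_d=\mathbb Q(\cos^2(\pi/d))\subset\mathbb R$, and let $\alpha$ be a totally real algebraic integer (a real number), $\mathbb K=\mathbb F_d(\alpha)$, such that $4<\alpha<16^2$ and $0<\sigma(\alpha)<\sigma(4\sin^2(\pi/d))$ for every field embedding $\sigma:\mathbb K\to\mathbb R$ other than the identity inclusion. Then $\mathbb K=\mathbb Q(\alpha)$, and such $\alpha$ can exist only for the values of $d$ listed below, with $m=[\mathbb K:\mathbb F_d]$ bounded as follows: $d=3$: $m\le47$; $d=4$: $m\le16$; $d=5$: $m\le10$; $d=6$: $m\le8$; $d=7$: $m\le10$; $d=8$: $m\le9$; $d=9$: $m\le5$; $d=10$: $m\le5$; $d=11$: $m\le4$; $d=12$: $m\le5$; $d=13$: $m\le3$; $d=14$: $m\le3$; $d=15$: $m\le2$; $d=16$: $m\le3$; $d=17$: $m\le2$; $d=18$: $m\le4$; $d=19$: $m\le2$; $d=20$: $m\le3$; $d=21$: $m\le2$; $d=22$: $m\le2$; $d=24$: $m\le3$; $d=26$: $m\le2$; $d=28$: $m\le2$; $d=30$: $m\le3$; $d=36$: $m\le2$; $d=42$: $m\le2$; and for $d\in\{23,25,27,29,31,32,33,34,35,38,39,40,44,45,46,48,50,52,54,56,58,60,62,64,66,70,72,78,80,84,90,96,102,120\}$ one has $m=1$, i.e. $\mathbb K=\mathbb F_d$. In particular $[\mathbb K:\mathbb Q]\le47$ for $d=3$, $[\mathbb K:\mathbb Q]\le30$ for $d=7$, $[\mathbb K:\mathbb Q]\le20$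 for $d=5,11$, $[\mathbb K:\mathbb Q]\le18$ for $d=8,13,19$, and $[\mathbb K:\mathbb Q]\le16$ for all remaining $d$.
   Context: All fields are regarded as subfields of $\mathbb R$; "the identity inclusion" is the given embedding $\mathbb K\subset\mathbb R$. *)

theory Defs
  imports "HOL-Analysis.Analysis" "HOL-Computational_Algebra.Polynomial"
begin

definition is_subfield :: "real set \<Rightarrow> bool" where
  "is_subfield K \<longleftrightarrow> 0 \<in> K \<and> 1 \<in> K \<and>
     (\<forall>x\<in>K. \<forall>y\<in>K. x + y \<in> K \<and> x * y \<in> K) \<and>
     (\<forall>x\<in>K. - x \<in> K) \<and> (\<forall>x\<in>K. x \<noteq> 0 \<longrightarrow> inverse x \<in> K)"

definition gen_field :: "real set \<Rightarrow> real set" where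
  "gen_field S = \<Inter>{K. is_subfield K \<and> S \<subseteq> K}"

text \<open>Field embeddings of a subfield K of R into R, resp. into C
  (only the values on K matter).\<close>
definition real_emb :: "real set \<Rightarrow> (real \<Rightarrow> real) \<Rightarrow> bool" where
  "real_emb K \<sigma> \<longleftrightarrow> \<sigma> 1 = 1 \<and>
     (\<forall>x\<in>K. \<forall>y\<in>K. \<sigma> (x + y) = \<sigma> x + \<sigma> y \<and> \<sigma> (x * y) = \<sigma> x * \<sigma> y)"

definition complex_emb :: "real set \<Rightarrow> (real \<Rightarrow> complex) \<Rightarrow> bool" where
  "complex_emb K \<sigma> \<longleftrightarrow> \<sigma> 1 = 1 \<and>
     (\<forall>x\<in>K. \<forall>y\<in>K. \<sigma> (x + y) = \<sigma> x + \<sigma> y \<and> \<sigma> (x * y) = \<sigma> x * \<sigma> y)"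

definition totally_real :: "real \<Rightarrow> bool" where
  "totally_real \<alpha> \<longleftrightarrow> algebraic \<alpha> \<and>
     (\<forall>\<sigma>. complex_emb (gen_field {\<alpha>}) \<sigma> \<longrightarrow> \<sigma> \<alpha> \<in> \<real>)"

text \<open>Degree [K:F] = dimension of K as an F-vector space
  (size of a smallest finite F-spanning set of K, i.e. of a basis).\<close>
definition fdeg :: "real set \<Rightarrow> real set \<Rightarrow> nat" where
  "fdeg K F = (LEAST n. \<exists>B. finite B \<and> B \<subseteq> K \<and> card B = n \<and>
      (\<forall>x\<in>K. \<exists>c. (\<forall>b\<in>B. c b \<in> F) \<and> x = (\<Sum>b\<in>B. c b * b)))"

definition Fd :: "nat \<Rightarrow> real set" where
  "Fd d = gen_field {cos (pi / real d) ^ 2}"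

definition mbound :: "nat \<Rightarrow> nat" where
  "mbound d = (if d = 3 then 47 else if d = 4 then 16 else if d = 5 then 10
     else if d = 6 then 8 else if d = 7 then 10 else if d = 8 then 9
     else if d = 9 then 5 else if d = 10 then 5 else if d = 11 then 4
     else if d = 12 then 5 else if d = 13 then 3 else if d = 14 then 3
     else if d = 15 then 2 else if d = 16 then 3 else if d = 17 then 2
     else if d = 18 then 4 else if d = 19 then 2 else if d = 20 then 3
     else if d = 21 then 2 else if d = 22 then 2 else if d = 24 then 3
     else if d = 26 then 2 else if d = 28 then 2 else if d = 30 then 3
     else if d = 36 then 2 else if d = 42 then 2 else 1)"

definition admissible_d :: "nat set" where
  "admissible_d = {3..22} \<union> {24, 26, 28, 30, 36, 42} \<union>
     {23,25,27,29,31,32,33,34,35,38,39,40,44,45,46,48,50,52,54,56,58,60,62,64,66,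
      70,72,78,80,84,90,96,102,120}"

definition qbound :: "nat \<Rightarrow> nat" where
  "qbound d = (if d = 3 then 47 else if d = 7 then 30 else if d \<in> {5, 11} then 20
     else if d \<in> {8, 13, 19} then 18 else 16)"

end

theory Submission
  imports Defs "HOL-Number_Theory.Residues" "HOL-Number_Theory.Prime_Powers"
    "HOL-Computational_Algebra.Field_as_Ring" "HOL-Library.Code_Binary_Nat"
    "Jordan_Normal_Form.Char_Poly"
begin

text \<open>
  Put \<open>s = 4 sin\<^sup>2(\<pi>/d)\<close> and \<open>n = [F\<^sub>d : \<rat>] = \<phi>(d)/2\<close>. The conjugates of \<open>s\<close> are the numbers
  \<open>4 sin\<^sup>2(\<pi>k/d)\<close> with \<open>k\<close> prime to \<open>d\<close>; each is taken by exactly \<open>m\<close> of the \<open>nm\<close> embeddings of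
  \<open>K\<close>, and their product is \<open>\<gamma> = exp (\<Lambda>(d))\<close>, which is \<open>p\<close> for a power of a prime \<open>p\<close> and
  \<open>1\<close> otherwise. Consider \<open>V = \<alpha> (\<alpha> - s)\<close>. At a nontrivial embedding \<open>\<sigma>\<close> with \<open>b = \<sigma>(s)\<close> one has
  \<open>0 < \<sigma>(\<alpha>) < b\<close>, hence \<open>\<sigma>(V) = - b\<^sup>2 w\<close> with \<open>0 \<le> w \<le> 1/4\<close>. Let \<open>q\<close> be an integral polynomial with
  \<open>q(V, s) \<noteq> 0\<close> and \<open>|q(- b\<^sup>2 w, b)| \<le> b\<^sup>k G\<close> for these \<open>w\<close>. As \<open>q(V, s)\<close> is an algebraic integer, its
  norm is at least \<open>1\<close> in absolute value; therefore \<open>s\<^sup>k G \<le> |q(V, s)| (\<gamma>\<^sup>k G\<^sup>n)\<^sup>m\<close>, which bounds \<open>m\<close> as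
  soon as \<open>\<gamma>\<^sup>k G\<^sup>n < 1\<close>.

  For most \<open>d\<close> the choice \<open>q(v, b) = v\<close>, \<open>k = 2\<close>, \<open>G = 1/4\<close> suffices. For the remaining \<open>d\<close>, mostly
  odd prime powers, one multiplies in further factors that are small for \<open>0 \<le> w \<le> 1/4\<close>, such as
  \<open>b\<^sup>2 + 4 v = b\<^sup>2 (1 - 4w)\<close>. For \<open>d = 3, 4, 5, 7\<close> factors \<open>r b\<^sup>2 + l v\<close> can be
  divided without losing integrality: by \<open>9\<close>, \<open>4\<close>, \<open>5\<close> in the first three cases, and by \<open>b\<^sup>2\<close> for
  \<open>d = 7\<close>, where \<open>7/b\<^sup>2\<close> is integral.

  A nontrivial embedding of \<open>K\<close> cannot fix \<open>\<alpha> > 4 \<ge> s\<close>, hence \<open>K = \<rat>(\<alpha>)\<close>.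
\<close>

hide_const (open) up_ring.coeff up_ring.monom Module.smult Coset.order

section \<open>Algebraic integers\<close>

global_interpretation int_module: Modules.module "\<lambda>k (x :: 'a::ring_1). of_int k * x"
  defines int_span = int_module.span
  by unfold_locales (simp_all add: algebra_simps)

lemma algebraic_int_if_int_eigenvector:
  fixes x :: "'a::field_char_0" and v :: "nat \<Rightarrow> 'a" and M :: "nat \<Rightarrow> nat \<Rightarrow> int"
  assumes eigen: "\<And>i. i < n \<Longrightarrow> x * v i = (\<Sum>j<n. of_int (M i j) * v j)"
    and nonzero: "k < n" "v k \<noteq> 0"
  shows "algebraic_int x"
proof -
  define A where "A = mat n n (\<lambda>(i, j). M i j)"
  have A: "A \<in> carrier_mat n n" by (simp add: A_def)
  let ?A = "map_mat of_int A :: 'a mat"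
  have "?A *\<^sub>v vec n v = x \<cdot>\<^sub>v vec n v"
    by (rule eq_vecI) (auto simp: A_def scalar_prod_def atLeast0LessThan eigen)
  moreover have "vec n v \<noteq> 0\<^sub>v n"
    using nonzero by (metis index_vec index_zero_vec(1))
  ultimately have "eigenvalue ?A x"
    using A unfolding eigenvalue_def eigenvector_def by (intro exI[of _ "vec n v"]) auto
  hence "poly (char_poly ?A) x = 0"
    using eigenvalue_root_char_poly[of ?A n x] A by simp
  hence "poly (map_poly of_int (char_poly A)) x = 0"
    by (simp add: of_int_hom.char_poly_hom[OF A])
  moreover have "lead_coeff (char_poly A) = 1" using degree_monic_char_poly[OF A] by simp
  ultimately show ?thesis unfolding algebraic_int_altdef_ipoly by blast
qed

lemma algebraic_int_if_int_span_stable: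
  fixes x :: "'a::field_char_0"
  assumes S: "finite S" "1 \<in> S" and stable: "\<And>v. v \<in> S \<Longrightarrow> x * v \<in> int_span S"
  shows "algebraic_int x"
proof -
  obtain v where v: "bij_betw v {..<card S} S"
    using ex_bij_betw_nat_finite[OF S(1)] by (auto simp: atLeast0LessThan)
  have "\<exists>c. x * v i = (\<Sum>j<card S. of_int (c j) * v j)" if i: "i < card S" for i
  proof -
    have "x * v i \<in> int_span S" using stable bij_betwE[OF v] i by blast
    then obtain u where "x * v i = (\<Sum>w\<in>S. of_int (u w) * w)"
      using int_module.span_finite[OF S(1)] by auto
    also have "\<dots> = (\<Sum>j<card S. of_int (u (v j)) * v j)"
      using sum.reindex_bij_betw[OF v, of "\<lambda>w. of_int (u w) * w"] by simp
    finally show ?thesis by (rule exI[of _ "\<lambda>j. u (v j)"])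
  qed
  then obtain M where "\<And>i. i < card S \<Longrightarrow> x * v i = (\<Sum>j<card S. of_int (M i j) * v j)"
    by metis
  moreover obtain k where "k < card S" "v k = 1"
    using S(2) bij_betw_imp_surj_on[OF v] by (metis imageE lessThan_iff)
  ultimately show ?thesis by (intro algebraic_int_if_int_eigenvector[of "card S" x v M k]) auto
qed

lemma algebraic_int_power_relation:
  fixes x :: "'a::field_char_0"
  assumes "algebraic_int x"
  obtains n c where "n > 0" "x ^ n = (\<Sum>i<n. of_int (c i) * x ^ i)"
proof -
  obtain p where p: "poly (map_poly of_int p) x = 0" "lead_coeff p = 1"
    using assms algebraic_int_altdef_ipoly by blast
  have "degree p \<noteq> 0"
  proof
    assume "degree p = 0"
    hence "p = 1" using p(2) degree0_coeffs[of p] by (auto simp: one_pCons)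
    thus False using p(1) by simp
  qed
  moreover have "(\<Sum>i<degree p. of_int (coeff p i) * x ^ i) + x ^ degree p = 0"
    using p by (simp add: poly_altdef lessThan_Suc_atMost[symmetric])
  hence "x ^ degree p = (\<Sum>i<degree p. of_int (- coeff p i) * x ^ i)"
    by (simp add: sum_negf eq_neg_iff_add_eq_0 add.commute)
  ultimately show ?thesis using that[of "degree p" "\<lambda>i. - coeff p i"] by simp
qed

definition power_products :: "'a::comm_ring_1 \<Rightarrow> nat \<Rightarrow> 'a \<Rightarrow> nat \<Rightarrow> 'a set" where
  "power_products x n y m = (\<lambda>(i, j). x ^ i * y ^ j) ` ({..<n} \<times> {..<m})"

lemma power_productsI: "i < n \<Longrightarrow> j < m \<Longrightarrow> x ^ i * y ^ j \<in> power_products x n y m"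
  by (auto simp: power_products_def)

lemma power_products_commute: "power_products x n y m = power_products y m x n"
  by (force simp: power_products_def mult.commute)

lemma power_products_stable:
  assumes n: "x ^ n = (\<Sum>i<n. of_int (c i) * x ^ i)" and v: "v \<in> power_products x n y m"
  shows "x * v \<in> int_span (power_products x n y m)"
proof -
  obtain i j where ij: "v = x ^ i * y ^ j" "i < n" "j < m"
    using v by (auto simp: power_products_def)
  have xv: "x * v = x ^ Suc i * y ^ j" using ij(1) by (simp add: mult.assoc)
  show ?thesis
  proof (cases "Suc i < n")
    case True
    thus ?thesis unfolding xv by (intro int_module.span_base power_productsI ij)
  next
    case False
    hence "x * v = x ^ n * y ^ j" using xv ij(2) by (metis Suc_lessI)
    also have "\<dots> = (\<Sum>i<n. of_int (c i) * (x ^ i * y ^ j))"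
      by (simp add: n sum_distrib_right mult.assoc)
    also have "\<dots> \<in> int_span (power_products x n y m)"
      using ij(3)
      by (intro int_module.span_sum int_module.span_scale int_module.span_base power_productsI) auto
    finally show ?thesis .
  qed
qed

lemma algebraic_int_common_stable_module:
  fixes x y :: "'a::field_char_0"
  assumes "algebraic_int x" "algebraic_int y"
  obtains S where "finite S" "1 \<in> S" "\<And>v. v \<in> S \<Longrightarrow> x * v \<in> int_span S"
    "\<And>v. v \<in> S \<Longrightarrow> y * v \<in> int_span S"
proof -
  obtain n c where n: "n > 0" "x ^ n = (\<Sum>i<n. of_int (c i) * x ^ i)"
    using algebraic_int_power_relation[OF assms(1)] by blast
  obtain m e where m: "m > 0" "y ^ m = (\<Sum>j<m. of_int (e j) * y ^ j)"
    using algebraic_int_power_relation[OF assms(2)] by blast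
  show ?thesis
  proof (rule that[of "power_products x n y m"])
    show "finite (power_products x n y m)" by (simp add: power_products_def)
    show "1 \<in> power_products x n y m" using power_productsI[OF n(1) m(1), of x y] by simp
    show "x * v \<in> int_span (power_products x n y m)" if "v \<in> power_products x n y m" for v
      using power_products_stable[OF n(2) that] .
    show "y * v \<in> int_span (power_products x n y m)" if "v \<in> power_products x n y m" for v
      using power_products_stable[OF m(2), of v x n] that by (simp add: power_products_commute)
  qed
qed

lemma algebraic_int_plus:
  fixes x y :: "'a::field_char_0"
  assumes "algebraic_int x" "algebraic_int y"
  shows "algebraic_int (x + y)"
proof -
  obtain S where S: "finite S" "1 \<in> S" "\<And>v. v \<in> S \<Longrightarrow> x * v \<in> int_span S"
    "\<And>v. v \<in> S \<Longrightarrow> y * v \<in> int_span S"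
    using algebraic_int_common_stable_module[OF assms] by blast
  have "(x + y) * v \<in> int_span S" if "v \<in> S" for v
    using int_module.span_add[OF S(3,4)[OF that]] by (simp add: distrib_right)
  thus ?thesis by (rule algebraic_int_if_int_span_stable[OF S(1,2)])
qed

lemma algebraic_int_times:
  fixes x y :: "'a::field_char_0"
  assumes "algebraic_int x" "algebraic_int y"
  shows "algebraic_int (x * y)"
proof -
  obtain S where S: "finite S" "1 \<in> S" "\<And>v. v \<in> S \<Longrightarrow> x * v \<in> int_span S"
    "\<And>v. v \<in> S \<Longrightarrow> y * v \<in> int_span S"
    using algebraic_int_common_stable_module[OF assms] by blast
  have "x * u \<in> int_span S" if "u \<in> int_span S" for u
    using that
  proof (induction rule: int_module.span_induct_alt)
    case base
    show ?case by (simp add: int_module.span_zero)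
  next
    case (step k v u)
    have "of_int k * (x * v) + x * u \<in> int_span S"
      by (intro int_module.span_add int_module.span_scale S(3) step)
    thus ?case by (simp add: algebra_simps)
  qed
  hence "(x * y) * v \<in> int_span S" if "v \<in> S" for v
    using S(4)[OF that] by (simp add: mult.assoc)
  thus ?thesis by (rule algebraic_int_if_int_span_stable[OF S(1,2)])
qed

lemma algebraic_int_diff:
  fixes x y :: "'a::field_char_0"
  shows "algebraic_int x \<Longrightarrow> algebraic_int y \<Longrightarrow> algebraic_int (x - y)"
  using algebraic_int_plus[of x "- y"] by simp

lemma algebraic_int_prod:
  fixes f :: "'b \<Rightarrow> 'a::field_char_0"
  shows "(\<And>i. i \<in> I \<Longrightarrow> algebraic_int (f i)) \<Longrightarrow> algebraic_int (prod f I)"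
  by (induction I rule: infinite_finite_induct) (auto intro: algebraic_int_times)

lemma algebraic_int_sum:
  fixes f :: "'b \<Rightarrow> 'a::field_char_0"
  shows "(\<And>i. i \<in> I \<Longrightarrow> algebraic_int (f i)) \<Longrightarrow> algebraic_int (sum f I)"
  by (induction I rule: infinite_finite_induct) (auto intro: algebraic_int_plus)

lemma algebraic_int_power:
  fixes x :: "'a::field_char_0"
  shows "algebraic_int x \<Longrightarrow> algebraic_int (x ^ n)"
  by (induction n) (auto intro: algebraic_int_times)

lemma algebraic_int_poly_of_int:
  fixes x :: "'a::field_char_0"
  shows "algebraic_int x \<Longrightarrow> algebraic_int (poly (map_poly of_int p) x)"
  by (auto simp: poly_altdef intro!: algebraic_int_sum algebraic_int_times algebraic_int_power)

section \<open>Minimal polynomials and conjugates\<close>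

abbreviation rpoly :: "rat poly \<Rightarrow> 'a::field_char_0 \<Rightarrow> 'a" where
  "rpoly p x \<equiv> poly (map_poly of_rat p) x"

context
  fixes x :: "'a::field_char_0"
begin

interpretation m: map_poly_comm_ring_hom "of_rat :: rat \<Rightarrow> 'a" ..

lemma rpoly_add: "rpoly (p + q) x = rpoly p x + rpoly q x"
  by (simp add: m.hom_add)

lemma rpoly_diff: "rpoly (p - q) x = rpoly p x - rpoly q x"
  by (simp add: m.hom_minus)

lemma rpoly_mult: "rpoly (p * q) x = rpoly p x * rpoly q x"
  by (simp add: m.hom_mult)

lemma rpoly_pcompose: "rpoly (pcompose p q) x = rpoly p (rpoly q x)"
  by (simp add: of_rat_hom.map_poly_pcompose poly_pcompose)

lemma rpoly_const: "rpoly [:c:] x = of_rat c"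
  by (simp add: of_rat_hom.map_poly_pCons_hom)

lemma rpoly_X: "rpoly [:0, 1:] x = x"
  by (simp add: of_rat_hom.map_poly_pCons_hom)

end

lemma rpoly_of_int_poly: "rpoly (map_poly of_int p) x = poly (map_poly of_int p) x"
proof -
  have "map_poly of_rat (map_poly of_int p) = (map_poly of_int p :: 'a poly)"
    by (intro poly_eqI) (simp add: coeff_map_poly)
  thus ?thesis by simp
qed

lemma of_real_of_rat: "complex_of_real (of_rat r) = of_rat r"
  by (cases r) (simp add: of_rat_rat)

lemma map_poly_of_real_of_rat: "map_poly complex_of_real (map_poly of_rat p) = map_poly of_rat p"
  by (intro poly_eqI) (simp add: coeff_map_poly of_real_of_rat)

lemma rpoly_of_real: "rpoly p (complex_of_real x) = complex_of_real (rpoly p x)"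
  by (metis map_poly_of_real_of_rat of_real_hom.poly_map_poly)

definition is_minpoly :: "rat poly \<Rightarrow> 'a::field_char_0 \<Rightarrow> bool" where
  "is_minpoly f x \<longleftrightarrow> lead_coeff f = 1 \<and> irreducible f \<and> rpoly f x = 0"

lemma is_minpolyD:
  assumes "is_minpoly f x"
  shows "lead_coeff f = 1" "irreducible f" "rpoly f x = 0"
  using assms by (auto simp: is_minpoly_def)

lemma is_minpoly_degree_pos: "is_minpoly f x \<Longrightarrow> degree f > 0"
  using is_unit_iff_degree[of f] by (auto simp: is_minpoly_def irreducible_def)

lemma irreducible_imp_bezout:
  assumes "irreducible (f :: rat poly)" "\<not> f dvd g"
  obtains a b where "a * f + b * g = 1"
proof -
  have "coprime f g"
    using assms by (intro prime_elem_imp_coprime field_poly_irreducible_imp_prime)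
  thus ?thesis using that bezout_coefficients_fst_snd[of f g] by (metis coprime_imp_gcd_eq_1)
qed

lemma is_minpoly_dvd_iff:
  assumes f: "is_minpoly f x"
  shows "f dvd g \<longleftrightarrow> rpoly g x = 0"
proof
  show "f dvd g" if "rpoly g x = 0"
  proof (rule ccontr)
    assume "\<not> f dvd g"
    then obtain a b where "a * f + b * g = 1"
      by (rule irreducible_imp_bezout[OF is_minpolyD(2)[OF f]])
    moreover have "rpoly (a * f + b * g) x = 0"
      using that is_minpolyD(3)[OF f] by (simp add: rpoly_add rpoly_mult)
    ultimately show False by simp
  qed
qed (use is_minpolyD(3)[OF f] in \<open>auto simp: rpoly_mult\<close>)

lemma rpoly_prod_mset_eq_0: "rpoly (prod_mset A) x = 0 \<Longrightarrow> \<exists>p\<in>#A. rpoly p x = 0"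
  by (induction A) (auto simp: rpoly_mult)

lemma is_minpoly_exists:
  assumes "algebraic x"
  obtains f where "is_minpoly f x"
proof -
  obtain p :: "int poly" where p: "p \<noteq> 0" "poly (map_poly of_int p) x = 0"
    using assms by (rule algebraicE')
  define P where "P = map_poly rat_of_int p"
  have P: "P \<noteq> 0" "rpoly P x = 0" using p by (simp_all add: P_def rpoly_of_int_poly)
  have "P dvd prod_mset (prime_factorization P)"
    using prod_mset_prime_factorization_weak[OF P(1)] by (metis dvd_normalize_iff dvd_refl)
  hence "rpoly (prod_mset (prime_factorization P)) x = 0"
    using P(2) by (auto simp: rpoly_mult)
  then obtain f where f: "f \<in> prime_factors P" "rpoly f x = 0"
    using rpoly_prod_mset_eq_0 by blast
  hence "prime f" by auto
  hence "irreducible f" "normalize f = f" "f \<noteq> 0"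
    by (auto intro: prime_elem_imp_irreducible)
  moreover from this have "unit_factor f = 1" by (metis unit_factor_normalize)
  hence "lead_coeff f = 1" by (simp add: unit_factor_poly_def one_pCons)
  ultimately show ?thesis using f(2) that unfolding is_minpoly_def by blast
qed

lemma rpoly_inverse:
  assumes "algebraic x" "rpoly h x \<noteq> 0"
  obtains k where "inverse (rpoly h x) = rpoly k x"
proof -
  obtain f where f: "is_minpoly f x" using is_minpoly_exists[OF assms(1)] .
  have "\<not> f dvd h" using assms(2) is_minpoly_dvd_iff[OF f] by simp
  then obtain a k where "a * f + k * h = 1"
    by (rule irreducible_imp_bezout[OF is_minpolyD(2)[OF f]])
  hence "rpoly (a * f + k * h) x = 1" by simp
  hence "rpoly k x * rpoly h x = 1"
    using is_minpolyD(3)[OF f] by (simp add: rpoly_add rpoly_mult)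
  hence "inverse (rpoly h x) = rpoly k x" by (intro inverse_unique) (simp add: mult.commute)
  thus ?thesis by (rule that)
qed

definition conjs :: "'a::field_char_0 \<Rightarrow> complex set" where
  "conjs x = {z. \<forall>p. rpoly p x = 0 \<longrightarrow> rpoly p z = 0}"

lemma conjsD: "z \<in> conjs x \<Longrightarrow> rpoly p x = 0 \<Longrightarrow> rpoly p z = 0"
  by (simp add: conjs_def)

lemma self_in_conjs: "z \<in> conjs z"
  by (simp add: conjs_def)

lemma conjs_of_real [simp]: "conjs (complex_of_real x) = conjs x"
  by (simp only: conjs_def rpoly_of_real of_real_eq_0_iff)

lemma of_real_in_conjs: "complex_of_real x \<in> conjs x"
  using self_in_conjs[of "complex_of_real x"] by simp

lemma conjs_eq_roots:
  assumes "is_minpoly f x"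
  shows "conjs x = {z. rpoly f z = 0}"
proof (intro subset_antisym subsetI CollectI)
  fix z :: complex assume "z \<in> {z. rpoly f z = 0}"
  hence "is_minpoly f z" using assms by (simp add: is_minpoly_def)
  thus "z \<in> conjs x"
    unfolding conjs_def by (simp flip: is_minpoly_dvd_iff[OF assms] is_minpoly_dvd_iff[of f z])
qed (use conjsD is_minpolyD(3)[OF assms] in blast)

lemma is_minpoly_conj:
  assumes "is_minpoly f x" "z \<in> conjs x"
  shows "is_minpoly f z"
  using assms conjsD unfolding is_minpoly_def by blast

lemma int_poly_conj_root:
  assumes "z \<in> conjs x" "poly (map_poly of_int p) x = 0"
  shows "poly (map_poly of_int p) z = 0"
  using conjsD[OF assms(1), of "map_poly of_int p"] assms(2) unfolding rpoly_of_int_poly .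

lemma algebraic_int_conj:
  assumes "algebraic_int x" "z \<in> conjs x"
  shows "algebraic_int z"
  using assms int_poly_conj_root unfolding algebraic_int_altdef_ipoly by blast

lemma conjs_conj:
  assumes "algebraic x" "z \<in> conjs x"
  shows "conjs z = conjs x"
proof -
  obtain f where f: "is_minpoly f x" using is_minpoly_exists[OF assms(1)] .
  show ?thesis unfolding conjs_eq_roots[OF f] conjs_eq_roots[OF is_minpoly_conj[OF f assms(2)]] ..
qed

lemma rpoly_in_conjs: "z \<in> conjs x \<Longrightarrow> rpoly h z \<in> conjs (rpoly h x)"
  using conjsD[of z x "pcompose p h" for p] by (simp add: conjs_def rpoly_pcompose)

lemma rpoly_eq_conj: "z \<in> conjs x \<Longrightarrow> rpoly h x = rpoly k x \<Longrightarrow> rpoly h z = rpoly k z"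
  using conjsD[of z x "h - k"] by (simp add: rpoly_diff)

lemma is_minpoly_rsquarefree:
  fixes x :: "'a::field_char_0"
  assumes f: "is_minpoly f x"
  shows "rsquarefree (map_poly of_rat f :: complex poly)"
  unfolding rsquarefree_roots
proof (intro allI notI, elim conjE)
  fix z :: complex assume z: "rpoly f z = 0" "poly (pderiv (map_poly of_rat f)) z = 0"
  have "is_minpoly f z" using f z(1) by (simp add: is_minpoly_def)
  moreover have "rpoly (pderiv f) z = 0" using z(2) by (simp add: of_rat_hom.map_poly_pderiv)
  ultimately have "f dvd pderiv f" using is_minpoly_dvd_iff by blast
  moreover have "pderiv f \<noteq> 0" using is_minpoly_degree_pos[OF f] by (simp add: pderiv_eq_0_iff)
  ultimately have "degree f \<le> degree (pderiv f)" by (intro dvd_imp_degree_le)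
  thus False using is_minpoly_degree_pos[OF f] unfolding degree_pderiv by simp
qed

lemma of_rat_minpoly_nonzero: "is_minpoly f x \<Longrightarrow> (map_poly of_rat f :: complex poly) \<noteq> 0"
  by (auto simp: is_minpoly_def)

lemma finite_conjs:
  assumes "algebraic x"
  shows "finite (conjs x)"
proof -
  obtain f where "is_minpoly f x" using is_minpoly_exists[OF assms] .
  thus ?thesis using poly_roots_finite of_rat_minpoly_nonzero conjs_eq_roots by metis
qed

lemma card_conjs:
  assumes f: "is_minpoly f x"
  shows "card (conjs x) = degree f"
  using is_minpoly_rsquarefree[OF f] rsquarefree_card_degree[OF of_rat_minpoly_nonzero[OF f]]
  by (simp add: conjs_eq_roots[OF f])

lemma minpoly_eq_prod_conjs:
  assumes f: "is_minpoly f x"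
  shows "map_poly of_rat f = (\<Prod>z\<in>conjs x. [:- z, 1:])"
  using complex_poly_decompose_rsquarefree[OF is_minpoly_rsquarefree[OF f]] is_minpolyD(1)[OF f]
  by (simp add: conjs_eq_roots[OF f])

section \<open>The characteristic polynomial of multiplication\<close>

lemma det_vandermonde_nonzero:
  fixes z :: "nat \<Rightarrow> 'a::field"
  assumes inj: "inj_on z {..<n}"
  shows "det (mat n n (\<lambda>(i, j). z i ^ j)) \<noteq> 0"
proof
  let ?V = "mat n n (\<lambda>(i, j). z i ^ j)"
  assume "det ?V = 0"
  then obtain v where v: "v \<in> carrier_vec n" "v \<noteq> 0\<^sub>v n" "?V *\<^sub>v v = 0\<^sub>v n"
    using det_0_iff_vec_prod_zero_field[of ?V n] by auto
  define p where "p = (\<Sum>j<n. monom (v $ j) j)"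
  have "poly p (z i) = 0" if i: "i < n" for i
  proof -
    have "poly p (z i) = (?V *\<^sub>v v) $ i"
      using i v(1) by (auto simp: p_def poly_sum poly_monom scalar_prod_def atLeast0LessThan
          mult.commute intro!: sum.cong)
    thus ?thesis using v(3) i by simp
  qed
  hence roots: "z ` {..<n} \<subseteq> {x. poly p x = 0}" by auto
  have p: "p \<noteq> 0"
  proof
    assume "p = 0"
    moreover have "coeff p j = v $ j" if "j < n" for j
      using that by (simp add: p_def coeff_sum)
    ultimately show False using v(1,2) by (auto simp: vec_eq_iff)
  qed
  have "n \<noteq> 0" using v(1,2) by (intro notI) auto
  moreover have "degree p \<le> n - 1"
    unfolding p_def by (intro degree_sum_le) (auto intro: order.trans[OF degree_monom_le])
  moreover have "card (z ` {..<n}) \<le> degree p"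
    using card_mono[OF poly_roots_finite[OF p] roots] card_poly_roots_bound[OF p] by linarith
  ultimately show False using card_image[OF inj] by simp
qed

definition mult_matrix :: "rat poly \<Rightarrow> rat poly \<Rightarrow> rat mat" where
  "mult_matrix f h = mat (degree f) (degree f) (\<lambda>(j, k). coeff ((h * monom 1 j) mod f) k)"

lemma mult_matrix_carrier: "mult_matrix f h \<in> carrier_mat (degree f) (degree f)"
  by (simp add: mult_matrix_def)

lemma rpoly_mod:
  assumes "rpoly f z = 0"
  shows "rpoly (g mod f) z = rpoly g z"
  using rpoly_add[of "f * (g div f)" "g mod f" z] assms by (simp add: rpoly_mult)

lemma rpoly_eq_sum:
  assumes "degree p < n"
  shows "rpoly p z = (\<Sum>k<n. of_rat (coeff p k) * z ^ k)"
proof -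
  have "rpoly p z = (\<Sum>k\<le>degree p. of_rat (coeff p k) * z ^ k)" by (simp add: poly_altdef)
  also have "\<dots> = (\<Sum>k<n. of_rat (coeff p k) * z ^ k)"
    using assms by (intro sum.mono_neutral_left) (auto simp: coeff_eq_0)
  finally show ?thesis .
qed

lemma mult_matrix_eigenvector:
  assumes f: "is_minpoly f x" and z: "z \<in> conjs x"
  shows "(\<Sum>k<degree f. of_rat (coeff ((h * monom 1 j) mod f) k) * z ^ k) = rpoly h z * z ^ j"
proof -
  have "degree ((h * monom 1 j) mod f) < degree f"
    using is_minpoly_degree_pos[OF f] by (metis degree_0 degree_mod_less' less_irrefl)
  moreover have "rpoly f z = 0" using z by (simp add: conjs_eq_roots[OF f])
  ultimately show ?thesis
    by (simp add: rpoly_mod rpoly_mult poly_monom flip: rpoly_eq_sum)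
qed

text \<open>Conjugating by the Vandermonde matrix of the conjugates of \<open>x\<close> diagonalizes the matrix of
  multiplication by \<open>h(x)\<close> in the basis of powers of \<open>x\<close>.\<close>

lemma mult_matrix_similar_diagonal:
  fixes z :: "nat \<Rightarrow> complex"
  assumes f: "is_minpoly f x" and z: "bij_betw z {..<degree f} (conjs x)"
  shows "similar_mat (map_mat of_rat (mult_matrix f h))
    (mat (degree f) (degree f) (\<lambda>(i, j). if i = j then rpoly h (z i) else 0))"
    (is "similar_mat ?M ?D")
proof -
  define n where "n = degree f"
  define V where "V = mat n n (\<lambda>(k, i). z i ^ k)"
  have carrier: "?M \<in> carrier_mat n n" "V \<in> carrier_mat n n" "?D \<in> carrier_mat n n"
    by (auto simp: mult_matrix_def V_def n_def)
  have eigen: "(\<Sum>k<n. of_rat (coeff ((h * monom 1 j) mod f) k) * z i ^ k) = rpoly h (z i) * z i ^ j"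
    if "i < n" for i j
    using mult_matrix_eigenvector[OF f bij_betwE[OF z, rule_format]] that by (simp add: n_def)
  have diag: "(\<Sum>k<n. z k ^ j * (if k = i then rpoly h (z k) else 0)) = rpoly h (z i) * z i ^ j"
    if "i < n" for i j
    using that by (simp add: if_distrib[of "(*) _"] mult.commute cong: if_cong)
  have MV: "?M * V = V * ?D"
    by (rule eq_matI) (auto simp: mult_matrix_def V_def scalar_prod_def atLeast0LessThan eigen diag
        simp flip: n_def)
  have "transpose_mat V = mat n n (\<lambda>(i, j). z i ^ j)"
    by (auto simp: V_def)
  hence "det V \<noteq> 0"
    using det_vandermonde_nonzero[of z n] z det_transpose[OF carrier(2)]
    by (auto simp: bij_betw_def n_def)
  hence "V \<in> Units (ring_mat TYPE(complex) n True)"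
    by (rule det_non_zero_imp_unit[OF carrier(2)])
  then obtain W where W: "W \<in> carrier_mat n n" "W * V = 1\<^sub>m n" "V * W = 1\<^sub>m n"
    by (auto simp: Units_def ring_mat_def)
  have "?M = ?M * (V * W)" unfolding W(3) by (rule right_mult_one_mat[OF carrier(1), symmetric])
  also have "\<dots> = ?M * V * W" by (rule assoc_mult_mat[OF carrier(1,2) W(1), symmetric])
  also have "\<dots> = V * ?D * W" unfolding MV ..
  finally have "similar_mat_wit ?M ?D V W"
    by (rule similar_mat_witI[OF W(3,2) _ carrier(1,3,2) W(1)])
  thus ?thesis unfolding similar_mat_def by blast
qed

lemma char_poly_mult_matrix:
  assumes f: "is_minpoly f x"
  shows "map_poly of_rat (char_poly (mult_matrix f h)) = (\<Prod>z\<in>conjs x. [:- rpoly h z, 1:])"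
proof -
  have fin: "finite (conjs x)"
    using is_minpoly_degree_pos[OF f] card_conjs[OF f] by (metis card.infinite less_irrefl)
  obtain z where z: "bij_betw z {..<degree f} (conjs x)"
    using ex_bij_betw_nat_finite[OF fin] by (auto simp: atLeast0LessThan card_conjs[OF f])
  define D where "D = mat (degree f) (degree f) (\<lambda>(i, j). if i = j then rpoly h (z i) else 0)"
  have "map_poly of_rat (char_poly (mult_matrix f h)) =
      char_poly (map_mat complex_of_rat (mult_matrix f h))"
    by (rule of_rat_hom.char_poly_hom[OF mult_matrix_carrier, symmetric])
  also have "\<dots> = char_poly D"
    using mult_matrix_similar_diagonal[OF f z] unfolding D_def by (rule char_poly_similar)
  also have "\<dots> = (\<Prod>a\<leftarrow>diag_mat D. [:- a, 1:])"
    by (rule char_poly_upper_triangular[of _ "degree f"]) (auto simp: D_def)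
  also have "\<dots> = (\<Prod>i<degree f. [:- rpoly h (z i), 1:])"
    by (simp add: diag_mat_def D_def prod.list_conv_set_nth atLeast0LessThan)
  also have "\<dots> = (\<Prod>z\<in>conjs x. [:- rpoly h z, 1:])"
    by (rule prod.reindex_bij_betw[OF z])
  finally show ?thesis .
qed

lemma rat_poly_eq_minpoly_power:
  assumes f: "is_minpoly f x"
    and "lead_coeff g = 1" "\<And>z::complex. rpoly g z = 0 \<Longrightarrow> z \<in> conjs x"
  shows "\<exists>k. g = f ^ k"
  using assms(2,3)
proof (induction "degree g" arbitrary: g rule: less_induct)
  case (less g)
  show ?case
  proof (cases "degree g = 0")
    case True
    hence "g = f ^ 0" using less.prems(1) degree0_coeffs[of g] by (auto simp: one_pCons)
    thus ?thesis ..
  next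
    case False
    hence "\<not> constant (poly (map_poly of_rat g :: complex poly))"
      by (simp add: constant_degree)
    then obtain z :: complex where z: "rpoly g z = 0"
      using fundamental_theorem_of_algebra by blast
    hence "is_minpoly f z" using is_minpoly_conj[OF f] less.prems(2) by blast
    then obtain q where q: "g = f * q" using z is_minpoly_dvd_iff by (blast elim: dvdE)
    have lead: "lead_coeff q = 1"
      using less.prems(1) is_minpolyD(1)[OF f] by (simp add: q lead_coeff_mult)
    hence "q \<noteq> 0" "f \<noteq> 0" using is_minpolyD(1)[OF f] by auto
    hence "degree q < degree g"
      using is_minpoly_degree_pos[OF f] by (simp add: q degree_mult_eq)
    moreover have "y \<in> conjs x" if "rpoly q y = 0" for y
      using less.prems(2) that by (simp add: q rpoly_mult)
    ultimately obtain k where "q = f ^ k" using less.hyps lead by blast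
    hence "g = f ^ Suc k" using q by simp
    thus ?thesis ..
  qed
qed

lemma order_prod_linear:
  fixes c :: "'b \<Rightarrow> 'a::field"
  assumes "finite A"
  shows "order y (\<Prod>a\<in>A. [:- c a, 1:]) = card {a\<in>A. c a = y}"
  using assms
proof (induction A)
  case empty
  show ?case by (simp add: order_0I)
next
  case (insert a A)
  have "[:- c a, 1:] * (\<Prod>a\<in>A. [:- c a, 1:]) \<noteq> 0"
    using insert.hyps by (intro no_zero_divisors) (simp_all add: prod_zero_iff)
  hence "order y ([:- c a, 1:] * (\<Prod>a\<in>A. [:- c a, 1:])) =
      (if c a = y then 1 else 0) + card {b\<in>A. c b = y}"
    by (subst order_mult) (auto simp: order_linear' insert.IH)
  moreover have "{b \<in> insert a A. c b = y} =
      (if c a = y then insert a {b\<in>A. c b = y} else {b\<in>A. c b = y})"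
    by auto
  ultimately show ?case using insert.hyps by (simp add: prod.insert del: mult_pCons_left)
qed

lemma order_power:
  fixes p :: "'a::field poly"
  assumes "p \<noteq> 0"
  shows "order y (p ^ k) = k * order y p"
  using assms by (induction k) (auto simp: order_mult order_0I)

lemma algebraic_rpoly:
  assumes x: "algebraic x"
  shows "algebraic (rpoly h x)"
proof -
  obtain f where f: "is_minpoly f x" using is_minpoly_exists[OF x] .
  define c where "c = char_poly (mult_matrix f h)"
  have c_eq: "map_poly of_rat c = (\<Prod>z\<in>conjs x. [:- rpoly h z, 1:])"
    unfolding c_def by (rule char_poly_mult_matrix[OF f])
  have "conjs x \<noteq> {}" using card_conjs[OF f] is_minpoly_degree_pos[OF f] by auto
  then obtain z where z: "z \<in> conjs x" by blast
  hence "rpoly c (rpoly h z) = 0" using finite_conjs[OF x] by (auto simp: c_eq poly_prod)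
  hence "f dvd pcompose c h"
    using is_minpoly_dvd_iff[OF is_minpoly_conj[OF f z]] by (simp add: rpoly_pcompose)
  hence "rpoly c (rpoly h x) = 0"
    using is_minpoly_dvd_iff[OF f] by (simp add: rpoly_pcompose)
  moreover have "c \<noteq> 0" using c_eq finite_conjs[OF x] by (auto simp: prod_zero_iff)
  ultimately show ?thesis
    by (intro algebraicI'[of "map_poly of_rat c"]) (simp_all add: coeff_map_poly)
qed

lemma card_conj_fibres:
  assumes x: "algebraic x"
  obtains m where "m > 0"
    "\<And>y. y \<in> conjs (rpoly h x) \<Longrightarrow> card {z\<in>conjs x. rpoly h z = y} = m"
proof -
  interpret m: map_poly_comm_ring_hom "of_rat :: rat \<Rightarrow> complex" ..
  note fin = finite_conjs[OF x]
  obtain f where f: "is_minpoly f x" using is_minpoly_exists[OF x] .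
  obtain g where g: "is_minpoly g (rpoly h x)" using is_minpoly_exists[OF algebraic_rpoly[OF x]] .
  define c where "c = char_poly (mult_matrix f h)"
  have c_eq: "map_poly of_rat c = (\<Prod>z\<in>conjs x. [:- rpoly h z, 1:])"
    unfolding c_def by (rule char_poly_mult_matrix[OF f])
  have roots: "rpoly c y = 0 \<longleftrightarrow> y \<in> rpoly h ` conjs x" for y
    using fin by (auto simp: c_eq poly_prod)
  hence "y \<in> conjs (rpoly h x)" if "rpoly c y = 0" for y
    using that rpoly_in_conjs by auto
  moreover have "lead_coeff c = 1"
    unfolding c_def using degree_monic_char_poly[OF mult_matrix_carrier] by simp
  ultimately obtain m where m: "c = g ^ m"
    using rat_poly_eq_minpoly_power[OF g, of c] by metis
  have "card {z\<in>conjs x. rpoly h z = y} = m" if y: "y \<in> conjs (rpoly h x)" for y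
  proof -
    have "card {z\<in>conjs x. rpoly h z = y} = order y (map_poly of_rat c)"
      unfolding c_eq by (rule order_prod_linear[OF fin, symmetric])
    also have "\<dots> = m * order y (map_poly of_rat g :: complex poly)"
      by (simp add: m m.hom_power order_power of_rat_minpoly_nonzero[OF g])
    also have "order y (map_poly of_rat g :: complex poly) = 1"
      using y rsquarefree_root_order[OF is_minpoly_rsquarefree[OF g] _ of_rat_minpoly_nonzero[OF g]]
      by (simp add: conjs_eq_roots[OF g])
    finally show ?thesis by simp
  qed
  moreover have "m \<noteq> 0"
  proof
    assume "m = 0"
    hence "conjs x = {}" using roots by (auto simp: m)
    thus False using card_conjs[OF f] is_minpoly_degree_pos[OF f] by simp
  qed
  ultimately show ?thesis using that by blast
qed

lemma conjs_rpoly: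
  assumes "algebraic x"
  shows "conjs (rpoly h x) = rpoly h ` conjs x"
proof
  obtain m where m: "m > 0" "\<And>y. y \<in> conjs (rpoly h x) \<Longrightarrow> card {z\<in>conjs x. rpoly h z = y} = m"
    using card_conj_fibres[OF assms, of h] by blast
  show "conjs (rpoly h x) \<subseteq> rpoly h ` conjs x"
  proof
    fix y assume "y \<in> conjs (rpoly h x)"
    hence "{z\<in>conjs x. rpoly h z = y} \<noteq> {}" using m by (metis card.empty less_irrefl)
    thus "y \<in> rpoly h ` conjs x" by blast
  qed
qed (auto intro: rpoly_in_conjs)

lemma prod_equal_fibres:
  fixes f :: "'b \<Rightarrow> 'c::comm_semiring_1"
  assumes "finite A" "finite B" "g ` A \<subseteq> B" and fibres: "\<And>y. y \<in> B \<Longrightarrow> card {x\<in>A. g x = y} = m"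
  shows "(\<Prod>x\<in>A. f (g x)) = (\<Prod>y\<in>B. f y) ^ m"
proof -
  have "(\<Prod>x\<in>A. f (g x)) = (\<Prod>y\<in>B. \<Prod>x | x \<in> A \<and> g x = y. f (g x))"
    by (rule prod.group[OF assms(1-3), symmetric])
  also have "\<dots> = (\<Prod>y\<in>B. f y ^ m)" using fibres by (intro prod.cong refl) simp
  finally show ?thesis by (simp flip: prod_power_distrib)
qed

lemma card_equal_fibres:
  assumes "finite A" "finite B" "g ` A \<subseteq> B" and fibres: "\<And>y. y \<in> B \<Longrightarrow> card {x\<in>A. g x = y} = m"
  shows "card A = m * card B"
proof -
  have "card A = (\<Sum>y\<in>B. card {x\<in>A. g x = y})"
    using sum.group[OF assms(1-3), of "\<lambda>_. 1 :: nat"] by simp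
  thus ?thesis by (simp add: fibres)
qed

section \<open>Norms of algebraic integers\<close>

lemma prod_norm_conjs_ge_1:
  assumes x: "algebraic_int x" "x \<noteq> 0"
  shows "(\<Prod>z\<in>conjs x. norm z) \<ge> 1"
proof -
  have fin: "finite (conjs x)" using x(1) by (intro finite_conjs) auto
  obtain f where f: "is_minpoly f x" using is_minpoly_exists x(1) by blast
  define P where "P = (\<Prod>z\<in>conjs x. - z)"
  have "P = rpoly f 0" by (simp add: P_def minpoly_eq_prod_conjs[OF f] poly_prod)
  hence P: "P = of_rat (coeff f 0)" by (simp add: poly_0_coeff_0 coeff_map_poly)
  have "algebraic_int P"
    unfolding P_def using algebraic_int_conj[OF x(1)] by (intro algebraic_int_prod) auto
  hence "P \<in> \<int>" using P by (intro rational_algebraic_int_is_int) auto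
  moreover have "z \<noteq> 0" if "z \<in> conjs x" for z
  proof
    assume "z = 0"
    hence "f dvd [:0, 1:]"
      using is_minpoly_dvd_iff[OF is_minpoly_conj[OF f that], of "[:0, 1:]"] by (simp add: rpoly_X)
    thus False using is_minpoly_dvd_iff[OF f] x(2) rpoly_X[of x] by simp
  qed
  hence "P \<noteq> 0" using fin by (auto simp: P_def)
  ultimately have "norm P \<ge> 1" by (auto elim!: Ints_cases)
  thus ?thesis by (simp add: P_def flip: prod_norm)
qed

lemma prod_norm_rpoly_conjs_ge_1:
  assumes x: "algebraic x" and h: "algebraic_int (rpoly h x)" "rpoly h x \<noteq> 0"
  shows "(\<Prod>z\<in>conjs x. norm (rpoly h z)) \<ge> 1"
proof -
  obtain m where m: "\<And>y. y \<in> conjs (rpoly h x) \<Longrightarrow> card {z\<in>conjs x. rpoly h z = y} = m"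
    using card_conj_fibres[OF x, of h] by blast
  have "finite (conjs x)" "finite (conjs (rpoly h x))"
    using x h(1) by (auto intro: finite_conjs)
  hence "(\<Prod>z\<in>conjs x. norm (rpoly h z)) = (\<Prod>y\<in>conjs (rpoly h x). norm y) ^ m"
    using rpoly_in_conjs m by (intro prod_equal_fibres) auto
  thus ?thesis using prod_norm_conjs_ge_1[OF h] one_le_power by simp
qed

lemma algebraic_int_coeff_prod_linear:
  fixes A :: "'a::field_char_0 set"
  assumes "\<And>z. z \<in> A \<Longrightarrow> algebraic_int z"
  shows "algebraic_int (coeff (\<Prod>z\<in>A. [:- z, 1:]) i)"
  using assms
proof (induction A arbitrary: i rule: infinite_finite_induct)
  case (insert a A)
  have "coeff ([:- a, 1:] * q) i = (if i = 0 then 0 else coeff q (i - 1)) - a * coeff q i"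
    for q :: "'a poly"
    by (cases i) simp_all
  moreover have "algebraic_int (coeff (\<Prod>z\<in>A. [:- z, 1:]) i)" "algebraic_int a" for i
    using insert by auto
  ultimately show ?case
    using insert.hyps by (auto intro!: algebraic_int_diff algebraic_int_times simp del: mult_pCons_left)
qed (auto simp: coeff_1)

lemma minpoly_int_coeffs:
  assumes f: "is_minpoly f x" and x: "algebraic_int x"
  obtains g where "f = map_poly of_int g"
proof -
  have "coeff f i \<in> \<int>" for i
  proof -
    have "algebraic_int (coeff (map_poly of_rat f :: complex poly) i)"
      unfolding minpoly_eq_prod_conjs[OF f]
      by (intro algebraic_int_coeff_prod_linear algebraic_int_conj[OF x])
    hence "complex_of_rat (coeff f i) \<in> \<int>"
      by (intro rational_algebraic_int_is_int) (auto simp: coeff_map_poly)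
    then obtain k where "complex_of_rat (coeff f i) = of_rat (of_int k)" by (auto elim: Ints_cases)
    thus ?thesis by (simp only: of_rat_eq_iff) simp
  qed
  hence "f = map_poly of_int (map_poly floor f)"
    by (intro poly_eqI) (auto simp: coeff_map_poly elim!: Ints_cases)
  thus ?thesis by (rule that)
qed

section \<open>Roots of unity\<close>

definition alg_cong :: "nat \<Rightarrow> 'a::field_char_0 \<Rightarrow> 'a \<Rightarrow> bool" where
  "alg_cong p x y \<longleftrightarrow> algebraic_int ((x - y) / of_nat p)"

lemma alg_cong_trans: "alg_cong p x y \<Longrightarrow> alg_cong p y z \<Longrightarrow> alg_cong p x z"
  unfolding alg_cong_def using algebraic_int_plus[of "(x - y) / of_nat p" "(y - z) / of_nat p"]
  by (simp add: diff_divide_distrib)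

lemma alg_cong_add: "alg_cong p x y \<Longrightarrow> alg_cong p u v \<Longrightarrow> alg_cong p (x + u) (y + v)"
  unfolding alg_cong_def using algebraic_int_plus[of "(x - y) / of_nat p" "(u - v) / of_nat p"]
  by (simp add: diff_divide_distrib add_divide_distrib algebra_simps)

lemma alg_cong_mult: "algebraic_int u \<Longrightarrow> alg_cong p x y \<Longrightarrow> alg_cong p (u * x) (u * y)"
  unfolding alg_cong_def using algebraic_int_times[of u "(x - y) / of_nat p"]
  by (simp add: algebra_simps)

lemma alg_cong_power_prime_add:
  fixes x y :: "'a::field_char_0"
  assumes p: "prime p" and x: "algebraic_int x" and y: "algebraic_int y"
  shows "alg_cong p ((x + y) ^ p) (x ^ p + y ^ p)"
proof -
  have p0: "p > 0" using p prime_gt_0_nat by blast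
  hence "{..p} = insert 0 (insert p {0<..<p})" by auto
  hence "(x + y) ^ p - (x ^ p + y ^ p) = (\<Sum>k\<in>{0<..<p}. of_nat (p choose k) * x ^ k * y ^ (p - k))"
    using p0 by (simp add: binomial_ring)
  also have "\<dots> = of_nat p * (\<Sum>k\<in>{0<..<p}. of_nat ((p choose k) div p) * x ^ k * y ^ (p - k))"
    unfolding sum_distrib_left
  proof (intro sum.cong refl)
    fix k assume "k \<in> {0<..<p}"
    hence "of_nat (p choose k) = (of_nat p * of_nat ((p choose k) div p) :: 'a)"
      using dvd_choose_prime[of k p] p by (simp flip: of_nat_mult)
    thus "of_nat (p choose k) * x ^ k * y ^ (p - k) =
        of_nat p * (of_nat ((p choose k) div p) * x ^ k * y ^ (p - k))" by simp
  qed
  finally have "((x + y) ^ p - (x ^ p + y ^ p)) / of_nat p =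
      (\<Sum>k\<in>{0<..<p}. of_nat ((p choose k) div p) * x ^ k * y ^ (p - k))"
    using p0 by simp
  also have "algebraic_int \<dots>"
    by (intro algebraic_int_sum algebraic_int_times algebraic_int_power x y) auto
  finally show ?thesis unfolding alg_cong_def .
qed

lemma int_power_prime_cong:
  assumes p: "prime p"
  shows "[c ^ p = c] (mod int p)"
proof -
  define a where "a = nat (c mod int p)"
  have p0: "p > 0" using p prime_gt_0_nat by blast
  have "[a ^ p = a] (mod p)"
  proof (cases "p dvd a")
    case True
    hence "p dvd a ^ p" using p0 by (simp add: dvd_power_iff dvd_trans)
    thus ?thesis using True by (simp add: cong_def mod_eq_0_iff_dvd)
  next
    case False
    hence "[a * a ^ (p - 1) = a * 1] (mod p)" by (intro cong_scalar_left fermat_theorem p)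
    thus ?thesis using p0 by (simp add: power_eq_if)
  qed
  hence "[int a ^ p = int a] (mod int p)" by (simp flip: of_nat_power add: cong_int_iff)
  moreover have "[c = int a] (mod int p)" using p0 by (simp add: a_def cong_def)
  ultimately show ?thesis by (meson cong_pow cong_sym cong_trans)
qed

lemma alg_cong_power_prime_of_int:
  fixes c :: int
  assumes p: "prime p"
  shows "alg_cong p (of_int c ^ p) (of_int c :: 'a::field_char_0)"
proof -
  have "int p dvd c ^ p - c" using int_power_prime_cong[OF p] by (simp add: cong_iff_dvd_diff)
  then obtain k where "c ^ p - c = int p * k" by (auto elim: dvdE)
  hence "(of_int c ^ p - of_int c :: 'a) = of_nat p * of_int k"
    by (metis of_int_diff of_int_mult of_int_of_nat_eq of_int_power)
  thus ?thesis using prime_gt_0_nat[OF p] by (simp add: alg_cong_def)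
qed

lemma alg_cong_frobenius:
  fixes z :: "'a::field_char_0"
  assumes p: "prime p" and z: "algebraic_int z"
  shows "alg_cong p (poly (map_poly of_int g) z ^ p) (poly (map_poly of_int g) (z ^ p))"
proof (induction g)
  case 0
  show ?case using prime_gt_0_nat[OF p] by (simp add: alg_cong_def zero_power)
next
  case (pCons c g)
  let ?G = "poly (map_poly of_int g) :: 'a \<Rightarrow> 'a"
  have "algebraic_int (z * ?G z)" by (intro algebraic_int_times z algebraic_int_poly_of_int)
  hence binomial: "alg_cong p ((of_int c + z * ?G z) ^ p) (of_int c ^ p + (z * ?G z) ^ p)"
    by (intro alg_cong_power_prime_add[OF p]) auto
  have "alg_cong p (z ^ p * ?G z ^ p) (z ^ p * ?G (z ^ p))"
    by (intro alg_cong_mult algebraic_int_power z pCons.IH)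
  hence "alg_cong p (of_int c ^ p + (z * ?G z) ^ p) (of_int c + z ^ p * ?G (z ^ p))"
    using alg_cong_add[OF alg_cong_power_prime_of_int[OF p, of c]]
    by (simp add: power_mult_distrib)
  thus ?case using alg_cong_trans[OF binomial] by (simp add: of_int_hom.map_poly_pCons_hom)
qed

lemma rpoly_monom_minus_1: "rpoly (monom 1 d - 1) x = x ^ d - 1"
  by (simp add: rpoly_diff poly_monom)

lemma monom_minus_1_eq_prod:
  assumes d: "d > 0"
  shows "monom 1 d - 1 = (\<Prod>w | w ^ d = (1::complex). [:- w, 1:])"
proof -
  let ?P = "monom 1 d - 1 :: complex poly"
  have "\<not> (poly ?P a = 0 \<and> poly (pderiv ?P) a = 0)" for a
    using d by (auto simp: poly_monom pderiv_diff pderiv_monom power_0_left)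
  hence "rsquarefree ?P" unfolding rsquarefree_roots by blast
  moreover have "degree ?P = d"
    using d by (intro antisym degree_diff_le) (auto intro: le_degree simp: degree_monom_eq)
  hence "lead_coeff ?P = 1" using d by simp
  ultimately show ?thesis
    using complex_poly_decompose_rsquarefree[of ?P] by (simp add: poly_monom)
qed

lemma prod_diff_roots_of_unity:
  assumes d: "d > 0" and y: "y ^ d = (1::complex)"
  shows "(\<Prod>w\<in>{w. w ^ d = 1} - {y}. y - w) = of_nat d * y ^ (d - 1)"
proof -
  define B where "B = (\<Prod>w\<in>{w. w ^ d = 1} - {y}. [:- w, 1:])"
  have "monom 1 d - 1 = [:- y, 1:] * B"
    unfolding monom_minus_1_eq_prod[OF d] B_def
    using finite_roots_unity[of d] d y by (subst prod.remove[of _ y]) auto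
  hence "poly (pderiv (monom 1 d - 1)) y = poly (pderiv ([:- y, 1:] * B)) y" by simp
  also have "\<dots> = poly B y"
    by (simp add: pderiv_mult pderiv_pCons del: mult_pCons_left)
  finally show ?thesis
    by (simp add: B_def poly_prod pderiv_diff pderiv_monom poly_monom)
qed

lemma algebraic_int_root_of_unity: "d > 0 \<Longrightarrow> w ^ d = 1 \<Longrightarrow> algebraic_int (w :: complex)"
  by (rule algebraic_int_root[of 1 "monom 1 d"]) (auto simp: degree_monom_eq poly_monom)

lemma conj_power_eq_1: "z \<in> conjs x \<Longrightarrow> x ^ d = 1 \<Longrightarrow> z ^ d = 1"
  using conjsD[of z x "monom 1 d - 1"] unfolding rpoly_monom_minus_1 by simp

lemma minpoly_root_of_unity_dvd_degree:
  fixes x :: complex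
  assumes d: "d > 0" and x: "x ^ d = 1" and f: "is_minpoly f x"
    and y: "y ^ d = 1" "y \<notin> conjs x"
  obtains r where "algebraic_int r" "of_nat d = rpoly f y * r"
proof -
  let ?R = "{w::complex. w ^ d = 1}"
  define r where "r = y * (\<Prod>w\<in>?R - {y} - conjs x. y - w)"
  have fin: "finite ?R" using d finite_roots_unity[of d] by simp
  have sub: "conjs x \<subseteq> ?R" using conj_power_eq_1 x by blast
  have "?R - {y} = conjs x \<union> (?R - {y} - conjs x)" using sub y(2) by auto
  hence "(\<Prod>w\<in>?R - {y}. y - w) = (\<Prod>w\<in>conjs x \<union> (?R - {y} - conjs x). y - w)" by simp
  also have "\<dots> = (\<Prod>w\<in>conjs x. y - w) * (\<Prod>w\<in>?R - {y} - conjs x. y - w)"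
    using fin sub by (intro prod.union_disjoint) (auto intro: finite_subset)
  also have "(\<Prod>w\<in>conjs x. y - w) = rpoly f y"
    unfolding minpoly_eq_prod_conjs[OF f] by (simp add: poly_prod)
  finally have "rpoly f y * r = y * (\<Prod>w\<in>?R - {y}. y - w)"
    unfolding r_def by (simp only: mult_ac)
  also have "\<dots> = of_nat d * y ^ d"
    unfolding prod_diff_roots_of_unity[OF d y(1)] using d by (cases d) simp_all
  finally have "of_nat d = rpoly f y * r" using y(1) by simp
  moreover have "algebraic_int r"
    unfolding r_def using y(1) algebraic_int_root_of_unity[OF d]
    by (intro algebraic_int_times algebraic_int_prod algebraic_int_diff) auto
  ultimately show ?thesis using that by blast
qed

text \<open>Dedekind's argument: by Frobenius, \<open>f(z\<^sup>p)\<close> is divisible by \<open>p\<close> among the algebraic integers;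
  if it were nonzero, it would divide the discriminant factor \<open>d\<close>, and \<open>p\<close> would divide \<open>d\<close>.\<close>

lemma conj_root_of_unity_power_prime:
  fixes x :: complex
  assumes d: "d > 0" and x: "x ^ d = 1" and z: "z \<in> conjs x" and p: "prime p" "\<not> p dvd d"
  shows "z ^ p \<in> conjs x"
proof (rule ccontr)
  assume not_conj: "z ^ p \<notin> conjs x"
  have p0: "p > 0" using p(1) prime_gt_0_nat by blast
  have x_int: "algebraic_int x" using algebraic_int_root_of_unity[OF d x] .
  then obtain f where f: "is_minpoly f x" using is_minpoly_exists by blast
  obtain g where g: "f = map_poly of_int g" using minpoly_int_coeffs[OF f x_int] .
  have "rpoly f z = 0" using conjsD[OF z] is_minpolyD(3)[OF f] by blast
  moreover have "alg_cong p (rpoly f z ^ p) (rpoly f (z ^ p))"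
    unfolding g rpoly_of_int_poly by (intro alg_cong_frobenius p algebraic_int_conj[OF x_int z])
  ultimately have frobenius: "algebraic_int (rpoly f (z ^ p) / of_nat p)"
    using p0 by (simp add: alg_cong_def zero_power)
  have "z ^ d = 1" using conj_power_eq_1[OF z x] .
  hence "(z ^ p) ^ d = 1" by (metis mult.commute power_mult power_one)
  then obtain r where r: "algebraic_int r" "of_nat d = rpoly f (z ^ p) * r"
    using minpoly_root_of_unity_dvd_degree[OF d x f _ not_conj] by blast
  have "algebraic_int (of_nat d / of_nat p :: complex)"
    using algebraic_int_times[OF frobenius r(1)] r(2) by simp
  hence "(of_nat d / of_nat p :: complex) \<in> \<int>"
    by (intro rational_algebraic_int_is_int) auto
  then obtain k where "(of_nat d / of_nat p :: complex) = of_int k" by (auto elim: Ints_cases)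
  hence "(of_int (int d) :: complex) = of_int (k * int p)" using p0 by (simp add: field_simps)
  hence "int d = k * int p" by (simp only: of_int_eq_iff)
  thus False using p(2) by (metis dvd_triv_right int_dvd_int_iff)
qed

lemma conj_root_of_unity_power_coprime:
  fixes x :: complex
  assumes d: "d > 0" and x: "x ^ d = 1" and "z \<in> conjs x" "coprime k d" "k > 0"
  shows "z ^ k \<in> conjs x"
  using assms(3-5)
proof (induction k arbitrary: z rule: less_induct)
  case (less k)
  show ?case
  proof (cases "k = 1")
    case True
    thus ?thesis using less.prems by simp
  next
    case False
    then obtain p l where p: "prime p" and k: "k = p * l"
      using prime_factor_nat by (metis dvdE)
    have "\<not> p dvd d"
      using p k less.prems(2) by (metis coprime_common_divisor dvd_triv_left not_prime_unit)
    hence "z ^ p \<in> conjs x" using conj_root_of_unity_power_prime[OF d x less.prems(1) p] by blast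
    moreover have "0 < l" "l < k" "coprime l d"
      using k less.prems prime_gt_1_nat[OF p] by auto
    ultimately have "(z ^ p) ^ l \<in> conjs x" using less.IH by blast
    thus ?thesis by (simp add: k power_mult)
  qed
qed

definition zeta :: "nat \<Rightarrow> complex" where
  "zeta d = cis (2 * pi / real d)"

lemma zeta_power: "zeta d ^ k = cis (2 * pi * real k / real d)"
  by (simp add: zeta_def Complex.DeMoivre algebra_simps)

lemma bij_betw_zeta_powers: "d > 0 \<Longrightarrow> bij_betw (\<lambda>k. zeta d ^ k) {..<d} {w. w ^ d = 1}"
  unfolding zeta_power by (rule Complex.bij_betw_roots_unity)

lemma zeta_power_eq_1_iff:
  assumes "d > 0"
  shows "zeta d ^ k = 1 \<longleftrightarrow> d dvd k"
proof -
  have "zeta d ^ k = exp (2 * of_real pi * \<i> * of_nat k / of_nat d)"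
    by (simp add: zeta_power cis_conv_exp algebra_simps)
  thus ?thesis using complex_root_unity_eq_1[of d k] assms by simp
qed

lemma conjs_zeta:
  assumes d: "d \<ge> 2"
  shows "conjs (zeta d) = (\<lambda>k. zeta d ^ k) ` totatives d"
proof
  have d0: "d > 0" and one: "zeta d ^ d = 1" using d by (simp_all add: zeta_power_eq_1_iff)
  show "(\<lambda>k. zeta d ^ k) ` totatives d \<subseteq> conjs (zeta d)"
    using conj_root_of_unity_power_coprime[OF d0 one self_in_conjs]
    by (auto simp: in_totatives_iff)
  show "conjs (zeta d) \<subseteq> (\<lambda>k. zeta d ^ k) ` totatives d"
  proof
    fix w assume w: "w \<in> conjs (zeta d)"
    obtain k where k: "k < d" "w = zeta d ^ k"
      using bij_betw_zeta_powers[OF d0] conj_power_eq_1[OF w one] unfolding bij_betw_def by blast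
    have "algebraic (zeta d)" using algebraic_int_root_of_unity[OF d0 one] by blast
    hence zeta_conj: "zeta d \<in> conjs w" using conjs_conj[OF _ w] self_in_conjs by metis
    obtain e where e: "d = gcd k d * e" by (metis dvdE gcd_dvd2)
    have "d dvd k * e" by (metis e dvd_def gcd_dvd1 mult.assoc mult.commute mult_dvd_mono dvd_refl)
    hence "w ^ e = 1" by (simp add: k(2) zeta_power_eq_1_iff[OF d0] flip: power_mult)
    hence "d dvd e" using conj_power_eq_1[OF zeta_conj] by (simp add: zeta_power_eq_1_iff[OF d0])
    moreover have "e > 0" using e d0 by (metis gr0I mult_0_right)
    ultimately have "gcd k d * e \<le> 1 * e" using e dvd_imp_le by simp
    hence "gcd k d \<le> 1" using \<open>e > 0\<close> by (simp only: mult_le_cancel2)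
    hence "gcd k d = 1" using d0 by (simp add: le_Suc_eq)
    moreover from this have "k \<noteq> 0" using d by (intro notI) simp
    ultimately have "k \<in> totatives d" using k(1) by (simp add: in_totatives_iff coprime_iff_gcd_eq_1)
    thus "w \<in> (\<lambda>k. zeta d ^ k) ` totatives d" using k(2) by blast
  qed
qed

section \<open>The conjugates of \<open>4 sin\<^sup>2(\<pi>/d)\<close>\<close>

abbreviation four_sin2 :: "nat \<Rightarrow> real" where
  "four_sin2 d \<equiv> 4 * sin (pi / real d) ^ 2"

definition half_totatives :: "nat \<Rightarrow> nat set" where
  "half_totatives d = {k. 0 < k \<and> 2 * k < d \<and> coprime k d}"

definition sin2_conjs :: "nat \<Rightarrow> real set" where
  "sin2_conjs d = (\<lambda>k. 4 * sin (pi * real k / real d) ^ 2) ` half_totatives d"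

lemma finite_half_totatives [simp]: "finite (half_totatives d)"
  by (rule finite_subset[of _ "{..d}"]) (auto simp: half_totatives_def)

lemma totatives_eq_half_totatives:
  assumes "d \<ge> 3"
  shows "totatives d = half_totatives d \<union> (\<lambda>k. d - k) ` half_totatives d"
proof (intro subset_antisym subsetI)
  fix k assume "k \<in> totatives d"
  hence k: "0 < k" "k < d" "coprime k d" using totatives_less[of k d] assms
    by (auto simp: in_totatives_iff)
  have "2 * k \<noteq> d"
  proof
    assume half: "2 * k = d"
    hence "k dvd d" by auto
    hence "k = 1" using k(3) by (metis coprime_absorb_left nat_dvd_1_iff_1 gcd_nat.absorb1)
    thus False using half assms by simp
  qed
  show "k \<in> half_totatives d \<union> (\<lambda>k. d - k) ` half_totatives d"
  proof (cases "2 * k < d")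
    case True
    thus ?thesis using k by (auto simp: half_totatives_def)
  next
    case False
    hence "d - k \<in> half_totatives d"
      using k \<open>2 * k \<noteq> d\<close> by (auto simp: half_totatives_def coprime_iff_gcd_eq_1 gcd_diff2_nat)
    moreover have "k = d - (d - k)" using k by simp
    ultimately show ?thesis by blast
  qed
next
  fix k assume "k \<in> half_totatives d \<union> (\<lambda>k. d - k) ` half_totatives d"
  thus "k \<in> totatives d"
    by (auto simp: half_totatives_def in_totatives_iff coprime_iff_gcd_eq_1 gcd_diff2_nat)
qed

lemma half_totatives_disjoint: "half_totatives d \<inter> (\<lambda>k. d - k) ` half_totatives d = {}"
  by (auto simp: half_totatives_def)

lemma inj_on_diff_half_totatives: "inj_on (\<lambda>k. d - k) (half_totatives d)"
  by (auto simp: half_totatives_def inj_on_def)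

lemma totient_eq_half_totatives:
  assumes "d \<ge> 3"
  shows "totient d = 2 * card (half_totatives d)"
proof -
  have "totient d = card (half_totatives d) + card ((\<lambda>k. d - k) ` half_totatives d)"
    unfolding totient_def totatives_eq_half_totatives[OF assms]
    by (intro card_Un_disjoint half_totatives_disjoint) auto
  thus ?thesis by (simp add: card_image inj_on_diff_half_totatives)
qed

lemma sin_pi_fraction_pos:
  assumes "0 < k" "k < d"
  shows "sin (pi * real k / real d) > 0"
  using assms by (intro sin_gt_zero) (auto simp: field_simps)

lemma sin_half_totative_pos: "k \<in> half_totatives d \<Longrightarrow> sin (pi * real k / real d) > 0"
  by (intro sin_pi_fraction_pos) (auto simp: half_totatives_def)

lemma sin_half_totative_reflect:
  assumes "k \<in> half_totatives d"
  shows "sin (pi * real (d - k) / real d) = sin (pi * real k / real d)"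
proof -
  have "pi * real (d - k) / real d = pi - pi * real k / real d"
    using assms by (auto simp: half_totatives_def of_nat_diff field_simps)
  thus ?thesis by simp
qed

lemma sin2_conjs_pos: "b \<in> sin2_conjs d \<Longrightarrow> b > 0"
  using sin_half_totative_pos by (fastforce simp: sin2_conjs_def)

lemma sin2_conjs_le_4: "b \<in> sin2_conjs d \<Longrightarrow> b \<le> 4"
  by (auto simp: sin2_conjs_def abs_square_le_1 abs_sin_le_one)

lemma four_sin2_in_sin2_conjs:
  assumes "d \<ge> 3"
  shows "four_sin2 d \<in> sin2_conjs d"
proof -
  have "1 \<in> half_totatives d" using assms by (auto simp: half_totatives_def)
  thus ?thesis unfolding sin2_conjs_def by (rule rev_image_eqI) simp
qed

lemma finite_sin2_conjs [simp]: "finite (sin2_conjs d)"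
  by (simp add: sin2_conjs_def)

lemma inj_on_sin2:
  "inj_on (\<lambda>k. 4 * sin (pi * real k / real d) ^ 2) (half_totatives d)"
proof (rule inj_onI)
  fix k l assume k: "k \<in> half_totatives d" and l: "l \<in> half_totatives d"
    and eq: "4 * sin (pi * real k / real d) ^ 2 = 4 * sin (pi * real l / real d) ^ 2"
  have "sin (pi * real k / real d) = sin (pi * real l / real d)"
    using eq sin_half_totative_pos[OF k] sin_half_totative_pos[OF l]
    by (simp add: power2_eq_iff_nonneg)
  moreover have "- (pi / 2) \<le> pi * real j / real d" "pi * real j / real d \<le> pi / 2"
    if "j \<in> half_totatives d" for j
  proof -
    have "0 \<le> pi * real j / real d" by simp
    thus "- (pi / 2) \<le> pi * real j / real d" using pi_gt_zero by linarith
    have "2 * j < d" using that by (simp add: half_totatives_def)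
    hence "2 * real j \<le> real d" by linarith
    thus "pi * real j / real d \<le> pi / 2" using \<open>2 * j < d\<close> by (simp add: field_simps)
  qed
  ultimately have "pi * real k / real d = pi * real l / real d"
    using sin_inj_pi k l by blast
  thus "k = l" using k by (simp add: half_totatives_def)
qed

lemma card_sin2_conjs: "card (sin2_conjs d) = card (half_totatives d)"
  unfolding sin2_conjs_def by (rule card_image[OF inj_on_sin2])

lemma norm_1_minus_cis: "norm (1 - cis t) = 2 * \<bar>sin (t / 2)\<bar>"
proof -
  have "norm (1 - cis t) ^ 2 = (1 - cos t) ^ 2 + sin t ^ 2"
    by (simp add: cmod_power2)
  also have "\<dots> = 2 - 2 * cos t"
    using sin_cos_squared_add[of t] by (simp add: power2_eq_square algebra_simps)
  also have "\<dots> = (2 * \<bar>sin (t / 2)\<bar>) ^ 2"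
    using cos_double_sin[of "t / 2"] by (simp add: power_mult_distrib)
  finally show ?thesis by (rule power2_eq_imp_eq) auto
qed

lemma prod_sin_pi_fractions:
  assumes d: "d > 0"
  shows "(\<Prod>k\<in>{0<..<d}. 2 * sin (pi * real k / real d)) = real d"
proof -
  have "bij_betw (\<lambda>k. zeta d ^ k) ({..<d} - {0}) ({w. w ^ d = 1} - {1})"
    using bij_betw_zeta_powers[OF d] d by (intro bij_betw_DiffI) (auto simp: bij_betw_def)
  moreover have "{..<d} - {0} = {0<..<d}" by auto
  ultimately have bij: "bij_betw (\<lambda>k. zeta d ^ k) {0<..<d} ({w. w ^ d = 1} - {1})" by simp
  have "2 * sin (pi * real k / real d) = norm (1 - zeta d ^ k)" if "k \<in> {0<..<d}" for k
    using sin_pi_fraction_pos[of k d] that by (simp add: zeta_power norm_1_minus_cis)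
  hence "(\<Prod>k\<in>{0<..<d}. 2 * sin (pi * real k / real d)) = (\<Prod>k\<in>{0<..<d}. norm (1 - zeta d ^ k))"
    by (intro prod.cong refl) simp
  also have "\<dots> = (\<Prod>w\<in>{w::complex. w ^ d = 1} - {1}. norm (1 - w))"
    by (rule prod.reindex_bij_betw[OF bij])
  also have "\<dots> = real d" by (simp add: prod_norm prod_diff_roots_of_unity[OF d])
  finally show ?thesis .
qed

lemma sum_fractions_by_denominator:
  fixes F :: "real \<Rightarrow> 'a::comm_monoid_add"
  assumes d: "d > 0"
  shows "(\<Sum>k\<in>{0<..d}. F (real k / real d)) = (\<Sum>e | e dvd d. \<Sum>j\<in>totatives e. F (real j / real e))"
proof -
  let ?S = "\<lambda>e. \<Sum>j\<in>totatives e. F (real j / real e)"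
  have fibre: "(\<Sum>k | k \<in> {0<..d} \<and> gcd k d = g. F (real k / real d)) = ?S (d div g)"
    if g: "g dvd d" for g
  proof -
    have "(\<Sum>k | k \<in> {0<..d} \<and> gcd k d = g. F (real k / real d)) =
        (\<Sum>j\<in>totatives (d div g). F (real (j * g) / real d))"
      by (rule sum.reindex_bij_betw[OF bij_betw_totatives_gcd_eq[OF g d], symmetric])
    moreover have "real (j * g) / real d = real j / real (d div g)" for j
      using g d by (auto elim!: dvdE)
    ultimately show ?thesis by simp
  qed
  have involution: "d div (d div g) = g" "d div g dvd d" if "g dvd d" for g
    using that d by (auto elim!: dvdE)
  have "(\<Sum>k\<in>{0<..d}. F (real k / real d)) =
      (\<Sum>g | g dvd d. \<Sum>k | k \<in> {0<..d} \<and> gcd k d = g. F (real k / real d))"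
    using d by (intro sum.group[symmetric]) (auto simp: finite_divisors_nat)
  also have "\<dots> = (\<Sum>g | g dvd d. ?S (d div g))"
    by (rule sum.cong[OF refl]) (simp only: mem_Collect_eq fibre)
  also have "\<dots> = (\<Sum>e | e dvd d. ?S e)"
    by (rule sum.reindex_bij_witness[of _ "\<lambda>e. d div e" "\<lambda>e. d div e"])
      (simp_all add: involution)
  finally show ?thesis .
qed

lemma divisor_sum_inj:
  fixes f g :: "nat \<Rightarrow> 'a::cancel_comm_monoid_add"
  assumes "\<And>n. n > 0 \<Longrightarrow> (\<Sum>e | e dvd n. f e) = (\<Sum>e | e dvd n. g e)"
  shows "n > 0 \<Longrightarrow> f n = g n"
proof (induction n rule: less_induct)
  case (less n)
  have proper: "f e = g e" if "e dvd n" "e \<noteq> n" for e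
    using less that by (metis dvd_imp_le dvd_pos_nat le_neq_implies_less)
  have fin: "finite {e. e dvd n}" using less.prems by (simp add: finite_divisors_nat)
  have "f n + (\<Sum>e\<in>{e. e dvd n} - {n}. f e) = g n + (\<Sum>e\<in>{e. e dvd n} - {n}. g e)"
    using assms[OF less.prems] fin by (simp flip: sum.remove)
  moreover have "(\<Sum>e\<in>{e. e dvd n} - {n}. f e) = (\<Sum>e\<in>{e. e dvd n} - {n}. g e)"
    using proper by (intro sum.cong) auto
  ultimately show ?case by simp
qed

lemma sum_ln_sin_totatives:
  assumes "d > 0"
  shows "(\<Sum>k\<in>totatives d. ln (2 * sin (pi * (real k / real d)))) = mangoldt d"
proof (rule divisor_sum_inj[OF _ assms])
  fix n :: nat assume n: "n > 0"
  let ?L = "\<lambda>x. ln (2 * sin (pi * x))"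
  have "(\<Sum>e | e dvd n. \<Sum>k\<in>totatives e. ?L (real k / real e)) = (\<Sum>k\<in>{0<..n}. ?L (real k / real n))"
    by (rule sum_fractions_by_denominator[OF n, symmetric])
  also have "\<dots> = (\<Sum>k\<in>{0<..<n}. ?L (real k / real n))"
    \<comment> \<open>the term \<open>k = n\<close> is \<open>ln 0 = 0\<close>\<close>
    using n by (intro sum.mono_neutral_right) (auto simp: le_less)
  also have "\<dots> = ln (\<Prod>k\<in>{0<..<n}. 2 * sin (pi * (real k / real n)))"
  proof (rule ln_prod[symmetric])
    show "2 * sin (pi * (real k / real n)) \<noteq> 0" if "k \<in> {0<..<n}" for k
      using sin_pi_fraction_pos[of k n] that by simp
  qed simp
  also have "\<dots> = (\<Sum>e | e dvd n. mangoldt e)"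
    using mangoldt_sum[of n, where 'a = real] n by (simp add: prod_sin_pi_fractions)
  finally show "(\<Sum>e | e dvd n. \<Sum>k\<in>totatives e. ?L (real k / real e)) = (\<Sum>e | e dvd n. mangoldt e)" .
qed

lemma prod_sin2_conjs:
  assumes d: "d \<ge> 3"
  shows "\<Prod>(sin2_conjs d) = exp (mangoldt d)"
proof -
  let ?H = "half_totatives d" and ?s = "\<lambda>k. sin (pi * real k / real d)"
  have "mangoldt d = (\<Sum>k\<in>totatives d. ln (2 * ?s k))"
    using sum_ln_sin_totatives[of d] d by simp
  also have "\<dots> = (\<Sum>k\<in>?H. ln (2 * ?s k)) + (\<Sum>k\<in>(\<lambda>k. d - k) ` ?H. ln (2 * ?s k))"
    unfolding totatives_eq_half_totatives[OF d]
    by (intro sum.union_disjoint half_totatives_disjoint) auto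
  also have "(\<Sum>k\<in>(\<lambda>k. d - k) ` ?H. ln (2 * ?s k)) = (\<Sum>k\<in>?H. ln (2 * ?s k))"
    unfolding sum.reindex[OF inj_on_diff_half_totatives]
    by (intro sum.cong refl) (simp only: o_apply sin_half_totative_reflect)
  also have "(\<Sum>k\<in>?H. ln (2 * ?s k)) + (\<Sum>k\<in>?H. ln (2 * ?s k)) = (\<Sum>k\<in>?H. ln (4 * ?s k ^ 2))"
    unfolding sum.distrib[symmetric]
  proof (intro sum.cong refl)
    fix k assume "k \<in> ?H"
    hence "ln (2 * ?s k) + ln (2 * ?s k) = ln ((2 * ?s k) * (2 * ?s k))"
      using sin_half_totative_pos by (subst ln_mult) auto
    thus "ln (2 * ?s k) + ln (2 * ?s k) = ln (4 * ?s k ^ 2)" by (simp add: power2_eq_square)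
  qed
  also have "\<dots> = ln (\<Prod>k\<in>?H. 4 * ?s k ^ 2)"
  proof (rule ln_prod[symmetric])
    show "4 * ?s k ^ 2 \<noteq> 0" if "k \<in> ?H" for k using sin_half_totative_pos[OF that] by simp
  qed simp
  also have "(\<Prod>k\<in>?H. 4 * ?s k ^ 2) = \<Prod>(sin2_conjs d)"
    unfolding sin2_conjs_def prod.reindex[OF inj_on_sin2] by simp
  finally have "mangoldt d = ln (\<Prod>(sin2_conjs d))" .
  moreover have "\<Prod>(sin2_conjs d) > 0" by (intro prod_pos) (auto intro: sin2_conjs_pos)
  ultimately show ?thesis by simp
qed

lemma sin2_eq_zeta:
  assumes d: "d > 0"
  shows "complex_of_real (4 * sin (pi * real k / real d) ^ 2) =
    2 - zeta d ^ k - (zeta d ^ k) ^ (d - 1)"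
proof -
  define w where "w = zeta d ^ k"
  have w: "w = cis (2 * (pi * real k / real d))" by (simp add: w_def zeta_power mult.assoc)
  have "w ^ d = 1"
    using zeta_power_eq_1_iff[OF d, of "k * d"] by (simp add: w_def power_mult)
  hence "w * w ^ (d - 1) = 1" using d by (cases d) simp_all
  moreover have "w * cnj w = 1" by (simp add: w cis_cnj cis_mult)
  ultimately have "w ^ (d - 1) = cnj w" by (metis mult.assoc mult.commute mult_1_left)
  hence "2 - w - w ^ (d - 1) = of_real (2 - 2 * cos (2 * (pi * real k / real d)))"
    by (simp add: w complex_eq_iff)
  also have "2 - 2 * cos (2 * (pi * real k / real d)) = 4 * sin (pi * real k / real d) ^ 2"
    using cos_double_sin[of "pi * real k / real d"] by linarith
  finally show ?thesis by (simp add: w_def)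
qed

lemma algebraic_int_zeta: "d > 0 \<Longrightarrow> algebraic_int (zeta d)"
  by (rule algebraic_int_root_of_unity[of d]) (simp_all add: zeta_power_eq_1_iff)

lemma algebraic_int_4_sin2:
  assumes d: "d > 0"
  shows "algebraic_int (four_sin2 d)"
proof -
  have "algebraic_int (complex_of_real (4 * sin (pi * real 1 / real d) ^ 2))"
    unfolding sin2_eq_zeta[OF d]
    by (intro algebraic_int_diff algebraic_int_power algebraic_int_zeta[OF d]) auto
  thus ?thesis unfolding algebraic_int_of_real_iff by simp
qed

lemma conjs_4_sin2:
  assumes d: "d \<ge> 3"
  shows "conjs (four_sin2 d) = complex_of_real ` sin2_conjs d"
proof -
  have d0: "d > 0" using d by simp
  let ?s = "\<lambda>k. complex_of_real (4 * sin (pi * real k / real d) ^ 2)"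
  define h :: "rat poly" where "h = [:2, -1:] - monom 1 (d - 1)"
  have "rpoly h w = 2 - w - w ^ (d - 1)" for w :: complex
    by (simp add: h_def rpoly_diff poly_monom of_rat_hom.map_poly_pCons_hom)
  hence h: "rpoly h (zeta d ^ k) = ?s k" for k
    unfolding sin2_eq_zeta[OF d0] by simp
  have "conjs (four_sin2 d) = conjs (rpoly h (zeta d))"
    using h[of 1] conjs_of_real[of "four_sin2 d"] by simp
  also have "\<dots> = rpoly h ` conjs (zeta d)"
    using algebraic_int_zeta[OF d0] by (intro conjs_rpoly) blast
  also have "\<dots> = ?s ` totatives d" using d by (simp add: conjs_zeta image_image h)
  also have "\<dots> = ?s ` half_totatives d \<union> ?s ` (\<lambda>k. d - k) ` half_totatives d"
    by (simp only: totatives_eq_half_totatives[OF d] image_Un)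
  also have "?s ` (\<lambda>k. d - k) ` half_totatives d = ?s ` half_totatives d"
    unfolding image_image
    by (intro image_cong refl) (simp only: sin_half_totative_reflect)
  finally show ?thesis by (simp add: sin2_conjs_def image_image)
qed

section \<open>Subfields of the reals\<close>

lemma is_subfieldD:
  assumes "is_subfield K"
  shows "0 \<in> K" "1 \<in> K" "x \<in> K \<Longrightarrow> y \<in> K \<Longrightarrow> x + y \<in> K" "x \<in> K \<Longrightarrow> y \<in> K \<Longrightarrow> x * y \<in> K"
    "x \<in> K \<Longrightarrow> - x \<in> K" "x \<in> K \<Longrightarrow> inverse x \<in> K"
proof -
  show "x \<in> K \<Longrightarrow> inverse x \<in> K"
    using assms by (cases "x = 0") (auto simp: is_subfield_def)
qed (use assms in \<open>auto simp: is_subfield_def\<close>)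

lemma is_subfield_diff: "is_subfield K \<Longrightarrow> x \<in> K \<Longrightarrow> y \<in> K \<Longrightarrow> x - y \<in> K"
  using is_subfieldD(3)[of K x "- y"] is_subfieldD(5)[of K y] by simp

lemma is_subfield_divide: "is_subfield K \<Longrightarrow> x \<in> K \<Longrightarrow> y \<in> K \<Longrightarrow> x / y \<in> K"
  by (simp add: divide_inverse is_subfieldD(4,6))

lemma is_subfield_sum:
  "is_subfield K \<Longrightarrow> (\<And>i. i \<in> I \<Longrightarrow> f i \<in> K) \<Longrightarrow> sum f I \<in> K"
  by (induction I rule: infinite_finite_induct) (auto intro: is_subfieldD)

lemma is_subfield_power: "is_subfield K \<Longrightarrow> x \<in> K \<Longrightarrow> x ^ n \<in> K"
  by (induction n) (auto intro: is_subfieldD)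

lemma is_subfield_of_nat: "is_subfield K \<Longrightarrow> of_nat n \<in> K"
  by (induction n) (auto intro: is_subfieldD)

lemma is_subfield_of_int: "is_subfield K \<Longrightarrow> of_int n \<in> K"
  by (cases n rule: int_cases4) (auto intro: is_subfieldD is_subfield_of_nat)

lemma is_subfield_of_rat: "is_subfield K \<Longrightarrow> of_rat r \<in> K"
  by (cases r) (auto simp: of_rat_rat intro: is_subfield_divide is_subfield_of_int)

lemma is_subfield_gen_field: "is_subfield (gen_field S)"
  unfolding gen_field_def is_subfield_def by blast

lemma gen_field_superset: "S \<subseteq> gen_field S"
  unfolding gen_field_def by blast

lemma gen_field_least: "is_subfield K \<Longrightarrow> S \<subseteq> K \<Longrightarrow> gen_field S \<subseteq> K"
  unfolding gen_field_def by blast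

lemma gen_field_eqI: "S \<subseteq> gen_field T \<Longrightarrow> T \<subseteq> gen_field S \<Longrightarrow> gen_field S = gen_field T"
  by (intro subset_antisym gen_field_least is_subfield_gen_field)

lemma gen_field_gen_field_Un: "gen_field (gen_field S \<union> T) = gen_field (S \<union> T)"
proof (rule gen_field_eqI)
  have "gen_field S \<subseteq> gen_field (S \<union> T)"
    using gen_field_superset[of "S \<union> T"] by (intro gen_field_least is_subfield_gen_field) auto
  thus "gen_field S \<union> T \<subseteq> gen_field (S \<union> T)" using gen_field_superset[of "S \<union> T"] by blast
  show "S \<union> T \<subseteq> gen_field (gen_field S \<union> T)"
    using gen_field_superset[of S] gen_field_superset[of "gen_field S \<union> T"] by blast
qed

definition polys_over :: "real set \<Rightarrow> real poly set" where
  "polys_over L = {p. \<forall>i. coeff p i \<in> L}"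

context
  fixes L :: "real set"
  assumes L: "is_subfield L"
begin

lemma polys_over_diff: "p \<in> polys_over L \<Longrightarrow> q \<in> polys_over L \<Longrightarrow> p - q \<in> polys_over L"
  by (auto simp: polys_over_def intro: is_subfield_diff[OF L])

lemma polys_over_add: "p \<in> polys_over L \<Longrightarrow> q \<in> polys_over L \<Longrightarrow> p + q \<in> polys_over L"
  by (auto simp: polys_over_def intro: is_subfieldD(3)[OF L])

lemma polys_over_mult: "p \<in> polys_over L \<Longrightarrow> q \<in> polys_over L \<Longrightarrow> p * q \<in> polys_over L"
  by (auto simp: polys_over_def coeff_mult intro!: is_subfield_sum[OF L] is_subfieldD(4)[OF L])

lemma polys_over_smult: "c \<in> L \<Longrightarrow> q \<in> polys_over L \<Longrightarrow> Polynomial.smult c q \<in> polys_over L"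
  by (auto simp: polys_over_def intro: is_subfieldD(4)[OF L])

lemma polys_over_0: "0 \<in> polys_over L"
  using is_subfieldD(1)[OF L] by (auto simp: polys_over_def)

lemma pCons_in_polys_over_iff: "pCons c q \<in> polys_over L \<longleftrightarrow> c \<in> L \<and> q \<in> polys_over L"
  by (auto simp: polys_over_def coeff_pCons split: nat.splits)

lemma polys_over_of_rat: "map_poly of_rat p \<in> polys_over L"
  by (auto simp: polys_over_def coeff_map_poly intro: is_subfield_of_rat[OF L])

lemma polys_over_of_rat_diff_const: "y \<in> L \<Longrightarrow> map_poly of_rat h - [:y:] \<in> polys_over L"
  by (simp add: polys_over_diff polys_over_of_rat pCons_in_polys_over_iff polys_over_0)

lemma polys_over_pcompose:
  "p \<in> polys_over L \<Longrightarrow> q \<in> polys_over L \<Longrightarrow> pcompose p q \<in> polys_over L"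
proof (induction p)
  case (pCons c p)
  thus ?case
    by (auto simp: pcompose_pCons pCons_in_polys_over_iff polys_over_0
        intro!: polys_over_add polys_over_mult)
qed simp

lemma poly_in_subfield: "p \<in> polys_over L \<Longrightarrow> x \<in> L \<Longrightarrow> poly p x \<in> L"
  by (auto simp: poly_altdef polys_over_def
      intro!: is_subfield_sum[OF L] is_subfieldD(4)[OF L] is_subfield_power[OF L])

lemma rpoly_in_subfield: "x \<in> L \<Longrightarrow> rpoly h x \<in> L"
  by (rule poly_in_subfield[OF polys_over_of_rat])

lemma polys_over_mod: "p \<in> polys_over L \<Longrightarrow> q \<in> polys_over L \<Longrightarrow> p mod q \<in> polys_over L"
proof (induction p)
  case (pCons a p)
  show ?case
  proof (cases "q = 0")
    case False
    define r where "r = pCons a (p mod q)"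
    have r: "r \<in> polys_over L"
      using pCons by (simp add: r_def pCons_in_polys_over_iff)
    hence "coeff r (degree q) / coeff q (degree q) \<in> L"
      using pCons.prems(2) by (simp add: polys_over_def is_subfield_divide[OF L])
    thus ?thesis
      unfolding mod_pCons[OF False] using r pCons.prems(2)
      by (simp add: polys_over_diff polys_over_smult flip: r_def)
  qed (use pCons.prems in simp)
qed simp

lemma polys_over_normalize:
  assumes "p \<in> polys_over L"
  shows "normalize p \<in> polys_over L"
proof -
  have "normalize p = Polynomial.smult (inverse (lead_coeff p)) p"
    by (rule poly_eqI) (simp add: normalize_poly_eq_map_poly coeff_map_poly field_simps)
  thus ?thesis using assms
    by (auto simp: polys_over_def intro!: is_subfieldD(4,6)[OF L])
qed

lemma polys_over_gcd: "p \<in> polys_over L \<Longrightarrow> q \<in> polys_over L \<Longrightarrow> gcd p q \<in> polys_over L"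
proof (induction p q rule: eucl_induct)
  case (mod a b)
  hence "gcd b (a mod b) \<in> polys_over L" by (intro mod.IH polys_over_mod)
  thus ?case using mod.hyps by (simp add: gcd.commute[of b] gcd_mod_left)
qed (simp add: polys_over_normalize)

end

lemma rsquarefree_dvd:
  fixes p q :: "'a::field_char_0 poly"
  assumes "rsquarefree p" "q dvd p"
  shows "rsquarefree q"
proof -
  obtain r where "p = q * r" using assms(2) by (auto elim: dvdE)
  thus ?thesis using assms(1) unfolding rsquarefree_roots by (auto simp: pderiv_mult)
qed

interpretation of_real_field_hom: field_hom' complex_of_real ..

lemma degree_gcd_minpoly:
  assumes f: "is_minpoly f x"
  shows "degree (gcd (map_poly of_rat f) Q :: real poly) =
    card {z\<in>conjs x. poly (map_poly complex_of_real Q) z = 0}"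
proof -
  let ?Q = "map_poly complex_of_real Q"
  define G where "G = gcd (map_poly of_rat f) Q"
  have G: "map_poly complex_of_real G = gcd (map_poly of_rat f) ?Q"
    unfolding G_def of_real_field_hom.map_poly_gcd map_poly_of_real_of_rat ..
  have "rsquarefree (map_poly complex_of_real G)"
    unfolding G by (rule rsquarefree_dvd[OF is_minpoly_rsquarefree[OF f]]) simp
  moreover from this have "map_poly complex_of_real G \<noteq> 0" by (simp add: rsquarefree_def)
  ultimately have "degree G = card {z. poly (map_poly complex_of_real G) z = 0}"
    using rsquarefree_card_degree[of "map_poly complex_of_real G"] by simp
  moreover have "poly (map_poly complex_of_real G) z = 0 \<longleftrightarrow> z \<in> conjs x \<and> poly ?Q z = 0" for z
    unfolding G conjs_eq_roots[OF f] by (simp add: poly_eq_0_iff_dvd)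
  ultimately show ?thesis unfolding G_def by simp
qed

lemma common_conjs_poly:
  assumes L: "is_subfield L" and x: "algebraic x" and Q: "Q \<in> polys_over L" "poly Q x = 0"
  obtains p where "p \<in> polys_over L" "p \<noteq> 0" "poly p x = 0"
    "degree p = card {z\<in>conjs x. poly (map_poly complex_of_real Q) z = 0}"
proof -
  obtain f where f: "is_minpoly f x" using is_minpoly_exists[OF x] .
  show ?thesis
  proof (rule that[OF _ _ _ degree_gcd_minpoly[OF f]])
    show "gcd (map_poly of_rat f) Q \<in> polys_over L"
      by (intro polys_over_gcd[OF L] polys_over_of_rat[OF L] Q)
    show "gcd (map_poly of_rat f) Q \<noteq> 0" using is_minpolyD(1)[OF f] by auto
    show "poly (gcd (map_poly of_rat f) Q) x = 0"
      using is_minpolyD(3)[OF f] Q(2) by (simp add: poly_eq_0_iff_dvd)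
  qed
qed

lemma in_subfield_if_unique_common_conj:
  assumes L: "is_subfield L" and x: "algebraic x" and Q: "Q \<in> polys_over L" "poly Q x = 0"
    and unique: "\<And>z. z \<in> conjs x \<Longrightarrow> poly (map_poly complex_of_real Q) z = 0 \<Longrightarrow> z = complex_of_real x"
  shows "x \<in> L"
proof -
  obtain p where p: "p \<in> polys_over L" "p \<noteq> 0" "poly p x = 0"
    "degree p = card {z\<in>conjs x. poly (map_poly complex_of_real Q) z = 0}"
    by (rule common_conjs_poly[OF L x Q])
  have "card {z\<in>conjs x. poly (map_poly complex_of_real Q) z = 0} \<le> card {complex_of_real x}"
    using unique by (intro card_mono) auto
  hence "degree p \<le> 1" using p(4) by simp
  hence "p = [:coeff p 0, coeff p 1:]"
    by (intro poly_eqI) (auto simp: coeff_pCons coeff_eq_0 split: nat.split)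
  then obtain a b where ab: "p = [:a, b:]" by blast
  have "b \<noteq> 0" using p(2,3) ab by auto
  hence "x = - a / b" using p(3) by (simp add: ab field_simps eq_neg_iff_add_eq_0)
  moreover have "a \<in> L" "b \<in> L" using p(1) by (auto simp: ab pCons_in_polys_over_iff[OF L])
  ultimately show ?thesis by (simp add: is_subfield_divide[OF L] is_subfieldD(5)[OF L])
qed

lemma gen_field_eq_range_rpoly:
  assumes x: "algebraic (x :: real)"
  shows "gen_field {x} = range (\<lambda>h. rpoly h x)"
proof
  have "is_subfield (range (\<lambda>h. rpoly h x))"
    unfolding is_subfield_def
  proof (intro conjI ballI impI)
    show "0 \<in> range (\<lambda>h. rpoly h x)" by (rule range_eqI[of _ _ 0]) simp
    show "1 \<in> range (\<lambda>h. rpoly h x)" by (rule range_eqI[of _ _ 1]) simp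
    fix y assume "y \<in> range (\<lambda>h. rpoly h x)"
    then obtain h where h: "y = rpoly h x" by blast
    show "- y \<in> range (\<lambda>h. rpoly h x)"
      unfolding h by (rule range_eqI[of _ _ "0 - h"]) (simp only: rpoly_diff, simp)
    show "inverse y \<in> range (\<lambda>h. rpoly h x)" if "y \<noteq> 0"
      using rpoly_inverse[OF x, of h] that unfolding h by blast
    fix z assume "z \<in> range (\<lambda>h. rpoly h x)"
    then obtain k where k: "z = rpoly k x" by blast
    show "y + z \<in> range (\<lambda>h. rpoly h x)" unfolding h k rpoly_add[symmetric] by blast
    show "y * z \<in> range (\<lambda>h. rpoly h x)" unfolding h k rpoly_mult[symmetric] by blast
  qed
  moreover have "x \<in> range (\<lambda>h. rpoly h x)"
    by (rule range_eqI[of _ _ "[:0, 1:]"]) (simp only: rpoly_X)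
  ultimately show "gen_field {x} \<subseteq> range (\<lambda>h. rpoly h x)" by (intro gen_field_least) auto
  show "range (\<lambda>h. rpoly h x) \<subseteq> gen_field {x}"
    using rpoly_in_subfield[OF is_subfield_gen_field, of x] gen_field_superset[of "{x}"] by auto
qed

lemma fdeg_le_card:
  assumes "finite B" "B \<subseteq> K" "\<And>x. x \<in> K \<Longrightarrow> \<exists>c. (\<forall>b\<in>B. c b \<in> F) \<and> x = (\<Sum>b\<in>B. c b * b)"
  shows "fdeg K F \<le> card B"
  unfolding fdeg_def by (rule Least_le) (use assms in blast)

lemma fdeg_gen_field_le_degree:
  assumes L: "is_subfield L" and x: "algebraic x" and p: "p \<in> polys_over L" "p \<noteq> 0" "poly p x = 0"
  shows "fdeg (gen_field {x}) L \<le> degree p"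
proof -
  let ?K = "gen_field {x}"
  define B where "B = (\<lambda>j. x ^ j) ` {..<degree p}"
  have "x \<in> ?K" using gen_field_superset by blast
  hence "B \<subseteq> ?K" by (auto simp: B_def intro: is_subfield_power is_subfield_gen_field)
  moreover have "\<exists>c. (\<forall>b\<in>B. c b \<in> L) \<and> y = (\<Sum>b\<in>B. c b * b)" if y: "y \<in> ?K" for y
  proof -
    obtain h where h: "y = rpoly h x" using y gen_field_eq_range_rpoly[OF x] by blast
    define r where "r = map_poly of_rat h mod p"
    define c where "c b = (\<Sum>j | j \<in> {..<degree p} \<and> x ^ j = b. coeff r j)" for b
    have "r \<in> polys_over L" unfolding r_def by (intro polys_over_mod[OF L] polys_over_of_rat[OF L] p)
    hence c_in_L: "c b \<in> L" for b
      unfolding c_def by (intro is_subfield_sum[OF L]) (auto simp: polys_over_def)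
    have "degree p > 0" using p(2,3) by (auto elim: degree_eq_zeroE intro!: Nat.gr0I)
    hence "degree r < degree p" unfolding r_def using degree_mod_less'[OF p(2)] by (metis degree_0)
    hence "poly r x = (\<Sum>j<degree p. coeff r j * x ^ j)"
      unfolding poly_altdef by (intro sum.mono_neutral_left) (auto simp: coeff_eq_0)
    also have "\<dots> = (\<Sum>b\<in>B. \<Sum>j | j \<in> {..<degree p} \<and> x ^ j = b. coeff r j * x ^ j)"
      unfolding B_def by (rule sum.image_gen) simp
    also have "\<dots> = (\<Sum>b\<in>B. c b * b)"
      unfolding c_def by (intro sum.cong refl) (simp add: sum_distrib_right)
    finally have "y = (\<Sum>b\<in>B. c b * b)" using p(3) by (simp add: h r_def poly_mod)
    thus ?thesis using c_in_L by (intro exI[of _ c]) simp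
  qed
  ultimately have "fdeg ?K L \<le> card B" by (intro fdeg_le_card) (auto simp: B_def)
  also have "\<dots> \<le> degree p" unfolding B_def using card_image_le[of "{..<degree p}"] by simp
  finally show ?thesis .
qed

lemma poly_of_real_of_rat_diff_const:
  "poly (map_poly complex_of_real (map_poly of_rat h - [:y:])) z = rpoly h z - complex_of_real y"
proof -
  interpret m: map_poly_comm_ring_hom complex_of_real ..
  show ?thesis
    by (simp add: m.hom_minus map_poly_of_real_of_rat of_real_hom.map_poly_pCons_hom)
qed

lemma fdeg_gen_field_le_card_fibre:
  assumes x: "algebraic x"
  shows "fdeg (gen_field {x}) (gen_field {rpoly h x}) \<le>
    card {z\<in>conjs x. rpoly h z = complex_of_real (rpoly h x)}"
proof -
  let ?L = "gen_field {rpoly h x}" and ?Q = "map_poly of_rat h - [:rpoly h x:]"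
  have L: "is_subfield ?L" by (rule is_subfield_gen_field)
  have "rpoly h x \<in> ?L" using gen_field_superset by blast
  hence "?Q \<in> polys_over ?L" by (rule polys_over_of_rat_diff_const[OF L])
  moreover have "poly ?Q x = 0" by simp
  ultimately obtain p where p: "p \<in> polys_over ?L" "p \<noteq> 0" "poly p x = 0"
    "degree p = card {z\<in>conjs x. poly (map_poly complex_of_real ?Q) z = 0}"
    by (rule common_conjs_poly[OF L x])
  thus ?thesis
    using fdeg_gen_field_le_degree[OF L x p(1-3)] by (simp add: poly_of_real_of_rat_diff_const)
qed

lemma fdeg_gen_field_le_card_conjs:
  assumes "algebraic x"
  shows "fdeg (gen_field {x}) (gen_field {}) \<le> card (conjs x)"
proof -
  have "gen_field {0} = gen_field {}"
    using is_subfieldD(1)[OF is_subfield_gen_field] by (intro gen_field_eqI) auto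
  thus ?thesis using fdeg_gen_field_le_card_fibre[OF assms, of 0] by simp
qed

lemma gen_field_eq_if_fibre_singleton:
  assumes x: "algebraic x"
    and unique: "\<And>z. z \<in> conjs x \<Longrightarrow> rpoly h z = complex_of_real (rpoly h x) \<Longrightarrow> z = complex_of_real x"
  shows "gen_field {x} = gen_field {rpoly h x}"
proof (rule gen_field_eqI)
  let ?L = "gen_field {rpoly h x}" and ?Q = "map_poly of_rat h - [:rpoly h x:]"
  have L: "is_subfield ?L" by (rule is_subfield_gen_field)
  have "x \<in> ?L"
  proof (rule in_subfield_if_unique_common_conj[OF L x, of ?Q])
    have "rpoly h x \<in> ?L" using gen_field_superset by blast
    thus "?Q \<in> polys_over ?L" by (rule polys_over_of_rat_diff_const[OF L])
    show "z = complex_of_real x" if "z \<in> conjs x" "poly (map_poly complex_of_real ?Q) z = 0" for z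
      using unique that by (simp add: poly_of_real_of_rat_diff_const)
  qed simp
  thus "{x} \<subseteq> ?L" by simp
  show "{rpoly h x} \<subseteq> gen_field {x}"
    using gen_field_superset[of "{x}"] by (auto intro: rpoly_in_subfield is_subfield_gen_field)
qed

definition field_embedding :: "real set \<Rightarrow> (real \<Rightarrow> 'a::field_char_0) \<Rightarrow> bool" where
  "field_embedding K \<sigma> \<longleftrightarrow> \<sigma> 1 = 1 \<and>
    (\<forall>u\<in>K. \<forall>v\<in>K. \<sigma> (u + v) = \<sigma> u + \<sigma> v \<and> \<sigma> (u * v) = \<sigma> u * \<sigma> v)"

lemma real_emb_iff_field_embedding: "real_emb K \<sigma> \<longleftrightarrow> field_embedding K \<sigma>"
  by (simp add: real_emb_def field_embedding_def)

lemma complex_emb_iff_field_embedding: "complex_emb K \<sigma> \<longleftrightarrow> field_embedding K \<sigma>"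
  by (simp add: complex_emb_def field_embedding_def)

lemma embedding_of_conj:
  fixes x :: real and z :: "'a::field_char_0"
  assumes x: "algebraic x" and z: "\<And>p. rpoly p x = 0 \<Longrightarrow> rpoly p z = 0"
  obtains \<sigma> where "\<And>h. \<sigma> (rpoly h x) = rpoly h z" "field_embedding (gen_field {x}) \<sigma>"
proof -
  define \<sigma> where "\<sigma> y = rpoly (SOME k. rpoly k x = y) z" for y
  have \<sigma>: "\<sigma> (rpoly h x) = rpoly h z" for h
  proof -
    define k where "k = (SOME k. rpoly k x = rpoly h x)"
    have "rpoly k x = rpoly h x" unfolding k_def by (rule someI[of _ h]) simp
    hence "rpoly (k - h) x = 0" unfolding rpoly_diff by simp
    hence "rpoly (k - h) z = 0" by (rule z)
    thus ?thesis unfolding \<sigma>_def k_def rpoly_diff by simp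
  qed
  have hom: "\<sigma> (u + v) = \<sigma> u + \<sigma> v \<and> \<sigma> (u * v) = \<sigma> u * \<sigma> v"
    if "u \<in> gen_field {x}" "v \<in> gen_field {x}" for u v
  proof -
    obtain h k where "u = rpoly h x" "v = rpoly k x"
      using \<open>u \<in> gen_field {x}\<close> \<open>v \<in> gen_field {x}\<close> unfolding gen_field_eq_range_rpoly[OF x] by blast
    thus ?thesis using \<sigma>[of "h + k"] \<sigma>[of "h * k"] \<sigma>[of h] \<sigma>[of k] by (simp only: rpoly_add rpoly_mult)
  qed
  have "field_embedding (gen_field {x}) \<sigma>"
    using \<sigma>[of 1] hom by (simp add: field_embedding_def)
  thus ?thesis using that[of \<sigma>] \<sigma> by blast
qed

lemma totally_real_imp_conjs_real:
  assumes "totally_real x"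
  shows "conjs x \<subseteq> \<real>"
proof
  fix z assume z: "z \<in> conjs x"
  have "algebraic x" using assms by (simp add: totally_real_def)
  then obtain \<sigma> where \<sigma>: "\<And>h. \<sigma> (rpoly h x) = rpoly h z" "field_embedding (gen_field {x}) \<sigma>"
    using embedding_of_conj[of x z] conjsD[OF z] by blast
  hence "\<sigma> x \<in> \<real>"
    using assms by (simp add: totally_real_def complex_emb_iff_field_embedding)
  thus "z \<in> \<real>" using \<sigma>(1)[of "[:0, 1:]"] by (simp only: rpoly_X)
qed

lemma conjs_real_combination:
  fixes x :: real
  assumes x: "x = rpoly h x + real l * rpoly k x"
    and real: "conjs (rpoly h x) \<subseteq> \<real>" "conjs (rpoly k x) \<subseteq> \<real>"
  shows "conjs x \<subseteq> \<real>"
proof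
  fix z assume z: "z \<in> conjs x"
  have "rpoly [:0, 1:] x = rpoly (h + [:of_nat l:] * k) x"
    using x by (simp only: rpoly_add rpoly_mult rpoly_X rpoly_const of_rat_of_nat_eq)
  hence "rpoly [:0, 1:] z = rpoly (h + [:of_nat l:] * k) z" by (rule rpoly_eq_conj[OF z])
  hence "z = rpoly h z + of_nat l * rpoly k z"
    by (simp only: rpoly_add rpoly_mult rpoly_X rpoly_const of_rat_of_nat_eq)
  moreover have "rpoly h z \<in> \<real>" "rpoly k z \<in> \<real>" using rpoly_in_conjs[OF z] real by blast+
  ultimately show "z \<in> \<real>" by (metis Reals_add Reals_mult Reals_of_nat)
qed

lemma in_gen_field_linear_combination:
  fixes x y :: real
  assumes x: "algebraic x" and y: "algebraic y"
    and l: "\<And>a b. a \<in> conjs x \<Longrightarrow> b \<in> conjs y \<Longrightarrow> of_nat l * (of_real y - b) = a - of_real x \<Longrightarrow> b = of_real y"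
  shows "y \<in> gen_field {x + real l * y}"
proof -
  obtain f where f: "is_minpoly f x" using is_minpoly_exists[OF x] .
  define t where "t = x + real l * y"
  define Q where "Q = pcompose (map_poly of_rat f) [:t, - real l:]"
  let ?L = "gen_field {t}"
  have L: "is_subfield ?L" by (rule is_subfield_gen_field)
  have t: "t \<in> ?L" using gen_field_superset by blast
  have "y \<in> ?L"
  proof (rule in_subfield_if_unique_common_conj[OF L y, of Q])
    have "[:t, - real l:] \<in> polys_over ?L"
      by (simp add: pCons_in_polys_over_iff[OF L] polys_over_0[OF L] t is_subfieldD(5)[OF L]
          is_subfield_of_nat[OF L])
    thus "Q \<in> polys_over ?L"
      unfolding Q_def by (intro polys_over_pcompose[OF L] polys_over_of_rat[OF L])
    show "poly Q y = 0"
      using is_minpolyD(3)[OF f] by (simp add: Q_def poly_pcompose t_def algebra_simps)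
    fix z assume z: "z \<in> conjs y" "poly (map_poly complex_of_real Q) z = 0"
    define a where "a = of_real t - of_nat l * z"
    have "map_poly complex_of_real Q = pcompose (map_poly of_rat f) [:of_real t, - of_nat l:]"
      unfolding Q_def by (simp add: of_real_hom.map_poly_pcompose map_poly_of_real_of_rat
          of_real_hom.map_poly_pCons_hom)
    hence "rpoly f a = 0" using z(2) by (simp add: poly_pcompose a_def algebra_simps)
    hence "a \<in> conjs x" by (simp add: conjs_eq_roots[OF f])
    thus "z = complex_of_real y" by (rule l[OF _ z(1)]) (simp add: a_def t_def algebra_simps)
  qed
  thus ?thesis unfolding t_def .
qed

lemma primitive_element:
  fixes x y :: real
  assumes x: "algebraic x" and y: "algebraic y"
  obtains l :: nat where "gen_field {x + real l * y} = gen_field {x, y}"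
proof -
  have "finite ((\<lambda>(a, b). (a - of_real x) / (of_real y - b)) ` (conjs x \<times> conjs y))" (is "finite ?bad")
    by (intro finite_imageI finite_cartesian_product finite_conjs x y)
  moreover have "infinite (range of_nat :: complex set)"
    by (rule range_inj_infinite) (simp add: inj_on_def)
  ultimately have "\<not> range of_nat \<subseteq> ?bad" using finite_subset by blast
  then obtain l :: nat where l: "of_nat l \<notin> ?bad" by blast
  define t where "t = x + real l * y"
  have y_in: "y \<in> gen_field {t}"
    unfolding t_def
  proof (rule in_gen_field_linear_combination[OF x y], rule ccontr)
    fix a b assume ab: "a \<in> conjs x" "b \<in> conjs y" "of_nat l * (of_real y - b) = a - of_real x"
      and "b \<noteq> of_real y"
    hence "of_nat l = (a - of_real x) / (of_real y - b)" by (simp add: eq_divide_eq)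
    thus False using l ab(1,2) by (auto simp: image_iff)
  qed
  have "t \<in> gen_field {t}" using gen_field_superset by blast
  hence "t - real l * y \<in> gen_field {t}"
    by (intro is_subfield_diff is_subfieldD(4) is_subfield_gen_field is_subfield_of_nat y_in)
  hence "x \<in> gen_field {t}" by (simp add: t_def)
  moreover have "t \<in> gen_field {x, y}"
    using gen_field_superset[of "{x, y}"] unfolding t_def
    by (intro is_subfieldD(3,4) is_subfield_gen_field is_subfield_of_nat) auto
  ultimately have "gen_field {t} = gen_field {x, y}" using y_in by (intro gen_field_eqI) auto
  thus ?thesis using that by (simp add: t_def)
qed

lemma Fd_eq: "Fd d = gen_field {four_sin2 d}"
  unfolding Fd_def
proof (rule gen_field_eqI)
  have sin_cos: "four_sin2 d = 4 - 4 * cos (pi / real d) ^ 2"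
    by (simp add: sin_squared_eq algebra_simps)
  have four: "4 \<in> gen_field S" for S
    using is_subfield_of_nat[OF is_subfield_gen_field, of 4] by simp
  have "4 - 4 * cos (pi / real d) ^ 2 \<in> gen_field {cos (pi / real d) ^ 2}"
    using gen_field_superset[of "{cos (pi / real d) ^ 2}"]
    by (intro is_subfield_diff is_subfieldD(4) is_subfield_gen_field four) auto
  thus "{four_sin2 d} \<subseteq> gen_field {cos (pi / real d) ^ 2}"
    by (simp add: sin_cos)
  have "(4 - four_sin2 d) / 4 \<in> gen_field {four_sin2 d}"
    using gen_field_superset[of "{four_sin2 d}"]
    by (intro is_subfield_diff is_subfield_divide is_subfield_gen_field four) auto
  thus "{cos (pi / real d) ^ 2} \<subseteq> gen_field {four_sin2 d}"
    by (simp add: sin_cos)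
qed

section \<open>The norm inequality\<close>

inductive int_poly2 :: "(real \<Rightarrow> real \<Rightarrow> real) \<Rightarrow> bool" where
  const: "int_poly2 (\<lambda>a b. of_int c)"
| fst: "int_poly2 (\<lambda>a b. a)"
| snd: "int_poly2 (\<lambda>a b. b)"
| add: "int_poly2 q \<Longrightarrow> int_poly2 r \<Longrightarrow> int_poly2 (\<lambda>a b. q a b + r a b)"
| mult: "int_poly2 q \<Longrightarrow> int_poly2 r \<Longrightarrow> int_poly2 (\<lambda>a b. q a b * r a b)"

lemma int_poly2_numeral: "int_poly2 (\<lambda>a b. numeral n)"
  using int_poly2.const[of "numeral n"] by simp

lemma int_poly2_one: "int_poly2 (\<lambda>a b. 1)"
  using int_poly2.const[of 1] by simp

lemma int_poly2_diff: "int_poly2 q \<Longrightarrow> int_poly2 r \<Longrightarrow> int_poly2 (\<lambda>a b. q a b - r a b)"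
  using int_poly2.add[OF _ int_poly2.mult[OF int_poly2.const[of "- 1"]], of q r] by simp

lemma int_poly2_power: "int_poly2 q \<Longrightarrow> int_poly2 (\<lambda>a b. q a b ^ n)"
  by (induction n) (auto intro: int_poly2_one int_poly2.mult)

lemmas int_poly2_intros = int_poly2.fst int_poly2.snd int_poly2.add int_poly2.mult
  int_poly2_numeral int_poly2_one int_poly2_diff int_poly2_power

lemma int_poly2_algebraic_int:
  "int_poly2 q \<Longrightarrow> algebraic_int a \<Longrightarrow> algebraic_int b \<Longrightarrow> algebraic_int (q a b)"
  by (induction rule: int_poly2.induct) (auto intro: algebraic_int_plus algebraic_int_times)

lemma int_poly2_rpoly:
  assumes "int_poly2 q"
  shows "\<exists>p. \<forall>t. q (rpoly h t) (rpoly k t) = rpoly p t"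
  using assms
proof (induction rule: int_poly2.induct)
  case (const c)
  show ?case by (intro exI[of _ "[:of_int c:]"]) (simp add: rpoly_const)
next
  case (add q r)
  then obtain p p' where "\<forall>t. q (rpoly h t) (rpoly k t) = rpoly p t"
    "\<forall>t. r (rpoly h t) (rpoly k t) = rpoly p' t" by blast
  thus ?case by (intro exI[of _ "p + p'"]) (simp only: rpoly_add, simp)
next
  case (mult q r)
  then obtain p p' where "\<forall>t. q (rpoly h t) (rpoly k t) = rpoly p t"
    "\<forall>t. r (rpoly h t) (rpoly k t) = rpoly p' t" by blast
  thus ?case by (intro exI[of _ "p * p'"]) (simp only: rpoly_mult, simp)
qed blast+

lemma quadratic_le: "a * (b - a) \<le> b ^ 2 / (4 :: real)"
proof -
  have "0 \<le> (b - 2 * a) ^ 2" by simp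
  thus ?thesis by (simp add: power2_eq_square algebra_simps)
qed

lemma quadratic_ratio:
  fixes a b :: real
  assumes "0 < a" "a < b"
  obtains w where "0 \<le> w" "w \<le> 1 / 4" "a * (a - b) = - (b ^ 2 * w)"
proof (rule that[of "a * (b - a) / b ^ 2"])
  show "0 \<le> a * (b - a) / b ^ 2" using assms by simp
  show "a * (b - a) / b ^ 2 \<le> 1 / 4" using quadratic_le[of a b] assms by (simp add: field_simps)
  show "a * (a - b) = - (b ^ 2 * (a * (b - a) / b ^ 2))"
    using assms by (simp add: right_diff_distrib)
qed

definition bounded_at_conjs :: "nat \<Rightarrow> (real \<Rightarrow> real \<Rightarrow> real) \<Rightarrow> nat \<Rightarrow> real \<Rightarrow> bool" where
  "bounded_at_conjs d q k G \<longleftrightarrow>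
    (\<forall>b\<in>sin2_conjs d. \<forall>w. 0 \<le> w \<longrightarrow> w \<le> 1 / 4 \<longrightarrow> \<bar>q (- (b ^ 2 * w)) b\<bar> \<le> b ^ k * G)"

lemma bounded_at_conjsI:
  assumes "\<And>b w. b \<in> sin2_conjs d \<Longrightarrow> 0 \<le> w \<Longrightarrow> w \<le> 1 / 4 \<Longrightarrow> \<bar>q (- (b ^ 2 * w)) b\<bar> \<le> b ^ k * G"
  shows "bounded_at_conjs d q k G"
  using assms by (simp add: bounded_at_conjs_def)

lemma bounded_at_conjsD:
  assumes "bounded_at_conjs d q k G" "b \<in> sin2_conjs d" "0 \<le> w" "w \<le> 1 / 4"
  shows "\<bar>q (- (b ^ 2 * w)) b\<bar> \<le> b ^ k * G"
  using assms by (simp add: bounded_at_conjs_def)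

text \<open>Instantiated with \<open>V = \<alpha> (\<alpha> - s)\<close>, whose image under a nontrivial embedding with \<open>b = \<sigma>(s)\<close> is
  \<open>- b\<^sup>2 w\<close>.\<close>

locale norm_bound =
  fixes d :: nat and V :: real and m :: nat
  assumes d_ge_3: "d \<ge> 3"
    and V_pos: "0 < V" and V_less: "V + four_sin2 d ^ 2 < 256 ^ 2"
    and norm_bound: "int_poly2 q \<Longrightarrow> q V (four_sin2 d) \<noteq> 0 \<Longrightarrow> 0 < G \<Longrightarrow>
      bounded_at_conjs d q k G \<Longrightarrow>
      four_sin2 d ^ k * G \<le>
        \<bar>q V (four_sin2 d)\<bar> * (exp (mangoldt d) ^ k * G ^ card (half_totatives d)) ^ m"

locale small_conjugates =
  fixes d :: nat and \<alpha> :: real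
  assumes d_ge_3: "d \<ge> 3"
    and algebraic_int_\<alpha>: "algebraic_int \<alpha>" and totally_real_\<alpha>: "totally_real \<alpha>"
    and \<alpha>_bounds: "4 < \<alpha>" "\<alpha> < 16 ^ 2"
    and conjugates_small: "\<And>\<sigma>. real_emb (gen_field (Fd d \<union> {\<alpha>})) \<sigma> \<Longrightarrow>
      \<exists>x\<in>gen_field (Fd d \<union> {\<alpha>}). \<sigma> x \<noteq> x \<Longrightarrow> 0 < \<sigma> \<alpha> \<and> \<sigma> \<alpha> < \<sigma> (four_sin2 d)"
begin

abbreviation s :: real where "s \<equiv> four_sin2 d"

abbreviation K :: "real set" where "K \<equiv> gen_field (Fd d \<union> {\<alpha>})"

abbreviation V :: real where "V \<equiv> \<alpha> * (\<alpha> - s)"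

lemma s_in_sin2_conjs: "s \<in> sin2_conjs d"
  by (rule four_sin2_in_sin2_conjs[OF d_ge_3])

lemma s_bounds: "0 < s" "s \<le> 4"
  using s_in_sin2_conjs sin2_conjs_pos sin2_conjs_le_4 by blast+

lemma algebraic_int_s: "algebraic_int s"
  using d_ge_3 by (intro algebraic_int_4_sin2) simp

lemma K_eq_gen_field_pair: "K = gen_field {\<alpha>, s}"
  unfolding Fd_eq gen_field_gen_field_Un by (simp add: insert_commute)

lemma V_bounds: "0 < V" "V + s ^ 2 < 256 ^ 2"
proof -
  show "0 < V" using \<alpha>_bounds s_bounds by simp
  have "s * s \<le> \<alpha> * s" using \<alpha>_bounds s_bounds by (intro mult_right_mono) auto
  moreover have "\<alpha> * \<alpha> < 256 * 256" using \<alpha>_bounds by (intro mult_strict_mono) auto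
  ultimately show "V + s ^ 2 < 256 ^ 2" by (simp add: power2_eq_square algebra_simps)
qed

end

locale small_conjugates_primitive = small_conjugates +
  fixes \<theta> :: real and h\<^sub>\<alpha> h\<^sub>s :: "rat poly"
  assumes algebraic_\<theta>: "algebraic \<theta>" and conjs_\<theta>_real: "conjs \<theta> \<subseteq> \<real>"
    and K_eq_gen_field_\<theta>: "gen_field (Fd d \<union> {\<alpha>}) = gen_field {\<theta>}"
    and \<alpha>_eq: "rpoly h\<^sub>\<alpha> \<theta> = \<alpha>" and s_eq: "rpoly h\<^sub>s \<theta> = four_sin2 d"
begin

abbreviation V_at :: "real \<Rightarrow> real" where
  "V_at t \<equiv> rpoly h\<^sub>\<alpha> t * (rpoly h\<^sub>\<alpha> t - rpoly h\<^sub>s t)"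

lemma conj_s_in_sin2_conjs:
  assumes "complex_of_real t \<in> conjs \<theta>"
  shows "rpoly h\<^sub>s t \<in> sin2_conjs d"
proof -
  have "rpoly h\<^sub>s (complex_of_real t) \<in> conjs s"
    using rpoly_in_conjs[OF assms, of h\<^sub>s] by (simp only: s_eq)
  thus ?thesis unfolding conjs_4_sin2[OF d_ge_3] rpoly_of_real by auto
qed

lemma conj_\<alpha>_bounds:
  assumes t: "complex_of_real t \<in> conjs \<theta>" and nontrivial: "t \<noteq> \<theta>"
  shows "0 < rpoly h\<^sub>\<alpha> t" "rpoly h\<^sub>\<alpha> t < rpoly h\<^sub>s t"
proof -
  have "rpoly p t = 0" if "rpoly p \<theta> = 0" for p
    using conjsD[OF t that] unfolding rpoly_of_real by (simp only: of_real_eq_0_iff)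
  then obtain \<sigma> where \<sigma>: "\<And>h. \<sigma> (rpoly h \<theta>) = rpoly h t"
    and emb: "field_embedding (gen_field {\<theta>}) \<sigma>"
    using embedding_of_conj[OF algebraic_\<theta>, of t] by blast
  have "real_emb K \<sigma>" using emb unfolding real_emb_iff_field_embedding K_eq_gen_field_\<theta> .
  moreover have "\<sigma> \<theta> \<noteq> \<theta>" using nontrivial \<sigma>[of "[:0, 1:]"] by (simp only: rpoly_X not_False_eq_True)
  moreover have "\<theta> \<in> K" unfolding K_eq_gen_field_\<theta> using gen_field_superset by blast
  ultimately have "0 < \<sigma> \<alpha> \<and> \<sigma> \<alpha> < \<sigma> s" by (intro conjugates_small) blast+
  thus "0 < rpoly h\<^sub>\<alpha> t" "rpoly h\<^sub>\<alpha> t < rpoly h\<^sub>s t"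
    using \<sigma>[of h\<^sub>\<alpha>] \<sigma>[of h\<^sub>s] by (simp_all only: \<alpha>_eq s_eq)
qed

lemma K_eq_gen_field_\<alpha>: "K = gen_field {\<alpha>}"
proof -
  have "gen_field {\<theta>} = gen_field {rpoly h\<^sub>\<alpha> \<theta>}"
  proof (rule gen_field_eq_if_fibre_singleton[OF algebraic_\<theta>], rule ccontr)
    fix z assume z: "z \<in> conjs \<theta>" "rpoly h\<^sub>\<alpha> z = complex_of_real (rpoly h\<^sub>\<alpha> \<theta>)"
    assume "z \<noteq> complex_of_real \<theta>"
    obtain t where t: "z = complex_of_real t" using conjs_\<theta>_real z(1) by (blast elim: Reals_cases)
    have "rpoly h\<^sub>\<alpha> t = \<alpha>" using z(2) unfolding t rpoly_of_real of_real_eq_iff \<alpha>_eq .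
    moreover have "rpoly h\<^sub>\<alpha> t < rpoly h\<^sub>s t" using conj_\<alpha>_bounds z(1) \<open>z \<noteq> complex_of_real \<theta>\<close> t by blast
    moreover have "rpoly h\<^sub>s t \<le> 4" using sin2_conjs_le_4 conj_s_in_sin2_conjs z(1) t by blast
    ultimately show False using \<alpha>_bounds by linarith
  qed
  thus ?thesis unfolding K_eq_gen_field_\<theta> \<alpha>_eq .
qed

lemma test_polynomial_norm_ge_1:
  assumes q: "int_poly2 q" "q V s \<noteq> 0"
  obtains p where "\<And>t. rpoly p t = q (V_at t) (rpoly h\<^sub>s t)"
    "1 \<le> (\<Prod>z\<in>conjs \<theta>. norm (rpoly p z))"
proof -
  obtain p where p: "\<And>t. q (rpoly (h\<^sub>\<alpha> * (h\<^sub>\<alpha> - h\<^sub>s)) t) (rpoly h\<^sub>s t) = rpoly p t"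
    using int_poly2_rpoly[OF q(1)] by blast
  have p_\<theta>: "rpoly p \<theta> = q V s"
    using p[of \<theta>] by (simp only: rpoly_mult rpoly_diff \<alpha>_eq s_eq)
  have "algebraic_int (rpoly p \<theta>)"
    unfolding p_\<theta> by (intro int_poly2_algebraic_int[OF q(1)] algebraic_int_times algebraic_int_diff
        algebraic_int_\<alpha> algebraic_int_s)
  moreover have "rpoly p \<theta> \<noteq> 0" unfolding p_\<theta> by (rule q(2))
  ultimately have "1 \<le> (\<Prod>z\<in>conjs \<theta>. norm (rpoly p z))"
    by (rule prod_norm_rpoly_conjs_ge_1[OF algebraic_\<theta>])
  moreover have "rpoly p t = q (V_at t) (rpoly h\<^sub>s t)" for t
    using p[of t] by (simp only: rpoly_mult rpoly_diff)
  ultimately show ?thesis using that by blast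
qed

lemma norm_test_polynomial_le:
  assumes p: "\<And>t. rpoly p t = q (V_at t) (rpoly h\<^sub>s t)"
    and bound: "bounded_at_conjs d q k G"
    and z: "z \<in> conjs \<theta>" "z \<noteq> complex_of_real \<theta>"
  shows "norm (rpoly p z) \<le> norm (rpoly h\<^sub>s z) ^ k * G"
proof -
  obtain t where t: "z = complex_of_real t" using conjs_\<theta>_real z(1) by (blast elim: Reals_cases)
  define a b where "a = rpoly h\<^sub>\<alpha> t" and "b = rpoly h\<^sub>s t"
  have a: "0 < a" "a < b" using conj_\<alpha>_bounds[of t] z t by (auto simp: a_def b_def)
  have b: "b \<in> sin2_conjs d" using conj_s_in_sin2_conjs[of t] z t by (simp add: b_def)
  obtain w where w: "0 \<le> w" "w \<le> 1 / 4" "a * (a - b) = - (b ^ 2 * w)"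
    using quadratic_ratio[OF a] by blast
  have "norm (rpoly p z) = \<bar>q (a * (a - b)) b\<bar>"
    by (simp only: t rpoly_of_real norm_of_real p a_def b_def)
  also have "\<dots> \<le> b ^ k * G" unfolding w(3) by (rule bounded_at_conjsD[OF bound b w(1,2)])
  also have "\<dots> = norm (rpoly h\<^sub>s z) ^ k * G"
    unfolding t rpoly_of_real norm_of_real b_def[symmetric] using a by simp
  finally show ?thesis .
qed

lemma finite_conjs_\<theta>: "finite (conjs \<theta>)"
  by (rule finite_conjs[OF algebraic_\<theta>])

lemma finite_conjs_s: "finite (conjs s)"
  using algebraic_int_s by (auto intro: finite_conjs)

lemma rpoly_h_s_conjs_\<theta>: "rpoly h\<^sub>s ` conjs \<theta> \<subseteq> conjs s"
  using rpoly_in_conjs[of _ \<theta> h\<^sub>s] unfolding s_eq by blast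

lemma prod_conjs_s_powers:
  assumes fibres: "\<And>y. y \<in> conjs s \<Longrightarrow> card {z\<in>conjs \<theta>. rpoly h\<^sub>s z = y} = m"
  shows "(\<Prod>z\<in>conjs \<theta>. norm (rpoly h\<^sub>s z) ^ k * G) =
    (exp (mangoldt d) ^ k * G ^ card (half_totatives d)) ^ m"
proof -
  have "(\<Prod>z\<in>conjs \<theta>. norm (rpoly h\<^sub>s z) ^ k * G) = (\<Prod>y\<in>conjs s. norm y ^ k * G) ^ m"
    by (rule prod_equal_fibres[OF finite_conjs_\<theta> finite_conjs_s rpoly_h_s_conjs_\<theta> fibres])
  also have "(\<Prod>y\<in>conjs s. norm y ^ k * G) = (\<Prod>b\<in>sin2_conjs d. b ^ k * G)"
    unfolding conjs_4_sin2[OF d_ge_3]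
    by (subst prod.reindex) (auto simp: inj_on_def abs_of_pos sin2_conjs_pos intro!: prod.cong)
  also have "\<dots> = exp (mangoldt d) ^ k * G ^ card (half_totatives d)"
    by (simp add: prod.distrib card_sin2_conjs prod_sin2_conjs[OF d_ge_3] flip: prod_power_distrib)
  finally show ?thesis .
qed

lemma norm_inequality:
  assumes fibres: "\<And>y. y \<in> conjs s \<Longrightarrow> card {z\<in>conjs \<theta>. rpoly h\<^sub>s z = y} = m"
    and q: "int_poly2 q" "q V s \<noteq> 0" and G: "0 < G"
    and bound: "bounded_at_conjs d q k G"
  shows "s ^ k * G \<le>
    \<bar>q V s\<bar> * (exp (mangoldt d) ^ k * G ^ card (half_totatives d)) ^ m"
proof -
  obtain p where p: "\<And>t. rpoly p t = q (V_at t) (rpoly h\<^sub>s t)"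
    and norm_ge_1: "1 \<le> (\<Prod>z\<in>conjs \<theta>. norm (rpoly p z))"
    using test_polynomial_norm_ge_1[OF q] by blast
  define g where "g z = norm (rpoly h\<^sub>s z) ^ k * G" for z :: complex
  let ?T = "conjs \<theta> - {complex_of_real \<theta>}"
  note remove = prod.remove[OF finite_conjs_\<theta> of_real_in_conjs[of \<theta>]]
  have p_\<theta>: "norm (rpoly p (complex_of_real \<theta>)) = \<bar>q V s\<bar>"
    by (simp only: rpoly_of_real norm_of_real p \<alpha>_eq s_eq)
  have g_\<theta>: "g (complex_of_real \<theta>) = s ^ k * G"
    unfolding g_def rpoly_of_real norm_of_real s_eq using s_bounds(1) by simp
  have p_le: "norm (rpoly p z) \<le> g z" if "z \<in> ?T" for z
    unfolding g_def using norm_test_polynomial_le[OF p bound] that by blast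
  have "s ^ k * G * 1 \<le> s ^ k * G * (\<Prod>z\<in>conjs \<theta>. norm (rpoly p z))"
    using norm_ge_1 s_bounds G by (intro mult_left_mono) auto
  also have "\<dots> = \<bar>q V s\<bar> * (s ^ k * G * (\<Prod>z\<in>?T. norm (rpoly p z)))"
    unfolding remove p_\<theta> by (simp only: mult_ac)
  also have "\<dots> \<le> \<bar>q V s\<bar> * (s ^ k * G * (\<Prod>z\<in>?T. g z))"
    using p_le s_bounds G by (intro mult_left_mono prod_mono conjI) auto
  also have "s ^ k * G * (\<Prod>z\<in>?T. g z) = (\<Prod>z\<in>conjs \<theta>. g z)"
    unfolding remove g_\<theta> ..
  also have "\<dots> = (exp (mangoldt d) ^ k * G ^ card (half_totatives d)) ^ m"
    unfolding g_def by (rule prod_conjs_s_powers[OF fibres])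
  finally show ?thesis by simp
qed

lemma degree_bounds:
  obtains m where "0 < m" "fdeg K (Fd d) \<le> m" "fdeg K (gen_field {}) \<le> m * card (half_totatives d)"
    "norm_bound d V m"
proof -
  obtain m where m: "0 < m"
    and fibres: "\<And>y. y \<in> conjs s \<Longrightarrow> card {z\<in>conjs \<theta>. rpoly h\<^sub>s z = y} = m"
    using card_conj_fibres[OF algebraic_\<theta>, of h\<^sub>s] unfolding s_eq by blast
  have "fdeg K (Fd d) \<le> card {z\<in>conjs \<theta>. rpoly h\<^sub>s z = complex_of_real s}"
    using fdeg_gen_field_le_card_fibre[OF algebraic_\<theta>, of h\<^sub>s]
    by (simp only: s_eq flip: Fd_eq K_eq_gen_field_\<theta>)
  hence deg_Fd: "fdeg K (Fd d) \<le> m" using fibres[OF of_real_in_conjs] by simp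
  have "card (conjs \<theta>) = m * card (conjs s)"
    by (rule card_equal_fibres[OF finite_conjs_\<theta> finite_conjs_s rpoly_h_s_conjs_\<theta> fibres])
  also have "card (conjs s) = card (half_totatives d)"
    unfolding conjs_4_sin2[OF d_ge_3] by (simp add: card_image inj_on_def card_sin2_conjs)
  finally have "fdeg K (gen_field {}) \<le> m * card (half_totatives d)"
    using fdeg_gen_field_le_card_conjs[OF algebraic_\<theta>] by (simp only: K_eq_gen_field_\<theta>)
  moreover have "norm_bound d V m"
    by unfold_locales (use d_ge_3 V_bounds norm_inequality[OF fibres] in auto)
  ultimately show ?thesis using that m deg_Fd by blast
qed

end

context small_conjugates
begin

lemma primitive_element_exists: "\<exists>\<theta> h\<^sub>\<alpha> h\<^sub>s. small_conjugates_primitive d \<alpha> \<theta> h\<^sub>\<alpha> h\<^sub>s"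
proof -
  have algebraic: "algebraic \<alpha>" "algebraic s"
    using algebraic_int_\<alpha> algebraic_int_s by blast+
  obtain l where l: "gen_field {\<alpha> + real l * s} = gen_field {\<alpha>, s}"
    by (rule primitive_element[OF algebraic])
  define \<theta> where "\<theta> = \<alpha> + real l * s"
  have "algebraic_int \<theta>" unfolding \<theta>_def
    by (intro algebraic_int_plus algebraic_int_times algebraic_int_\<alpha> algebraic_int_s) simp
  hence \<theta>: "algebraic \<theta>" by blast
  have K: "K = gen_field {\<theta>}" unfolding K_eq_gen_field_pair \<theta>_def l ..
  have "\<alpha> \<in> K" "s \<in> K"
    unfolding K_eq_gen_field_pair using gen_field_superset[of "{\<alpha>, s}"] by auto
  then obtain h\<^sub>\<alpha> h\<^sub>s where "\<alpha> = rpoly h\<^sub>\<alpha> \<theta>" "s = rpoly h\<^sub>s \<theta>"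
    unfolding K gen_field_eq_range_rpoly[OF \<theta>] by blast
  note h = this[symmetric]
  have "conjs \<theta> \<subseteq> \<real>"
  proof (rule conjs_real_combination)
    show "\<theta> = rpoly h\<^sub>\<alpha> \<theta> + real l * rpoly h\<^sub>s \<theta>" unfolding h by (rule \<theta>_def)
    show "conjs (rpoly h\<^sub>\<alpha> \<theta>) \<subseteq> \<real>" unfolding h by (rule totally_real_imp_conjs_real[OF totally_real_\<alpha>])
    show "conjs (rpoly h\<^sub>s \<theta>) \<subseteq> \<real>" unfolding h conjs_4_sin2[OF d_ge_3] by auto
  qed
  hence "small_conjugates_primitive d \<alpha> \<theta> h\<^sub>\<alpha> h\<^sub>s"
    by unfold_locales (use \<theta> K h in auto)
  thus ?thesis by blast
qed

lemma K_eq_gen_field_\<alpha>: "K = gen_field {\<alpha>}"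
  using primitive_element_exists small_conjugates_primitive.K_eq_gen_field_\<alpha> by blast

lemma degree_bounds:
  obtains m where "0 < m" "fdeg K (Fd d) \<le> m" "fdeg K (gen_field {}) \<le> m * card (half_totatives d)"
    "norm_bound d V m"
  using primitive_element_exists small_conjugates_primitive.degree_bounds by metis

end

section \<open>Lower bounds for \<open>4 sin\<^sup>2(\<pi>/d)\<close> and for the totient\<close>

lemma cos_le_taylor_4: "cos x \<le> 1 - x ^ 2 / 2 + x ^ 4 / 24" for x :: real
proof -
  obtain t where "cos x = (\<Sum>m<4. cos_coeff m * x ^ m) + cos (t + 1 / 2 * real 4 * pi) / fact 4 * x ^ 4"
    using Maclaurin_cos_expansion[of x 4] by blast
  moreover have "(\<Sum>m<4. cos_coeff m * x ^ m) = 1 - x ^ 2 / 2"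
    by (simp add: lessThan_nat_numeral cos_coeff_def fact_numeral)
  moreover have "cos (t + 1 / 2 * real 4 * pi) / fact 4 * x ^ 4 \<le> 1 / fact 4 * x ^ 4"
    by (intro mult_right_mono divide_right_mono) auto
  moreover have "(fact 4 :: real) = 24" by (simp add: fact_numeral)
  ultimately show ?thesis by simp
qed

lemma four_sin2_lower:
  assumes d: "d \<ge> 3"
  shows "(39 * real d ^ 2 - 128) / real d ^ 4 \<le> four_sin2 d"
proof -
  define x where "x = pi / real d"
  have pi_lower: "986 / 100 \<le> pi ^ 2"
    using power_mono[of "31415 / 10000" pi 2] pi_approx by (simp add: power2_eq_square)
  have "pi ^ 2 \<le> 987 / 100"
    using power_mono[of pi "31416 / 10000" 2] pi_approx by (simp add: power2_eq_square)
  hence "(pi ^ 2) ^ 2 \<le> (987 / 100) ^ 2" by (intro power_mono) auto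
  hence pi_upper: "pi ^ 4 \<le> 9742 / 100" by (simp flip: power_mult) (simp add: power2_eq_square)
  have "9 \<le> real d ^ 2" using power_mono[of 3 "real d" 2] d by simp
  hence "(4 * pi ^ 2 - 39) * 9 \<le> (4 * pi ^ 2 - 39) * real d ^ 2"
    using pi_lower by (intro mult_left_mono) auto
  hence "39 * real d ^ 2 - 128 \<le> 4 * pi ^ 2 * real d ^ 2 - 4 / 3 * pi ^ 4"
    using pi_lower pi_upper by (simp add: algebra_simps)
  hence "(39 * real d ^ 2 - 128) / real d ^ 4 \<le> (4 * pi ^ 2 * real d ^ 2 - 4 / 3 * pi ^ 4) / real d ^ 4"
    by (rule divide_right_mono) simp
  also have "\<dots> = 4 * x ^ 2 - 4 / 3 * x ^ 4"
    using d by (simp add: x_def power_divide field_simps power2_eq_square power4_eq_xxxx)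
  also have "\<dots> \<le> 2 - 2 * cos (2 * x)"
    using cos_le_taylor_4[of "2 * x"] by (simp add: power_mult_distrib)
  also have "\<dots> = four_sin2 d" using cos_double_sin[of x] by (simp add: x_def)
  finally show ?thesis .
qed

lemma totient_prime_power_mult:
  assumes "prime p" "\<not> p dvd m" "k > 0"
  shows "totient (p ^ k * m) = p ^ (k - 1) * (p - 1) * totient m"
proof -
  have "coprime (p ^ k) m" using assms by (simp add: prime_imp_coprime)
  thus ?thesis using assms by (simp add: totient_mult_coprime totient_prime_power)
qed

lemma prime_part_decompose:
  assumes "prime (p::nat)" "n > 0"
  obtains k m where "n = p ^ k * m" "\<not> p dvd m" "m > 0"
proof -
  obtain m where "n = p ^ multiplicity p n * m" "\<not> p dvd m"
    using assms by (elim multiplicity_decompose'[of n p, rotated 2]) (auto dest: not_prime_unit)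
  thus ?thesis using that[of "multiplicity p n" m] assms(2) by (cases "m = 0") auto
qed

lemma totient_bound_prime_part:
  assumes p: "prime p" "\<not> p dvd m" and ab: "a * p ^ 5 \<le> b * (p - 1) ^ 6" "a \<le> b"
    and m: "c * m ^ 5 \<le> e * totient m ^ 6"
  shows "a * c * (p ^ k * m) ^ 5 \<le> b * e * totient (p ^ k * m) ^ 6"
proof (cases k)
  case 0
  thus ?thesis using mult_le_mono[OF ab(2) m] by (simp add: mult.assoc)
next
  case (Suc j)
  have "p \<ge> 1" using prime_gt_0_nat[OF p(1)] by simp
  have "a * c * (p ^ k * m) ^ 5 = p ^ (5 * j) * (a * p ^ 5) * (c * m ^ 5)"
    by (simp add: Suc power_mult_distrib power_mult power_add mult_ac)
  also have "\<dots> \<le> p ^ (6 * j) * (b * (p - 1) ^ 6) * (e * totient m ^ 6)"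
    using \<open>p \<ge> 1\<close> by (intro mult_le_mono[OF mult_le_mono[OF power_increasing ab(1)] m]) auto
  also have "\<dots> = b * e * (p ^ j * (p - 1) * totient m) ^ 6"
    by (simp add: power_mult_distrib mult_ac flip: power_mult)
  also have "p ^ j * (p - 1) * totient m = totient (p ^ k * m)"
    using totient_prime_power_mult[OF p, of k] Suc by simp
  finally show ?thesis .
qed

lemma power5_le_pred_power6:
  assumes "p \<ge> (5::nat)"
  shows "p ^ 5 \<le> (p - 1) ^ 6"
proof -
  obtain r where r: "p = r + 1" "r \<ge> 4" using assms by (cases p) auto
  have "(4 * (r + 1)) ^ 5 \<le> (5 * r) ^ 5" using r by (intro power_mono) auto
  hence "1024 * (r + 1) ^ 5 \<le> 3125 * r ^ 5" unfolding power_mult_distrib by simp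
  moreover have "4 * r ^ 5 \<le> r * r ^ 5" using r by (intro mult_right_mono) auto
  ultimately have "(r + 1) ^ 5 \<le> r * r ^ 5" by linarith
  thus ?thesis using r by (simp flip: power_Suc)
qed

lemma totient_bound_coprime_6:
  "n > 0 \<Longrightarrow> \<not> 2 dvd n \<Longrightarrow> \<not> 3 dvd n \<Longrightarrow> n ^ 5 \<le> totient n ^ 6"
proof (induction n rule: less_induct)
  case (less n)
  show ?case
  proof (cases "n = 1")
    case False
    then obtain p where p: "prime p" "p dvd n" using prime_factor_nat by blast
    have "p \<noteq> 2" "p \<noteq> 3" "p \<noteq> 4" "p \<ge> 2" using p less.prems prime_ge_2_nat by auto
    hence "p \<ge> 5" by simp
    obtain k m where n: "n = p ^ k * m" and m: "\<not> p dvd m" "m > 0"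
      using prime_part_decompose[OF p(1) less.prems(1)] .
    have "k \<noteq> 0" using n m(1) p(2) by (intro notI) simp
    hence "1 < p ^ k" using one_less_power[of p k] \<open>p \<ge> 5\<close> by simp
    hence "m < n" using n m(2) by simp
    hence "m ^ 5 \<le> totient m ^ 6" using less n m by (auto intro!: less.IH)
    thus ?thesis
      using totient_bound_prime_part[OF p(1) m(1), of 1 1 1 1 k] power5_le_pred_power6[OF \<open>p \<ge> 5\<close>]
      by (simp add: n)
  qed simp
qed

lemma totient_lower_bound:
  assumes "n > 0"
  shows "2 * n ^ 5 \<le> 243 * totient n ^ 6"
proof -
  obtain i l where l: "n = 2 ^ i * l" "\<not> 2 dvd l" "l > 0"
    using prime_part_decompose[of 2 n] assms by auto
  obtain j m where m: "l = 3 ^ j * m" "\<not> 3 dvd m" "m > 0"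
    using prime_part_decompose[of 3 l] l by auto
  have "\<not> 2 dvd m" using l(2) m(1) by auto
  hence "m ^ 5 \<le> totient m ^ 6" using totient_bound_coprime_6 m by blast
  hence "64 * l ^ 5 \<le> 243 * totient l ^ 6"
    using totient_bound_prime_part[of 3 m 64 243 1 1 j] m by simp
  hence "64 * n ^ 5 \<le> 32 * 243 * totient n ^ 6"
    using totient_bound_prime_part[of 2 l 1 32 64 243 i] l by simp
  thus ?thesis by simp
qed

lemma power_le_exponential:
  fixes n n0 k B C :: nat
  assumes "n \<ge> n0" "n0 > 0" "C * n0 ^ k \<le> D * B ^ n0" "(n0 + 1) ^ k \<le> B * n0 ^ k"
  shows "C * n ^ k \<le> D * B ^ n"
  using assms(1)
proof (induction n rule: dec_induct)
  case base
  show ?case using assms(3) .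
next
  case (step n)
  have "n0 * (n + 1) \<le> (n0 + 1) * n" using step by (simp add: algebra_simps)
  hence "(n0 * (n + 1)) ^ k \<le> ((n0 + 1) * n) ^ k" by (rule power_mono) simp
  hence "n0 ^ k * (n + 1) ^ k \<le> (n0 + 1) ^ k * n ^ k" by (simp only: power_mult_distrib)
  also have "\<dots> \<le> B * n0 ^ k * n ^ k" using assms(4) by (rule mult_right_mono) simp
  finally have "n0 ^ k * (n + 1) ^ k \<le> n0 ^ k * (B * n ^ k)" by (simp add: algebra_simps)
  hence "(n + 1) ^ k \<le> B * n ^ k" using assms(2) by simp
  hence "C * (n + 1) ^ k \<le> B * (C * n ^ k)" by (metis mult.left_commute mult_le_mono2)
  also have "\<dots> \<le> B * (D * B ^ n)" using step by (intro mult_left_mono) auto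
  finally show ?case by (simp add: algebra_simps)
qed

lemma totient_exponential:
  assumes d: "d \<ge> 210"
  shows "182 * d ^ 4 \<le> 2 ^ totient d"
proof -
  define n where "n = totient d"
  have lower: "2 * d ^ 5 \<le> 243 * n ^ 6" unfolding n_def using d by (intro totient_lower_bound) simp
  have "2 * 210 ^ 5 \<le> 2 * d ^ 5" using d by (intro mult_left_mono power_mono) auto
  hence lower_210: "2 * 210 ^ 5 \<le> 243 * n ^ 6" using lower by linarith
  have n: "n \<ge> 39"
  proof (rule ccontr)
    assume "\<not> n \<ge> 39"
    hence "n ^ 6 \<le> 38 ^ 6" by (intro power_mono) auto
    thus False using lower_210 by simp
  qed
  have "16 * (182 * d ^ 4) ^ 5 = 182 ^ 5 * (2 * d ^ 5) ^ 4"
    by (simp add: power_mult_distrib flip: power_mult)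
  also have "\<dots> \<le> 182 ^ 5 * (243 * n ^ 6) ^ 4" using lower by (intro mult_left_mono power_mono) auto
  also have "\<dots> = (182 ^ 5 * 243 ^ 4) * n ^ 24" by (simp add: power_mult_distrib flip: power_mult)
  also have "\<dots> \<le> 16 * 32 ^ n" by (rule power_le_exponential[OF n]) simp_all
  also have "(32::nat) ^ n = (2 ^ 5) ^ n" by simp
  also have "\<dots> = (2 ^ n) ^ 5" by (simp only: power_mult[symmetric] mult.commute)
  finally have "(182 * d ^ 4) ^ 5 \<le> (2 ^ n) ^ 5" by simp
  thus ?thesis unfolding n_def by (simp only: power_mono_iff)
qed

lemma totient_primepow_exponential:
  assumes d: "d \<ge> 210" "primepow d"
  shows "182 * d ^ 4 * aprimedivisor d ^ 2 \<le> 2 ^ totient d"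
proof -
  obtain q k where q: "prime q" "k > 0" "d = q ^ k" using d(2) by (auto simp: primepow_def)
  have q2: "q \<ge> 2" using q(1) prime_ge_2_nat by blast
  have base: "aprimedivisor d = q" using q by (simp add: aprimedivisor_prime_power)
  have "q \<le> d" using q(2,3) q2 by (simp add: self_le_power)
  have "d = q ^ (k - 1) * q" using q(2,3) by (cases k) simp_all
  also have "\<dots> \<le> q ^ (k - 1) * (2 * (q - 1))" using q2 by (intro mult_left_mono) auto
  also have "\<dots> = 2 * totient d" using q by (simp add: totient_prime_power)
  finally have half: "d \<le> 2 * totient d" .
  hence n: "totient d \<ge> 105" using d(1) by simp
  have "182 * d ^ 4 * aprimedivisor d ^ 2 \<le> 182 * d ^ 4 * d ^ 2"
    unfolding base using \<open>q \<le> d\<close> by (intro mult_left_mono power_mono) auto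
  also have "\<dots> = 182 * d ^ 6" by (simp flip: power_add)
  also have "\<dots> \<le> 182 * (2 * totient d) ^ 6" using half by (intro mult_left_mono power_mono) auto
  also have "\<dots> = (182 * 64) * totient d ^ 6" by (simp add: power_mult_distrib)
  also have "\<dots> \<le> 1 * 2 ^ totient d" by (rule power_le_exponential[OF n]) simp_all
  finally show ?thesis by simp
qed

lemma exp_mangoldt_totient_exponential:
  assumes d: "d \<ge> 210"
  shows "182 * real d ^ 4 * exp (mangoldt d) ^ 2 \<le> 2 ^ totient d"
proof (cases "primepow d")
  case True
  have "aprimedivisor d > 0" using d aprimedivisor_pos_nat[of d] by simp
  hence "exp (mangoldt d) = real (aprimedivisor d)" using True by (simp add: mangoldt_def)
  moreover have "real (182 * d ^ 4 * aprimedivisor d ^ 2) \<le> real (2 ^ totient d)"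
    using totient_primepow_exponential[OF d True] by (simp only: of_nat_le_iff)
  ultimately show ?thesis by simp
next
  case False
  have "real (182 * d ^ 4) \<le> real (2 ^ totient d)"
    using totient_exponential[OF d] by (simp only: of_nat_le_iff)
  thus ?thesis using False by (simp add: mangoldt_def)
qed

section \<open>From test polynomials to degree bounds\<close>

context norm_bound
begin

lemma degree_less:
  assumes q: "int_poly2 q" "0 < q V (four_sin2 d)" "q V (four_sin2 d) < Q" and G: "0 < G"
    and bound: "bounded_at_conjs d q k G"
    and \<gamma>: "exp (mangoldt d) \<le> \<gamma>" "\<gamma> ^ k * G ^ card (half_totatives d) \<le> 1"
    and s': "0 \<le> s'" "s' \<le> four_sin2 d"
    and M: "Q * (\<gamma> ^ k * G ^ card (half_totatives d)) ^ M \<le> s' ^ k * G"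
  shows "m < M"
proof (rule ccontr)
  assume "\<not> m < M"
  hence "M \<le> m" by simp
  let ?q = "q V (four_sin2 d)"
  define X where "X = exp (mangoldt d) ^ k * G ^ card (half_totatives d)"
  define Y where "Y = \<gamma> ^ k * G ^ card (half_totatives d)"
  have X: "0 < X" "X \<le> Y" "Y \<le> 1"
    unfolding X_def Y_def using \<gamma> G by (auto intro!: mult_right_mono power_mono)
  have "s' ^ k * G \<le> four_sin2 d ^ k * G" using s' G by (intro mult_right_mono power_mono) auto
  also have "\<dots> \<le> \<bar>?q\<bar> * X ^ m"
    unfolding X_def using q(2) by (intro norm_bound[OF q(1) _ G bound]) auto
  also have "\<dots> \<le> ?q * X ^ M"
    using X \<open>M \<le> m\<close> q(2) by (auto intro!: mult_left_mono power_decreasing)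
  also have "\<dots> \<le> ?q * Y ^ M" using X q(2) by (intro mult_left_mono power_mono) auto
  also have "\<dots> < Q * Y ^ M" using X q(3) by (intro mult_strict_right_mono) auto
  also have "\<dots> \<le> s' ^ k * G" unfolding Y_def by (rule M)
  finally show False by simp
qed

lemma bounded_linear_test_poly: "bounded_at_conjs d (\<lambda>v b. v) 2 (1 / 4)"
proof (rule bounded_at_conjsI)
  fix b w :: real assume "b \<in> sin2_conjs d" "0 \<le> w" "w \<le> 1 / 4"
  thus "\<bar>- (b ^ 2 * w)\<bar> \<le> b ^ 2 * (1 / 4)"
    using mult_left_mono[of w "1 / 4" "b ^ 2"] by (simp add: abs_mult)
qed

lemma V_less_256: "V < 256 ^ 2"
  using V_less sin2_conjs_pos[OF four_sin2_in_sin2_conjs[OF d_ge_3]] by (smt (verit) zero_le_power2)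

lemma degree_zero_if_large:
  assumes d: "d \<ge> 210"
  shows "m = 0"
proof -
  define g where "g = exp (mangoldt d :: real)"
  have d0: "real d > 0" using d by simp
  have exponential: "182 * real d ^ 4 * g ^ 2 \<le> 2 ^ totient d"
    unfolding g_def by (rule exp_mangoldt_totient_exponential[OF d])
  have power4: "(4 :: real) ^ card (half_totatives d) = 2 ^ totient d"
    using totient_eq_half_totatives[OF d_ge_3] by (simp add: power_mult)
  have "38 * real d ^ 2 \<le> 39 * real d ^ 2 - 128"
    using power_mono[of 210 "real d" 2] d by simp
  hence "38 / real d ^ 2 \<le> (39 * real d ^ 2 - 128) / real d ^ 4"
    using d0 by (simp add: field_simps power2_eq_square power4_eq_xxxx)
  also have "\<dots> \<le> four_sin2 d" by (rule four_sin2_lower[OF d_ge_3])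
  finally have s': "38 / real d ^ 2 \<le> four_sin2 d" .
  have "m < 1"
  proof (rule degree_less[OF int_poly2.fst V_pos V_less_256 _ bounded_linear_test_poly])
    have "1 ^ 4 \<le> real d ^ 4" using d by (intro power_mono) auto
    hence "1 * g ^ 2 \<le> 182 * real d ^ 4 * g ^ 2" by (intro mult_right_mono) auto
    hence "g ^ 2 \<le> 2 ^ totient d" using exponential by linarith
    thus "g ^ 2 * (1 / 4) ^ card (half_totatives d) \<le> 1"
      by (simp add: power_divide power4)
    have "256 ^ 2 * 4 * real d ^ 4 * g ^ 2 \<le> 1444 * (182 * real d ^ 4 * g ^ 2)" by simp
    also have "\<dots> \<le> 1444 * 2 ^ totient d" using exponential by (intro mult_left_mono) auto
    finally have "256 ^ 2 * 4 * real d ^ 4 * g ^ 2 \<le> 1444 * 2 ^ totient d" .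
    thus "256 ^ 2 * (g ^ 2 * (1 / 4) ^ card (half_totatives d)) ^ 1 \<le> (38 / real d ^ 2) ^ 2 * (1 / 4)"
      using d0 by (simp add: power_divide power4 field_simps flip: power_mult)
  qed (use s' in \<open>auto simp: g_def\<close>)
  thus ?thesis by simp
qed

end

definition smallest_factor :: "nat \<Rightarrow> nat" where
  "smallest_factor d = the (List.find (\<lambda>k. k dvd d) [2..<Suc d])"

lemma smallest_factor:
  assumes "d \<ge> 2"
  shows "2 \<le> smallest_factor d" "smallest_factor d dvd d"
    "\<And>k. 2 \<le> k \<Longrightarrow> k dvd d \<Longrightarrow> smallest_factor d \<le> k"
proof -
  have "List.find (\<lambda>k. k dvd d) [2..<Suc d] \<noteq> None"
    using assms by (auto simp: find_None_iff)
  then obtain q where find: "List.find (\<lambda>k. k dvd d) [2..<Suc d] = Some q" by blast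
  hence q: "smallest_factor d = q" by (simp add: smallest_factor_def del: upt_Suc)
  obtain i where i: "i < length [2..<Suc d]" "[2..<Suc d] ! i dvd d" "q = [2..<Suc d] ! i"
    "\<forall>j<i. \<not> [2..<Suc d] ! j dvd d"
    using find unfolding find_Some_iff by blast
  hence qi: "q = 2 + i" by (simp del: upt_Suc)
  thus "2 \<le> smallest_factor d" "smallest_factor d dvd d" using i(2,3) q by auto
  fix k assume k: "2 \<le> k" "k dvd d"
  show "smallest_factor d \<le> k"
  proof (rule ccontr)
    assume "\<not> smallest_factor d \<le> k"
    hence "k - 2 < i" "[2..<Suc d] ! (k - 2) = k" using k(1) q qi i(1) by (simp_all del: upt_Suc)
    thus False using i(4) k(2) by metis
  qed
qed

lemma smallest_factor_prime_power:
  assumes p: "prime p" and k: "k > 0"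
  shows "smallest_factor (p ^ k) = p"
proof (rule antisym)
  have p2: "p \<ge> 2" using prime_ge_2_nat[OF p] .
  hence d: "p ^ k \<ge> 2" using k self_le_power[of p k] by simp
  show "smallest_factor (p ^ k) \<le> p" using smallest_factor(3)[OF d p2] k by simp
  obtain j where j: "smallest_factor (p ^ k) = p ^ j"
    using smallest_factor(2)[OF d] divides_primepow_nat[OF p] by blast
  moreover have "j \<noteq> 0" using smallest_factor(1)[OF d] j by (intro notI) simp
  ultimately show "p \<le> smallest_factor (p ^ k)" using p2 by (simp add: self_le_power)
qed

text \<open>The exponent \<open>9\<close> is large enough for \<open>d < 512 = 2\<^sup>9\<close>.\<close>

definition prime_power_base :: "nat \<Rightarrow> nat" where
  "prime_power_base d = (let q = smallest_factor d in if d dvd q ^ 9 then q else 1)"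

lemma exp_mangoldt_le_prime_power_base:
  assumes d: "2 \<le> d" "d < 512"
  shows "exp (mangoldt d) \<le> real (prime_power_base d)"
proof (cases "primepow d")
  case True
  then obtain p k where p: "prime p" "k > 0" "d = p ^ k" by (auto simp: primepow_def)
  have "2 ^ k \<le> d" using prime_ge_2_nat[OF p(1)] p(3) by (simp add: power_mono)
  hence "(2::nat) ^ k < 2 ^ 9" using d(2) by simp
  hence "k < 9" by (simp only: power_strict_increasing_iff)
  hence "prime_power_base d = p"
    using smallest_factor_prime_power[OF p(1,2)] p(3)
    by (simp add: prime_power_base_def le_imp_power_dvd)
  thus ?thesis using p prime_gt_0_nat[OF p(1)] by simp
next
  case False
  have "1 \<le> prime_power_base d"
    using smallest_factor(1)[OF d(1)] by (simp add: prime_power_base_def Let_def)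
  thus ?thesis using False by (simp add: mangoldt_def)
qed

definition degree_limit :: "nat \<Rightarrow> nat" where
  "degree_limit d = (if d \<in> admissible_d then mbound d + 1 else 1)"

text \<open>An integral form of the numerical hypotheses of \<open>degree_less\<close> for \<open>G = 1/N\<close>, with the bound
  \<open>(39 d\<^sup>2 - 128) / d\<^sup>4\<close> for \<open>4 sin\<^sup>2(\<pi>/d)\<close>.\<close>

definition degree_test :: "nat \<Rightarrow> nat \<Rightarrow> nat \<Rightarrow> nat \<Rightarrow> bool" where
  "degree_test k N Q d \<longleftrightarrow>
    (let M = degree_limit d; g = prime_power_base d; n = totient d div 2; D = d ^ 2
     in g ^ k \<le> N ^ n \<and> Q * g ^ (k * M) * N * (D ^ 2) ^ k \<le> (39 * D - 128) ^ k * N ^ (n * M))"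

lemma (in norm_bound) degree_less_degree_limit_if_test:
  assumes d: "d < 512" and q: "int_poly2 q" "0 < q V (four_sin2 d)" "q V (four_sin2 d) < real Q"
    and N: "0 < N"
    and bound: "bounded_at_conjs d q k (1 / real N)"
    and test: "degree_test k N Q d"
  shows "m < degree_limit d"
proof -
  define M g n D where "M = degree_limit d" and "g = prime_power_base d"
    and "n = totient d div 2" and "D = d ^ 2"
  have n: "card (half_totatives d) = n"
    using totient_eq_half_totatives[OF d_ge_3] by (simp add: n_def)
  have test_base: "g ^ k \<le> N ^ n"
    and test_limit: "Q * g ^ (k * M) * N * (D ^ 2) ^ k \<le> (39 * D - 128) ^ k * N ^ (n * M)"
    using test unfolding degree_test_def Let_def M_def g_def n_def D_def by blast+
  have D: "D \<ge> 9" using power_mono[OF d_ge_3, of 2] by (simp add: D_def)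
  have s': "real (39 * D - 128) / real (D ^ 2) \<le> four_sin2 d"
    using four_sin2_lower[OF d_ge_3] D by (simp add: of_nat_diff D_def flip: power_mult)
  show ?thesis unfolding M_def[symmetric]
  proof (rule degree_less[OF q _ bound exp_mangoldt_le_prime_power_base[of d, folded g_def] _ _ s'])
    have "real (g ^ k) \<le> real (N ^ n)" using test_base by (simp only: of_nat_le_iff)
    thus "real g ^ k * (1 / real N) ^ card (half_totatives d) \<le> 1"
      using N by (simp add: n power_divide divide_le_eq_1)
    have "real (Q * g ^ (k * M) * N * (D ^ 2) ^ k) \<le> real ((39 * D - 128) ^ k * N ^ (n * M))"
      using test_limit by (simp only: of_nat_le_iff)
    hence "real Q * real g ^ (k * M) / real N ^ (n * M) \<le>
        real (39 * D - 128) ^ k / real (D ^ 2) ^ k / real N"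
      using N D by (simp add: field_simps del: of_nat_diff)
    thus "real Q * (real g ^ k * (1 / real N) ^ card (half_totatives d)) ^ M \<le>
        (real (39 * D - 128) / real (D ^ 2)) ^ k * (1 / real N)"
      by (simp add: n power_divide power_mult_distrib flip: power_mult)
  qed (use d d_ge_3 N in auto)
qed

section \<open>The test polynomials\<close>

lemma power_le_tangent:
  assumes "0 \<le> y" "0 < (r::real)"
  shows "y ^ e \<le> r ^ e * exp (real e * (y / r - 1))"
proof -
  have "y / r \<le> exp (y / r - 1)" using exp_ge_add_one_self[of "y / r - 1"] by simp
  hence "y \<le> r * exp (y / r - 1)" using assms by (simp add: pos_divide_le_eq mult.commute)
  hence "y ^ e \<le> (r * exp (y / r - 1)) ^ e" using assms by (intro power_mono) auto
  thus ?thesis by (simp add: power_mult_distrib exp_of_nat_mult)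
qed

text \<open>Applied with the values \<open>r\<^sub>i\<close> of the linear factors at a rational point close to the maximum of
  the product, so that the sum in the last hypothesis almost vanishes.\<close>

lemma product_le_tangent:
  assumes y: "0 \<le> y1" "0 \<le> y2" "0 \<le> y3" and r: "0 < r1" "0 < r2" "0 < (r3::real)"
    and \<delta>: "0 \<le> \<delta>" "\<delta> \<le> 1"
    and tangents: "real e1 * (y1 / r1 - 1) + real e2 * (y2 / r2 - 1) + real e3 * (y3 / r3 - 1) \<le> \<delta>"
  shows "y1 ^ e1 * y2 ^ e2 * y3 ^ e3 \<le> r1 ^ e1 * r2 ^ e2 * r3 ^ e3 * (1 + \<delta> + \<delta> ^ 2)"
proof -
  let ?E = "\<lambda>e y r. exp (real e * (y / r - 1))"
  have "y1 ^ e1 * y2 ^ e2 * y3 ^ e3 \<le>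
      (r1 ^ e1 * ?E e1 y1 r1) * (r2 ^ e2 * ?E e2 y2 r2) * (r3 ^ e3 * ?E e3 y3 r3)"
    using y r by (intro mult_mono power_le_tangent) auto
  also have "\<dots> = r1 ^ e1 * r2 ^ e2 * r3 ^ e3 *
      exp (real e1 * (y1 / r1 - 1) + real e2 * (y2 / r2 - 1) + real e3 * (y3 / r3 - 1))"
    by (simp add: exp_add)
  also have "\<dots> \<le> r1 ^ e1 * r2 ^ e2 * r3 ^ e3 * exp \<delta>" using r tangents by (intro mult_left_mono) auto
  also have "\<dots> \<le> r1 ^ e1 * r2 ^ e2 * r3 ^ e3 * (1 + \<delta> + \<delta> ^ 2)"
    using r \<delta> exp_bound[of \<delta>] by (intro mult_left_mono) auto
  finally show ?thesis .
qed

lemma quintic_test_poly_le: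
  fixes w :: real
  assumes "0 \<le> w" "w \<le> 1 / 4"
  shows "w ^ 5 * (1 - 4 * w) * \<bar>1 - 5 * w\<bar> \<le> 1 / 10 ^ 5"
proof (cases "w \<le> 1 / 5")
  case True
  have "w ^ 5 * (1 - 4 * w) ^ 1 * (1 - 5 * w) ^ 1 \<le>
      (31 / 200) ^ 5 * (19 / 50) ^ 1 * (9 / 40) ^ 1 * (1 + 8 / 100 + (8 / 100) ^ 2)"
    using assms True by (intro product_le_tangent) (auto simp: field_simps)
  also have "\<dots> \<le> 1 / 10 ^ 5" by (simp add: power_divide)
  finally show ?thesis using True by simp
next
  case False
  have "w ^ 5 * (1 - 4 * w) ^ 1 * (5 * w - 1) ^ 1 \<le>
      (23 / 100) ^ 5 * (2 / 25) ^ 1 * (3 / 20) ^ 1 * (1 + 11 / 100 + (11 / 100) ^ 2)"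
    using assms False by (intro product_le_tangent) (auto simp: field_simps)
  also have "\<dots> \<le> 1 / 10 ^ 5" by (simp add: power_divide)
  finally show ?thesis using False by simp
qed

lemma test_poly_7_le:
  fixes w :: real
  assumes "0 \<le> w" "w \<le> 1 / 4"
  shows "w ^ 2 * (1 - 4 * w) * (1 - 7 * w) ^ 2 \<le> 1 / 526"
proof (cases "w \<le> 1 / 7")
  case True
  have "w ^ 2 * (1 - 4 * w) ^ 1 * (1 - 7 * w) ^ 2 \<le>
      (13 / 200) ^ 2 * (37 / 50) ^ 1 * (109 / 200) ^ 2 * (1 + 3 / 100 + (3 / 100) ^ 2)"
    using assms True by (intro product_le_tangent) (auto simp: field_simps)
  also have "\<dots> \<le> 1 / 526" by (simp add: power_divide)
  finally show ?thesis by simp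
next
  case False
  have "w ^ 2 * (1 - 4 * w) ^ 1 * (7 * w - 1) ^ 2 \<le>
      (11 / 50) ^ 2 * (3 / 25) ^ 1 * (27 / 50) ^ 2 * (1 + 6 / 100 + (6 / 100) ^ 2)"
    using assms False by (intro product_le_tangent) (auto simp: field_simps)
  also have "\<dots> \<le> 1 / 526" by (simp add: power_divide)
  finally show ?thesis by (simp add: power2_commute)
qed

lemma test_poly_5_le:
  fixes w :: real
  assumes "w \<le> 1 / 4"
  shows "w * (1 - 5 * w) ^ 2 \<le> 4 / 135"
proof -
  have "0 \<le> 25 * (w - 1 / 15) ^ 2 * (4 / 15 - w)" using assms by simp
  also have "\<dots> = 4 / 135 - w * (1 - 5 * w) ^ 2"
    by (simp add: power2_eq_square field_simps)
  finally show ?thesis by simp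
qed

lemma test_poly_3_le:
  fixes u :: real
  assumes "0 \<le> u" "u \<le> 9 / 4"
  shows "u ^ 7 * (1 - u) ^ 6 * \<bar>2 - u\<bar> ^ 9 \<le> 1 / 181"
proof -
  have even: "(u - 1) ^ 6 = (1 - u) ^ 6"
    using power_even_abs[of 6 "u - 1"] power_even_abs[of 6 "1 - u"] by (simp add: abs_minus_commute)
  consider (below) "u \<le> 1" | (between) "1 \<le> u" "u \<le> 2" | (above) "2 \<le> u" by linarith
  thus ?thesis
  proof cases
    case below
    have "u ^ 7 * (1 - u) ^ 6 * (2 - u) ^ 9 \<le>
        (43 / 100) ^ 7 * (57 / 100) ^ 6 * (157 / 100) ^ 9 * (1 + 12 / 1000 + (12 / 1000) ^ 2)"
      using assms below by (intro product_le_tangent) (auto simp: field_simps)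
    also have "\<dots> \<le> 1 / 181" by (simp add: power_divide)
    finally show ?thesis using below by simp
  next
    case between
    have "u ^ 7 * (u - 1) ^ 6 * (2 - u) ^ 9 \<le>
        (37 / 25) ^ 7 * (12 / 25) ^ 6 * (13 / 25) ^ 9 * (1 + 4 / 100 + (4 / 100) ^ 2)"
      using assms between by (intro product_le_tangent) (auto simp: field_simps)
    also have "\<dots> \<le> 1 / 181" by (simp add: power_divide)
    finally show ?thesis using between unfolding even by simp
  next
    case above
    have "u ^ 7 * (u - 1) ^ 6 * (u - 2) ^ 9 \<le> (9 / 4) ^ 7 * (5 / 4) ^ 6 * (1 / 4) ^ 9"
      using assms above by (intro mult_mono power_mono) auto
    also have "\<dots> \<le> 1 / 181" by (simp add: power_divide)
    finally show ?thesis using above unfolding even by simp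
  qed
qed

lemma sin2_conjs_eq_singleton:
  shows "sin2_conjs 3 = {3}" "sin2_conjs 4 = {2}" "sin2_conjs 6 = {1}"
proof -
  have one: "half_totatives d = {1}" if "\<And>k. 0 < k \<Longrightarrow> 2 * k < d \<Longrightarrow> coprime k d \<Longrightarrow> k = 1" "d \<ge> 3" for d
    using that by (auto simp: half_totatives_def)
  have "half_totatives 6 = {1}"
  proof (rule one)
    fix k :: nat assume k: "0 < k" "2 * k < 6" "coprime k 6"
    have "k \<noteq> 2" using k(3) by (auto simp: coprime_iff_gcd_eq_1)
    thus "k = 1" using k by linarith
  qed simp
  moreover have "half_totatives 3 = {1}" "half_totatives 4 = {1}" by (rule one; linarith)+
  ultimately show "sin2_conjs 3 = {3}" "sin2_conjs 4 = {2}" "sin2_conjs 6 = {1}"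
    by (simp_all add: sin2_conjs_def sin_60 sin_45 sin_30 power_divide)
qed

lemma sin_times_sum_cos:
  "sin t * (1 + 2 * (\<Sum>j=1..n. cos (2 * real j * t))) = sin ((2 * real n + 1) * t)"
proof (induction n)
  case (Suc n)
  have "((2 * real (Suc n) + 1) * t - (2 * real n + 1) * t) / 2 = t"
    "((2 * real (Suc n) + 1) * t + (2 * real n + 1) * t) / 2 = 2 * real (Suc n) * t"
    by (simp_all add: field_simps)
  hence "sin ((2 * real (Suc n) + 1) * t) - sin ((2 * real n + 1) * t) =
      2 * sin t * cos (2 * real (Suc n) * t)"
    by (simp only: sin_diff_sin)
  thus ?case using Suc by (simp add: algebra_simps)
qed simp

lemma sum_cos_sin2_conjs:
  assumes "b \<in> sin2_conjs (2 * n + 1)"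
  obtains t where "b = 4 * sin t ^ 2" "1 + 2 * (\<Sum>j=1..n. cos (2 * real j * t)) = 0"
proof -
  obtain k where k: "k \<in> half_totatives (2 * n + 1)"
    "b = 4 * sin (pi * real k / real (2 * n + 1)) ^ 2"
    using assms unfolding sin2_conjs_def by blast
  define t where "t = pi * real k / real (2 * n + 1)"
  have "(2 * real n + 1) * t = pi * real k" by (simp add: t_def field_simps)
  hence "sin t * (1 + 2 * (\<Sum>j=1..n. cos (2 * real j * t))) = 0"
    unfolding sin_times_sum_cos by (simp add: sin_npi2 mult.commute)
  moreover have "sin t > 0" unfolding t_def by (rule sin_half_totative_pos[OF k(1)])
  ultimately show ?thesis using that k(2) by (simp add: t_def)
qed

lemma sin2_conjs_5:
  assumes "b \<in> sin2_conjs 5"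
  shows "b ^ 2 = 5 * b - 5"
proof -
  obtain t where t: "b = 4 * sin t ^ 2" "1 + 2 * (\<Sum>j=1..2. cos (2 * real j * t)) = 0"
    using sum_cos_sin2_conjs[of b 2] assms by auto
  define x where "x = cos (2 * t)"
  have b: "b = 2 - 2 * x" using cos_double_sin[of t] by (simp add: x_def t(1))
  have "cos (4 * t) = 2 * x ^ 2 - 1" using cos_double_cos[of "2 * t"] by (simp add: x_def)
  hence "1 + 2 * x + 2 * (2 * x ^ 2 - 1) = 0" using t(2) by (simp add: x_def numeral_2_eq_2)
  thus ?thesis by (simp add: b power2_eq_square algebra_simps)
qed

lemma sin2_conjs_7:
  assumes "b \<in> sin2_conjs 7"
  shows "b ^ 3 = 7 * (1 - b) ^ 2"
proof -
  obtain t where t: "b = 4 * sin t ^ 2" "1 + 2 * (\<Sum>j=1..3. cos (2 * real j * t)) = 0"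
    using sum_cos_sin2_conjs[of b 3] assms by auto
  define x where "x = cos (2 * t)"
  have b: "b = 2 - 2 * x" using cos_double_sin[of t] by (simp add: x_def t(1))
  have "cos (4 * t) = 2 * x ^ 2 - 1" using cos_double_cos[of "2 * t"] by (simp add: x_def)
  moreover have "cos (6 * t) = 4 * x ^ 3 - 3 * x" using cos_treble_cos[of "2 * t"] by (simp add: x_def)
  ultimately have "1 + 2 * x + 2 * (2 * x ^ 2 - 1) + 2 * (4 * x ^ 3 - 3 * x) = 0"
    using t(2) by (simp add: x_def numeral_3_eq_3 numeral_2_eq_2)
  thus ?thesis by (simp add: b power2_eq_square power3_eq_cube algebra_simps)
qed

text \<open>Since \<open>b\<^sup>3 = 7 (1 - b)\<^sup>2\<close> and \<open>1 - b\<close> is a unit, \<open>7 / b\<^sup>2\<close> is an integral polynomial in \<open>b\<close>.\<close>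

lemma seven_div_square:
  assumes "b \<in> sin2_conjs 7"
  shows "b * (3 + 4 * (1 - b) + (1 - b) ^ 2) ^ 2 = 7 / b ^ 2"
proof -
  define v where "v = 1 - b"
  have relation: "b ^ 3 = 7 * v ^ 2" unfolding v_def by (rule sin2_conjs_7[OF assms])
  hence unit: "v * (3 + 4 * v + v ^ 2) = 1"
    by (simp add: v_def power2_eq_square power3_eq_cube algebra_simps)
  have "b * (3 + 4 * v + v ^ 2) ^ 2 * b ^ 2 = b ^ 3 * (3 + 4 * v + v ^ 2) ^ 2"
    by (simp add: power2_eq_square power3_eq_cube)
  also have "\<dots> = 7 * (v * (3 + 4 * v + v ^ 2)) ^ 2" unfolding relation by (simp add: power_mult_distrib)
  finally have "b * (3 + 4 * v + v ^ 2) ^ 2 * b ^ 2 = 7" unfolding unit by simp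
  thus ?thesis using sin2_conjs_pos[OF assms] by (simp add: v_def field_simps)
qed

definition quintic_test_poly :: "real \<Rightarrow> real \<Rightarrow> real" where
  "quintic_test_poly v b = v ^ 5 * (b ^ 2 + 4 * v) * (b ^ 2 + 5 * v)"

lemma bounded_quintic_test_poly: "bounded_at_conjs d quintic_test_poly 14 (1 / real (10 ^ 5))"
proof (rule bounded_at_conjsI)
  fix b w :: real assume w: "0 \<le> w" "w \<le> 1 / 4"
  have "quintic_test_poly (- (b ^ 2 * w)) b = - (b ^ 14 * (w ^ 5 * (1 - 4 * w) * (1 - 5 * w)))"
    unfolding quintic_test_poly_def by (simp add: power_numeral_reduce algebra_simps)
  hence "\<bar>quintic_test_poly (- (b ^ 2 * w)) b\<bar> = b ^ 14 * (w ^ 5 * (1 - 4 * w) * \<bar>1 - 5 * w\<bar>)"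
    using w by (simp add: abs_mult)
  thus "\<bar>quintic_test_poly (- (b ^ 2 * w)) b\<bar> \<le> b ^ 14 * (1 / real (10 ^ 5))"
    using mult_left_mono[OF quintic_test_poly_le[OF w], of "b ^ 14"] by simp
qed

definition test_poly_3 :: "real \<Rightarrow> real \<Rightarrow> real" where
  "test_poly_3 v b = v ^ 7 * (1 + v) ^ 6 * (2 + v) ^ 9"

lemma bounded_test_poly_3: "bounded_at_conjs 3 test_poly_3 0 (1 / real 181)"
proof (rule bounded_at_conjsI)
  fix b w :: real assume "b \<in> sin2_conjs 3" and w: "0 \<le> w" "w \<le> 1 / 4"
  hence b: "b = 3" by (simp add: sin2_conjs_eq_singleton)
  have "\<bar>test_poly_3 (- (b ^ 2 * w)) b\<bar> = (9 * w) ^ 7 * (1 - 9 * w) ^ 6 * \<bar>2 - 9 * w\<bar> ^ 9"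
    unfolding test_poly_3_def b using w by (simp add: abs_mult power_abs)
  also have "\<dots> \<le> 1 / 181" using w by (intro test_poly_3_le) auto
  finally show "\<bar>test_poly_3 (- (b ^ 2 * w)) b\<bar> \<le> b ^ 0 * (1 / real 181)" by simp
qed

definition test_poly_4 :: "real \<Rightarrow> real \<Rightarrow> real" where
  "test_poly_4 v b = v * (1 + v)"

lemma bounded_test_poly_4: "bounded_at_conjs 4 test_poly_4 0 (1 / real 4)"
proof (rule bounded_at_conjsI)
  fix b w :: real assume "b \<in> sin2_conjs 4" and w: "0 \<le> w" "w \<le> 1 / 4"
  hence b: "b = 2" by (simp add: sin2_conjs_eq_singleton)
  have "\<bar>test_poly_4 (- (b ^ 2 * w)) b\<bar> = 4 * w * (1 - 4 * w)"
    unfolding test_poly_4_def b using w by (simp add: abs_mult)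
  also have "\<dots> \<le> 1 / 4" using quadratic_le[of "4 * w" 1] by simp
  finally show "\<bar>test_poly_4 (- (b ^ 2 * w)) b\<bar> \<le> b ^ 0 * (1 / real 4)" by simp
qed

definition test_poly_5 :: "real \<Rightarrow> real \<Rightarrow> real" where
  "test_poly_5 v b = v * (v + (b - 1)) ^ 2"

lemma test_poly_5_eq:
  assumes "b \<in> sin2_conjs 5"
  shows "test_poly_5 v b = v * (v + b ^ 2 / 5) ^ 2"
  using sin2_conjs_5[OF assms] by (simp add: test_poly_5_def)

lemma bounded_test_poly_5: "bounded_at_conjs 5 test_poly_5 6 (1 / real 843)"
proof (rule bounded_at_conjsI)
  fix b w :: real assume b: "b \<in> sin2_conjs 5" and w: "0 \<le> w" "w \<le> 1 / 4"
  have "test_poly_5 (- (b ^ 2 * w)) b = - (b ^ 6 / 25 * (w * (1 - 5 * w) ^ 2))"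
    unfolding test_poly_5_eq[OF b]
    by (simp add: power2_eq_square power_numeral_reduce field_simps)
  hence "\<bar>test_poly_5 (- (b ^ 2 * w)) b\<bar> = b ^ 6 / 25 * (w * (1 - 5 * w) ^ 2)"
    using w by (simp add: abs_mult)
  also have "\<dots> \<le> b ^ 6 / 25 * (4 / 135)"
    using test_poly_5_le[OF w(2)] by (intro mult_left_mono) auto
  also have "\<dots> \<le> b ^ 6 * (1 / real 843)" by simp
  finally show "\<bar>test_poly_5 (- (b ^ 2 * w)) b\<bar> \<le> b ^ 6 * (1 / real 843)" .
qed

definition test_poly_7 :: "real \<Rightarrow> real \<Rightarrow> real" where
  "test_poly_7 v b =
    v ^ 2 * (b ^ 2 + 4 * v) * (b * (3 + 4 * (1 - b) + (1 - b) ^ 2) ^ 2 * v + 1) ^ 2"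

lemma test_poly_7_eq:
  assumes "b \<in> sin2_conjs 7"
  shows "test_poly_7 v b = v ^ 2 * (b ^ 2 + 4 * v) * (7 / b ^ 2 * v + 1) ^ 2"
  unfolding test_poly_7_def seven_div_square[OF assms] ..

lemma bounded_test_poly_7: "bounded_at_conjs 7 test_poly_7 6 (1 / real 526)"
proof (rule bounded_at_conjsI)
  fix b w :: real assume b: "b \<in> sin2_conjs 7" and w: "0 \<le> w" "w \<le> 1 / 4"
  have "b > 0" by (rule sin2_conjs_pos[OF b])
  hence "7 / b ^ 2 * - (b ^ 2 * w) + 1 = 1 - 7 * w" by simp
  moreover have "b ^ 2 + 4 * - (b ^ 2 * w) = b ^ 2 * (1 - 4 * w)" by (simp add: algebra_simps)
  ultimately have "test_poly_7 (- (b ^ 2 * w)) b =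
      (b ^ 2 * w) ^ 2 * (b ^ 2 * (1 - 4 * w)) * (1 - 7 * w) ^ 2"
    by (simp only: test_poly_7_eq[OF b] power2_minus)
  also have "\<dots> = b ^ 6 * (w ^ 2 * (1 - 4 * w) * (1 - 7 * w) ^ 2)"
    by (simp add: power_mult_distrib flip: power_mult power_add)
  finally have eq: "test_poly_7 (- (b ^ 2 * w)) b = b ^ 6 * (w ^ 2 * (1 - 4 * w) * (1 - 7 * w) ^ 2)" .
  have "0 \<le> b ^ 6 * (w ^ 2 * (1 - 4 * w) * (1 - 7 * w) ^ 2)" using w by simp
  thus "\<bar>test_poly_7 (- (b ^ 2 * w)) b\<bar> \<le> b ^ 6 * (1 / real 526)"
    unfolding eq using mult_left_mono[OF test_poly_7_le[OF w], of "b ^ 6"] by simp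
qed

context norm_bound
begin

lemma degree_less_if_linear_test:
  assumes "d < 512" "degree_test 2 4 (256 ^ 2) d"
  shows "m < degree_limit d"
  by (rule degree_less_degree_limit_if_test[OF assms(1) int_poly2.fst V_pos _ _ _ assms(2)])
    (use V_less_256 bounded_linear_test_poly in simp_all)

lemma degree_less_if_quintic_test:
  assumes "d < 512" "degree_test 14 (10 ^ 5) (20 * 256 ^ 14) d"
  shows "m < degree_limit d"
proof (rule degree_less_degree_limit_if_test[OF assms(1) _ _ _ _ bounded_quintic_test_poly assms(2)])
  define S where "S = four_sin2 d ^ 2"
  have S: "0 \<le> S" "V + S < 256 ^ 2" using V_less by (simp_all add: S_def)
  show "int_poly2 quintic_test_poly" unfolding quintic_test_poly_def by (intro int_poly2_intros)
  show "0 < quintic_test_poly V (four_sin2 d)"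
    unfolding quintic_test_poly_def S_def[symmetric] using V_pos S by (intro mult_pos_pos) auto
  have "quintic_test_poly V (four_sin2 d) < (256 ^ 2) ^ 5 * (4 * 256 ^ 2) * (5 * 256 ^ 2)"
    unfolding quintic_test_poly_def S_def[symmetric] using V_pos S
    by (intro mult_strict_mono power_strict_mono mult_pos_pos) auto
  thus "quintic_test_poly V (four_sin2 d) < real (20 * 256 ^ 14)" by simp
qed simp

lemma degree_less_3:
  assumes "d = 3"
  shows "m < degree_limit d"
proof (rule degree_less_degree_limit_if_test)
  have s: "four_sin2 d = 3"
    using four_sin2_in_sin2_conjs[OF d_ge_3] assms by (simp add: sin2_conjs_eq_singleton)
  have V: "V + 9 < 256 ^ 2" using V_less unfolding s by simp
  show "int_poly2 test_poly_3" unfolding test_poly_3_def by (intro int_poly2_intros)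
  show "0 < test_poly_3 V (four_sin2 d)" using V_pos by (simp add: test_poly_3_def)
  have "test_poly_3 V (four_sin2 d) < (256 ^ 2) ^ 7 * (256 ^ 2) ^ 6 * (256 ^ 2) ^ 9"
    unfolding test_poly_3_def using V_pos V by (intro mult_strict_mono power_strict_mono) auto
  thus "test_poly_3 V (four_sin2 d) < real (256 ^ 44)" by simp
  show "bounded_at_conjs d test_poly_3 0 (1 / real 181)"
    unfolding assms by (rule bounded_test_poly_3)
  show "degree_test 0 181 (256 ^ 44) d" unfolding assms by code_simp
qed (use assms in simp_all)

lemma degree_less_4:
  assumes "d = 4"
  shows "m < degree_limit d"
proof (rule degree_less_degree_limit_if_test)
  have s: "four_sin2 d = 2"
    using four_sin2_in_sin2_conjs[OF d_ge_3] assms by (simp add: sin2_conjs_eq_singleton)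
  have V: "V + 4 < 256 ^ 2" using V_less unfolding s by simp
  show "int_poly2 test_poly_4" unfolding test_poly_4_def by (intro int_poly2_intros)
  show "0 < test_poly_4 V (four_sin2 d)" using V_pos by (simp add: test_poly_4_def)
  have "test_poly_4 V (four_sin2 d) < 256 ^ 2 * 256 ^ 2"
    unfolding test_poly_4_def using V_pos V by (intro mult_strict_mono) auto
  thus "test_poly_4 V (four_sin2 d) < real (256 ^ 4)" by simp
  show "bounded_at_conjs d test_poly_4 0 (1 / real 4)"
    unfolding assms by (rule bounded_test_poly_4)
  show "degree_test 0 4 (256 ^ 4) d" unfolding assms by code_simp
qed (use assms in simp_all)

lemma degree_less_5:
  assumes "d = 5"
  shows "m < degree_limit d"
proof (rule degree_less_degree_limit_if_test)
  define S where "S = four_sin2 d ^ 2"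
  have S: "0 \<le> S" "V + S < 256 ^ 2" using V_less by (simp_all add: S_def)
  have eq: "test_poly_5 V (four_sin2 d) = V * (V + S / 5) ^ 2"
    using four_sin2_in_sin2_conjs[OF d_ge_3] unfolding assms S_def by (rule test_poly_5_eq)
  show "int_poly2 test_poly_5" unfolding test_poly_5_def by (intro int_poly2_intros)
  show "0 < test_poly_5 V (four_sin2 d)" unfolding eq using V_pos S by (intro mult_pos_pos) auto
  have "test_poly_5 V (four_sin2 d) < 256 ^ 2 * (256 ^ 2) ^ 2"
    unfolding eq using V_pos S by (intro mult_strict_mono power_strict_mono) auto
  thus "test_poly_5 V (four_sin2 d) < real (256 ^ 6)" by simp
  show "bounded_at_conjs d test_poly_5 6 (1 / real 843)"
    unfolding assms by (rule bounded_test_poly_5)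
  show "degree_test 6 843 (256 ^ 6) d" unfolding assms by code_simp
qed (use assms in simp_all)

lemma degree_less_6:
  assumes "d = 6"
  shows "m < degree_limit d"
proof (rule degree_less_degree_limit_if_test[OF _ int_poly2.fst V_pos])
  show "V < real (256 ^ 2)" using V_less_256 by simp
  show "bounded_at_conjs d (\<lambda>v b. v) 0 (1 / real 4)"
    by (rule bounded_at_conjsI) (simp add: assms sin2_conjs_eq_singleton)
  show "degree_test 0 4 (256 ^ 2) d" unfolding assms by code_simp
qed (use assms in simp_all)

lemma seven_V_div_square_less:
  assumes "d = 7"
  shows "7 / four_sin2 d ^ 2 * V + 1 < 13 * 256 ^ 2"
proof -
  define S where "S = four_sin2 d ^ 2"
  have "74 / 100 \<le> four_sin2 d"
    using four_sin2_lower[OF d_ge_3] by (simp add: assms)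
  hence lower: "(74 / 100) ^ 2 \<le> S" unfolding S_def by (intro power_mono) auto
  hence S: "0 < S" "V + S < 256 ^ 2" using V_less by (auto simp: S_def)
  have "7 / S * V + 1 = (7 * V + S) / S" using S by (simp add: field_simps)
  also have "\<dots> \<le> (7 * 256 ^ 2) / (74 / 100) ^ 2"
    using V_pos S lower by (intro frac_le) auto
  also have "\<dots> < 13 * 256 ^ 2" by (simp add: power_divide)
  finally show ?thesis unfolding S_def .
qed

lemma degree_less_7:
  assumes "d = 7"
  shows "m < degree_limit d"
proof (rule degree_less_degree_limit_if_test)
  define S where "S = four_sin2 d ^ 2"
  have S: "0 < S" "V + S < 256 ^ 2"
    using V_less sin2_conjs_pos[OF four_sin2_in_sin2_conjs[OF d_ge_3]] by (auto simp: S_def)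
  have eq: "test_poly_7 V (four_sin2 d) = V ^ 2 * (S + 4 * V) * (7 / S * V + 1) ^ 2"
    using four_sin2_in_sin2_conjs[OF d_ge_3] unfolding assms S_def by (rule test_poly_7_eq)
  have last_factor: "7 / S * V + 1 < 13 * 256 ^ 2"
    unfolding S_def by (rule seven_V_div_square_less[OF assms])
  show "int_poly2 test_poly_7" unfolding test_poly_7_def by (intro int_poly2_intros)
  show "0 < test_poly_7 V (four_sin2 d)"
    unfolding eq using V_pos S by (intro mult_pos_pos zero_less_power add_pos_pos) auto
  have "test_poly_7 V (four_sin2 d) < (256 ^ 2) ^ 2 * (4 * 256 ^ 2) * (13 * 256 ^ 2) ^ 2"
    unfolding eq using V_pos S last_factor
    by (intro mult_strict_mono power_strict_mono mult_pos_pos) auto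
  thus "test_poly_7 V (four_sin2 d) < real (4 * 13 ^ 2 * 256 ^ 10)" by simp
  show "bounded_at_conjs d test_poly_7 6 (1 / real 526)"
    unfolding assms by (rule bounded_test_poly_7)
  show "degree_test 6 526 (4 * 13 ^ 2 * 256 ^ 10) d" unfolding assms by code_simp
qed (use assms in simp_all)

end

section \<open>The list of degrees\<close>

lemma degree_tests:
  "list_all (\<lambda>d. if d \<in> {9, 11, 13, 17, 37} then degree_test 14 (10 ^ 5) (20 * 256 ^ 14) d
    else degree_test 2 4 (256 ^ 2) d) [8..<210]"
  by code_simp

lemma (in norm_bound) degree_less_degree_limit: "m < degree_limit d"
proof -
  consider (small) "d = 3 \<or> d = 4 \<or> d = 5 \<or> d = 6 \<or> d = 7"
    | (medium) "8 \<le> d" "d < 210" | (large) "d \<ge> 210"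
    using d_ge_3 by linarith
  thus ?thesis
  proof cases
    case small
    thus ?thesis
      using degree_less_3 degree_less_4 degree_less_5 degree_less_6 degree_less_7 by blast
  next
    case medium
    hence "d < 512" and "d \<in> set [8..<210]"
      unfolding set_upt atLeastLessThan_iff by linarith+
    thus ?thesis
      using degree_tests degree_less_if_quintic_test degree_less_if_linear_test
      unfolding list_all_iff by meson
  next
    case large
    thus ?thesis using degree_zero_if_large by (simp add: degree_limit_def)
  qed
qed

lemma totient_mbound_le_qbound_list:
  "list_all (\<lambda>d. d \<in> admissible_d \<longrightarrow> totient d * mbound d \<le> 2 * qbound d) [3..<121]"
  by code_simp

lemma totient_mbound_le_qbound:
  assumes "d \<in> admissible_d"
  shows "totient d * mbound d \<le> 2 * qbound d"
proof -
  have "3 \<le> d" "d < 121" using assms by (auto simp: admissible_d_def)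
  hence "d \<in> set [3..<121]" unfolding set_upt atLeastLessThan_iff by blast
  thus ?thesis using totient_mbound_le_qbound_list assms unfolding list_all_iff by blast
qed

theorem theorem4p5:
  fixes d :: nat and \<alpha> :: real
  assumes "d \<ge> 3"
    and "algebraic_int \<alpha>" and "totally_real \<alpha>"
    and "4 < \<alpha>" and "\<alpha> < 16 ^ 2"
    and "\<forall>\<sigma>. real_emb (gen_field (Fd d \<union> {\<alpha>})) \<sigma> \<and>
              (\<exists>x\<in>gen_field (Fd d \<union> {\<alpha>}). \<sigma> x \<noteq> x) \<longrightarrow>
              0 < \<sigma> \<alpha> \<and> \<sigma> \<alpha> < \<sigma> (4 * sin (pi / real d) ^ 2)"
  shows "gen_field (Fd d \<union> {\<alpha>}) = gen_field {\<alpha>} \<and>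
         d \<in> admissible_d \<and>
         fdeg (gen_field (Fd d \<union> {\<alpha>})) (Fd d) \<le> mbound d \<and>
         fdeg (gen_field (Fd d \<union> {\<alpha>})) (gen_field {}) \<le> qbound d"
proof -
  interpret small_conjugates d \<alpha> by unfold_locales (use assms in blast)+
  obtain m where m: "0 < m" "fdeg K (Fd d) \<le> m" "fdeg K (gen_field {}) \<le> m * card (half_totatives d)"
    "norm_bound d V m"
    by (rule degree_bounds)
  have "m < degree_limit d" by (rule norm_bound.degree_less_degree_limit[OF m(4)])
  hence d: "d \<in> admissible_d" and m_le: "m \<le> mbound d"
    using m(1) by (auto simp: degree_limit_def split: if_splits)
  have "2 * (m * card (half_totatives d)) = totient d * m"
    using totient_eq_half_totatives[OF assms(1)] by simp
  also have "\<dots> \<le> totient d * mbound d" using m_le by simp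
  also have "\<dots> \<le> 2 * qbound d" by (rule totient_mbound_le_qbound[OF d])
  finally have "fdeg K (gen_field {}) \<le> qbound d" using m(3) by simp
  thus ?thesis using K_eq_gen_field_\<alpha> d m(2) m_le by simp
qed

end
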